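(* Let $X$ be a finite biquandle, and let $L_1, L_2$ be oriented virtual links. If the biquandle counting invariant of $L_i$ with respect to $X$ is exactly $|X|^{b_2(L_i)}$, that is, $|\mathrm{Hom}(X_{L_i},X)| = |X|^{b_2(L_i)}$, for $i=1,2$, then the quiver enhancements of $L_1$ and $L_2$ are isomorphic: for every subset $S\subseteq \mathrm{Hom}(X,X)$, the biquandle coloring quivers $\mathcal{Q}^S_X(L_1)$ and $\mathcal{Q}^S_X(L_2)$ are isomorphic as directed graphs.
   Context: A biquandle is a set $X$ with two binary operations $\overline{\triangleright},\underline{\triangleright}$ such that: (i) $x\,\overline{\triangleright}\,x=x\,\underline{\triangleright}\,x$ for all $x$; (ii) the maps $\alpha_y(x)=x\,\overline{\triangleright}\,y$, $\beta_y(x)=x\,\underline{\triangleright}\,y$ on $X$ and $S(x,y)=(y\,\overline{\triangleright}\,x,\;x\,\underline{\triangleright}\,y)$ on $X\times X$ are invertible; (iii) for all $x,y,z$: $(x\overline{\triangleright}y)\overline{\triangleright}(z\overline{\triangleright}y)=(x\overline{\triangleright}z)\overline{\triangleright}(y\underline{\triangleright}z)$, $(x\underline{\triangleright}y)\overline{\triangleright}(z\underline{\triangleright}y)=(x\overline{\triangleright}z)\underline{\triangleright}(y\overline{\triangleright}z)$, $(x\underline{\triangleright}y)\underline{\triangleright}(z\underline{\triangleright}y)=(x\underline{\triangleright}z)\underline{\triangleright}(y\overline{\triangleright}z)$. A biquandle homomorphism is a map preserving both operations; $\mathrm{Hom}(X,Y)$ is the set of biquandle homomorphisms from $X$ to $Y$.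 Given an oriented virtual link diagram $D$ of $L$, a semiarc is an edge of $D$ when classical crossings are viewed as 4-valent vertices (labels are unchanged through virtual crossings). The fundamental biquandle $X_L$ is generated by the semiarcs, with two relations at each classical crossing: if $x$ is the under-semiarc lying to the left of the oriented overstrand and $y$ is the over-semiarc lying to the left of the oriented understrand, then the other under-semiarc is $x\,\underline{\triangleright}\,y$ and the other over-semiarc is $y\,\overline{\triangleright}\,x$. Elements of $\mathrm{Hom}(X_L,X)$ correspond to labelings of the semiarcs of $D$ by elements of $X$ satisfying these relations. The biquandle counting invariant of $L$ with respect to $X$ is $|\mathrm{Hom}(X_L,X)|$. For $S\subseteq \mathrm{Hom}(X,X)$, the biquandle coloring quiver $\mathcal{Q}^S_X(L)$ (the quiver enhancement of the counting invariant) is the directed graph with vertex set $\mathrm{Hom}(X_L,X)$ and, for each vertex $v$ and each $\varphi\in S$, an edge from $v$ to $\varphi\circ v$. The second bridge index $b_2(L)$ is the minimum, over all diagrams $D$ in $\mathbb{R}^2$ representing $L$, of the number of local maxima of the standard height function $h:\mathbb{R}^2\to\mathbb{R}$ restricted to $D$ (with $D$ generic with respect to $h$).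
   Formalization: The formal theorem also assumes that the two counting invariants are equal; without this the claim fails (two-element trivial biquandle, unknot with 2 colorings versus two-component unlink with 4), and isomorphic quivers always satisfy it. *)

theory Defs
  imports "HOL-Analysis.Analysis" "Graph_Theory.Digraph_Isomorphism"
begin

section \<open>Biquandles\<close>

record 'a biquandle_struct =
  carrier :: "'a set"
  ovr :: "'a \<Rightarrow> 'a \<Rightarrow> 'a"   (* the overlined operation *)
  unr :: "'a \<Rightarrow> 'a \<Rightarrow> 'a"   (* the underlined operation *)

locale biquandle =
  fixes X :: "'a biquandle_struct"
  assumes diag: "x \<in> carrier X \<Longrightarrow> ovr X x x = unr X x x"
    and ovr_bij: "y \<in> carrier X \<Longrightarrow> bij_betw (\<lambda>x. ovr X x y) (carrier X) (carrier X)"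
    and unr_bij: "y \<in> carrier X \<Longrightarrow> bij_betw (\<lambda>x. unr X x y) (carrier X) (carrier X)"
    and S_bij: "bij_betw (\<lambda>(x, y). (ovr X y x, unr X x y))
                  (carrier X \<times> carrier X) (carrier X \<times> carrier X)"
    and exchange1: "\<lbrakk>x \<in> carrier X; y \<in> carrier X; z \<in> carrier X\<rbrakk> \<Longrightarrow>
          ovr X (ovr X x y) (ovr X z y) = ovr X (ovr X x z) (unr X y z)"
    and exchange2: "\<lbrakk>x \<in> carrier X; y \<in> carrier X; z \<in> carrier X\<rbrakk> \<Longrightarrow>
          ovr X (unr X x y) (unr X z y) = unr X (ovr X x z) (ovr X y z)"
    and exchange3: "\<lbrakk>x \<in> carrier X; y \<in> carrier X; z \<in> carrier X\<rbrakk> \<Longrightarrow>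
          unr X (unr X x y) (unr X z y) = unr X (unr X x z) (ovr X y z)"

(* Homomorphisms are taken extensional, so that Hom X Y is in bijection with the maps on carriers. *)
definition Hom :: "'a biquandle_struct \<Rightarrow> 'b biquandle_struct \<Rightarrow> ('a \<Rightarrow> 'b) set" where
  "Hom X Y = {f \<in> carrier X \<rightarrow>\<^sub>E carrier Y.
     \<forall>x \<in> carrier X. \<forall>y \<in> carrier X.
       f (ovr X x y) = ovr Y (f x) (f y) \<and> f (unr X x y) = unr Y (f x) (f y)}"

subsection \<open>Biquandles presented by generators and relations\<close>

(* The last four constructors are the inverse operations witnessing the invertibility axioms:
   OvrInv _ y and UnrInv _ y invert alpha_y and beta_y, and (SInv1 u v, SInv2 u v) is the
   preimage of (u, v) under S. *)
datatype 'g bq_term =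
    Gen 'g
  | OvrT "'g bq_term" "'g bq_term"
  | UnrT "'g bq_term" "'g bq_term"
  | OvrInv "'g bq_term" "'g bq_term"
  | UnrInv "'g bq_term" "'g bq_term"
  | SInv1 "'g bq_term" "'g bq_term"
  | SInv2 "'g bq_term" "'g bq_term"

inductive bq_eq :: "('g bq_term \<times> 'g bq_term) set \<Rightarrow> 'g bq_term \<Rightarrow> 'g bq_term \<Rightarrow> bool"
  for R where
  relator: "(s, t) \<in> R \<Longrightarrow> bq_eq R s t"
| refl: "bq_eq R t t"
| sym: "bq_eq R s t \<Longrightarrow> bq_eq R t s"
| trans: "bq_eq R s t \<Longrightarrow> bq_eq R t u \<Longrightarrow> bq_eq R s u"
| cong_OvrT: "bq_eq R s s' \<Longrightarrow> bq_eq R t t' \<Longrightarrow> bq_eq R (OvrT s t) (OvrT s' t')"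
| cong_UnrT: "bq_eq R s s' \<Longrightarrow> bq_eq R t t' \<Longrightarrow> bq_eq R (UnrT s t) (UnrT s' t')"
| cong_OvrInv: "bq_eq R s s' \<Longrightarrow> bq_eq R t t' \<Longrightarrow> bq_eq R (OvrInv s t) (OvrInv s' t')"
| cong_UnrInv: "bq_eq R s s' \<Longrightarrow> bq_eq R t t' \<Longrightarrow> bq_eq R (UnrInv s t) (UnrInv s' t')"
| cong_SInv1: "bq_eq R s s' \<Longrightarrow> bq_eq R t t' \<Longrightarrow> bq_eq R (SInv1 s t) (SInv1 s' t')"
| cong_SInv2: "bq_eq R s s' \<Longrightarrow> bq_eq R t t' \<Longrightarrow> bq_eq R (SInv2 s t) (SInv2 s' t')"
| ax_diag: "bq_eq R (OvrT x x) (UnrT x x)"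
| ax_ovr1: "bq_eq R (OvrT (OvrInv x y) y) x"
| ax_ovr2: "bq_eq R (OvrInv (OvrT x y) y) x"
| ax_unr1: "bq_eq R (UnrT (UnrInv x y) y) x"
| ax_unr2: "bq_eq R (UnrInv (UnrT x y) y) x"
| ax_S1: "bq_eq R (OvrT (SInv2 u v) (SInv1 u v)) u"
| ax_S2: "bq_eq R (UnrT (SInv1 u v) (SInv2 u v)) v"
| ax_S3: "bq_eq R (SInv1 (OvrT y x) (UnrT x y)) x"
| ax_S4: "bq_eq R (SInv2 (OvrT y x) (UnrT x y)) y"
| ax_ex1: "bq_eq R (OvrT (OvrT x y) (OvrT z y)) (OvrT (OvrT x z) (UnrT y z))"
| ax_ex2: "bq_eq R (OvrT (UnrT x y) (UnrT z y)) (UnrT (OvrT x z) (OvrT y z))"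
| ax_ex3: "bq_eq R (UnrT (UnrT x y) (UnrT z y)) (UnrT (UnrT x z) (OvrT y z))"

definition bq_terms :: "'g set \<Rightarrow> 'g bq_term set" where
  "bq_terms A = {t. set_bq_term t \<subseteq> A}"

definition bq_rel :: "'g set \<Rightarrow> ('g bq_term \<times> 'g bq_term) set \<Rightarrow> ('g bq_term \<times> 'g bq_term) set" where
  "bq_rel A R = {(s, t). s \<in> bq_terms A \<and> t \<in> bq_terms A \<and> bq_eq R s t}"

definition presented_biquandle ::
  "'g set \<Rightarrow> ('g bq_term \<times> 'g bq_term) set \<Rightarrow> 'g bq_term set biquandle_struct" where
  "presented_biquandle A R =
    \<lparr>carrier = bq_terms A // bq_rel A R,
     ovr = (\<lambda>a b. bq_rel A R `` {OvrT s t | s t. s \<in> a \<and> t \<in> b}),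
     unr = (\<lambda>a b. bq_rel A R `` {UnrT s t | s t. s \<in> a \<and> t \<in> b})\<rparr>"

section \<open>Oriented virtual link diagrams in the plane\<close>

type_synonym point = "real \<times> real"

(* Edge (i, j) is the oriented segment from vertex j to vertex j+1 (cyclically) of component i. *)
type_synonym edge = "nat \<times> nat"

(* Diagrams are piecewise linear: each component is an oriented closed polygon, given by its
   vertices in order.  A pair (e, f) in over_rel means that the edges e and f meet in a classical
   crossing at which e passes over f.  All other double points are virtual crossings. *)
record vdiagram =
  comps :: "point list list"
  over_rel :: "(edge \<times> edge) set"

definition edges :: "vdiagram \<Rightarrow> edge set" where
  "edges D = {(i, j). i < length (comps D) \<and> j < length (comps D ! i)}"

definition next_edge :: "vdiagram \<Rightarrow> edge \<Rightarrow> edge" where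
  "next_edge D e = (fst e, (snd e + 1) mod length (comps D ! fst e))"

definition src :: "vdiagram \<Rightarrow> edge \<Rightarrow> point" where
  "src D e = comps D ! fst e ! snd e"

definition tgt :: "vdiagram \<Rightarrow> edge \<Rightarrow> point" where
  "tgt D e = src D (next_edge D e)"

definition closed_edge :: "vdiagram \<Rightarrow> edge \<Rightarrow> point set" where
  "closed_edge D e = closed_segment (src D e) (tgt D e)"

definition open_edge :: "vdiagram \<Rightarrow> edge \<Rightarrow> point set" where
  "open_edge D e = open_segment (src D e) (tgt D e)"

definition crosses :: "vdiagram \<Rightarrow> edge \<Rightarrow> edge \<Rightarrow> bool" where
  "crosses D e f \<longleftrightarrow> e \<in> edges D \<and> f \<in> edges D \<and> e \<noteq> f \<and> open_edge D e \<inter> open_edge D f \<noteq> {}"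

definition crossing_point :: "vdiagram \<Rightarrow> edge \<Rightarrow> edge \<Rightarrow> point" where
  "crossing_point D e f = (THE p. p \<in> open_edge D e \<inter> open_edge D f)"

(* General position: the only multiple points are transversal double points in the interior
   of two edges. *)
definition virtual_diagram :: "vdiagram \<Rightarrow> bool" where
  "virtual_diagram D \<longleftrightarrow>
     (\<forall>P \<in> set (comps D). length P \<ge> 3) \<and>
     (\<forall>e \<in> edges D. src D e \<noteq> tgt D e) \<and>
     (\<forall>e \<in> edges D. closed_edge D e \<inter> closed_edge D (next_edge D e) = {tgt D e}) \<and>
     (\<forall>e \<in> edges D. \<forall>f \<in> edges D. e \<noteq> f \<and> f \<noteq> next_edge D e \<and> e \<noteq> next_edge D f \<longrightarrow>
        closed_edge D e \<inter> closed_edge D f = {} \<or>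
        (\<exists>p \<in> open_edge D e \<inter> open_edge D f. closed_edge D e \<inter> closed_edge D f = {p})) \<and>
     (\<forall>e \<in> edges D. \<forall>f \<in> edges D. \<forall>g \<in> edges D. e \<noteq> f \<and> f \<noteq> g \<and> e \<noteq> g \<longrightarrow>
        closed_edge D e \<inter> closed_edge D f \<inter> closed_edge D g = {}) \<and>
     (\<forall>(e, f) \<in> over_rel D. crosses D e f \<and> (f, e) \<notin> over_rel D)"

subsection \<open>Gauss diagrams\<close>

(* Passage through a classical crossing with a given label and sign. *)
datatype 'c passage = Over 'c int | Under 'c int

(* One word per component, read cyclically along the orientation. *)
type_synonym 'c gauss = "'c passage list list"

(* Positive iff the pair (over direction, under direction) is positively oriented. *)
definition crossing_sign :: "vdiagram \<Rightarrow> edge \<Rightarrow> edge \<Rightarrow> int" where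
  "crossing_sign D e f =
    (let u = tgt D e - src D e; v = tgt D f - src D f
     in if fst u * snd v - snd u * fst v > 0 then 1 else -1)"

(* A crossing is labelled by the pair (over-edge, under-edge). *)
definition passage_of :: "vdiagram \<Rightarrow> edge \<Rightarrow> edge \<Rightarrow> (edge \<times> edge) passage" where
  "passage_of D e f =
    (if (e, f) \<in> over_rel D then Over (e, f) (crossing_sign D e f)
     else Under (f, e) (crossing_sign D f e))"

definition edge_word :: "vdiagram \<Rightarrow> edge \<Rightarrow> (edge \<times> edge) passage list" where
  "edge_word D e =
    map (passage_of D e)
      (sorted_key_list_of_set (\<lambda>f. dist (src D e) (crossing_point D e f))
         {f. (e, f) \<in> over_rel D \<or> (f, e) \<in> over_rel D})"

definition gauss_of :: "vdiagram \<Rightarrow> (edge \<times> edge) gauss" where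
  "gauss_of D =
    map (\<lambda>i. concat (map (\<lambda>j. edge_word D (i, j)) [0..<length (comps D ! i)]))
      [0..<length (comps D)]"

(* Equality of Gauss diagrams up to the names of the crossings, the order of the components
   and the choice of a base point on each component. *)
definition gauss_iso :: "'c gauss \<Rightarrow> 'd gauss \<Rightarrow> bool" where
  "gauss_iso G G' \<longleftrightarrow>
    (\<exists>f H. inj_on f (\<Union>w \<in> set G. \<Union>p \<in> set w. set_passage p) \<and>
       mset H = mset (map (map (map_passage f)) G) \<and>
       list_all2 (\<lambda>u v. \<exists>n. v = rotate n u) H G')"

subsection \<open>Virtual links\<close>

definition ordered_by :: "int \<Rightarrow> 'a list \<Rightarrow> 'a list" where
  "ordered_by k xs = (if k = -1 then xs else rev xs)"

(* The words read along the strands inside the disc of a Reidemeister move, before and after the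
   move.  In R3 the strands are top, middle, bottom; a, b, c are the crossings top/middle,
   top/bottom, middle/bottom with signs k, l, m, and q = 1 or -1 tells the two sides of the move
   apart.  If the strands are the lines det (u_i, x) = h_i with directions u_1, u_2, u_3, and q is
   the sign of det (u_2, u_3) h_1 - det (u_1, u_3) h_2 + det (u_1, u_2) h_3, then the top line meets
   the middle line before the bottom line iff q k l = -1, and similarly for the other two lines.
   All eight combinations of k, l, m occur, and these are all the oriented R3 moves. *)
inductive local_move :: "'c passage list list \<Rightarrow> 'c passage list list \<Rightarrow> bool" where
  R1a: "s \<in> {1, -1} \<Longrightarrow> local_move [[]] [[Over a s, Under a s]]"
| R1b: "s \<in> {1, -1} \<Longrightarrow> local_move [[]] [[Under a s, Over a s]]"
| R2a: "s \<in> {1, -1} \<Longrightarrow> local_move [[], []] [[Over a s, Over b (-s)], [Under a s, Under b (-s)]]"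
| R2b: "s \<in> {1, -1} \<Longrightarrow> local_move [[], []] [[Over a s, Over b (-s)], [Under b (-s), Under a s]]"
| R3: "\<lbrakk>k \<in> {1, -1}; l \<in> {1, -1}; m \<in> {1, -1}; q \<in> {1, -1};
       tp = ordered_by (q * k * l) [Over a k, Over b l];
       md = ordered_by (q * k * m) [Under a k, Over c m];
       bt = ordered_by (q * l * m) [Under b l, Under c m]\<rbrakk> \<Longrightarrow>
      local_move [tp, md, bt] [rev tp, rev md, rev bt]"

(* A template is a Gauss diagram with numbered holes (Inl n) to be filled with words. *)
definition fill :: "'c passage list list \<Rightarrow> (nat + 'c passage) list list \<Rightarrow> 'c gauss" where
  "fill ws T = map (\<lambda>w. concat (map (case_sum (\<lambda>n. ws ! n) (\<lambda>p. [p])) w)) T"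

definition reidemeister :: "'c gauss \<Rightarrow> 'c gauss \<Rightarrow> bool" where
  "reidemeister G G' \<longleftrightarrow>
    (\<exists>us vs T. local_move us vs \<and>
       mset [n. w \<leftarrow> T, Inl n \<leftarrow> w] = mset [0..<length us] \<and>
       G = fill us T \<and> G' = fill vs T)"

(* Planar isotopy, the purely virtual moves and the mixed move do not change the Gauss diagram;
   conversely diagrams with the same Gauss diagram are related by these (detour) moves.
   Crossings created by R1 or R2 are automatically new, because in the Gauss diagram of a
   virtual link diagram each label occurs once as Over and once as Under. *)
definition diagram_move :: "vdiagram \<Rightarrow> vdiagram \<Rightarrow> bool" where
  "diagram_move D D' \<longleftrightarrow> virtual_diagram D \<and> virtual_diagram D' \<and>
    (gauss_iso (gauss_of D) (gauss_of D') \<or>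
     (\<exists>G G' :: (edge \<times> edge) gauss.
        gauss_iso (gauss_of D) G \<and> reidemeister G G' \<and> gauss_iso G' (gauss_of D')))"

definition virtual_links :: "vdiagram set set" where
  "virtual_links =
    {D. virtual_diagram D} // {(D, D'). virtual_diagram D \<and> virtual_diagram D' \<and> equivclp diagram_move D D'}"

subsection \<open>The second bridge index\<close>

definition height :: "point \<Rightarrow> real" where
  "height p = snd p"

definition height_generic :: "vdiagram \<Rightarrow> bool" where
  "height_generic D \<longleftrightarrow>
    inj_on height (src D ` edges D \<union> {p. \<exists>e f. crosses D e f \<and> p \<in> open_edge D e \<inter> open_edge D f})"

(* The local maxima sit at vertices; a vertex is represented by the edge e that ends there. *)
definition num_local_maxima :: "vdiagram \<Rightarrow> nat" where
  "num_local_maxima D = card {e \<in> edges D.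
     height (src D e) < height (tgt D e) \<and> height (tgt D (next_edge D e)) < height (tgt D e)}"

definition second_bridge_index :: "vdiagram set \<Rightarrow> nat" where
  "second_bridge_index L = (LEAST n. \<exists>D \<in> L. height_generic D \<and> n = num_local_maxima D)"

section \<open>The fundamental biquandle and the coloring quiver\<close>

(* Semiarc (i, j) leaves passage j of component i.  A component without classical crossings
   is a single semiarc (i, 0). *)
definition semiarcs :: "'c gauss \<Rightarrow> (nat \<times> nat) set" where
  "semiarcs G = {(i, j). i < length G \<and> j < max 1 (length (G ! i))}"

definition semiarc_in :: "'c gauss \<Rightarrow> nat \<Rightarrow> nat \<Rightarrow> nat \<times> nat" where
  "semiarc_in G i j = (i, (j + length (G ! i) - 1) mod length (G ! i))"

definition semiarc_out :: "'c gauss \<Rightarrow> nat \<Rightarrow> nat \<Rightarrow> nat \<times> nat" where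
  "semiarc_out G i j = (i, j)"

(* x is the under-semiarc on the left of the overstrand and y the over-semiarc on the left of the
   understrand; x' and y' are the other under- and over-semiarc.  At a positive crossing the
   understrand runs from right to left of the overstrand and the overstrand from left to right of
   the understrand; at a negative crossing it is the other way round. *)
definition crossing_relators :: "'c gauss \<Rightarrow> ((nat \<times> nat) bq_term \<times> (nat \<times> nat) bq_term) set" where
  "crossing_relators G = {(t, u). \<exists>i j k l c s x y x' y'.
     i < length G \<and> j < length (G ! i) \<and> G ! i ! j = Over c s \<and>
     k < length G \<and> l < length (G ! k) \<and> G ! k ! l = Under c s \<and>
     (x, x') = (if s = 1 then (semiarc_out G k l, semiarc_in G k l)
                else (semiarc_in G k l, semiarc_out G k l)) \<and>
     (y, y') = (if s = 1 then (semiarc_in G i j, semiarc_out G i j)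
                else (semiarc_out G i j, semiarc_in G i j)) \<and>
     ((t, u) = (UnrT (Gen x) (Gen y), Gen x') \<or> (t, u) = (OvrT (Gen y) (Gen x), Gen y'))}"

definition fundamental_biquandle :: "vdiagram \<Rightarrow> (nat \<times> nat) bq_term set biquandle_struct" where
  "fundamental_biquandle D =
    presented_biquandle (semiarcs (gauss_of D)) (crossing_relators (gauss_of D))"

(* One arc (v, phi) for each vertex v and each phi in S; parallel arcs are kept apart. *)
definition coloring_quiver ::
  "'a biquandle_struct \<Rightarrow> ('a \<Rightarrow> 'a) set \<Rightarrow> vdiagram \<Rightarrow>
    ((nat \<times> nat) bq_term set \<Rightarrow> 'a,
     ((nat \<times> nat) bq_term set \<Rightarrow> 'a) \<times> ('a \<Rightarrow> 'a)) pre_digraph" where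
  "coloring_quiver X S D =
    \<lparr>verts = Hom (fundamental_biquandle D) X,
     arcs = Hom (fundamental_biquandle D) X \<times> S,
     tail = fst,
     head = (\<lambda>(v, \<phi>). compose (carrier (fundamental_biquandle D)) \<phi> v)\<rparr>"

end

theory Submission
  imports Defs
begin

text \<open>
  Let $D$ be a diagram of $L$ with $b_2(L)$ local maxima, and scan it from the
  top to the bottom. New strands appear only at local maxima. At a crossing one strand is the
  overstrand and the other the understrand, so the two arcs that come in from above are one over-arc
  and one under-arc; by the invertibility axioms of a biquandle the colors of one over-arc and one
  under-arc at a crossing determine the colors of the other two. Hence a coloring of $D$ by $X$ is
  determined by its values at the local maxima (\<open>coloring_determined_by_maxima\<close>). If the number of
  colorings is exactly $|X|^{b_2(L)}$, then every assignment of colors to the local maxima extends to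
  a unique coloring, and the set of colorings is a full function space $X^I$ with $|I| = b_2(L)$
  (\<open>colorings_free_on_maxima\<close>).

  This bijection is compatible with postcomposition by endomorphisms of $X$: coloring the maxima by
  $\<phi>(g(e))$ gives $\<phi>$ composed with the coloring. The quiver is nothing but the set of
  colorings with the action of $S$ by postcomposition, so it depends only on $X$, $S$ and $|I|$.
  As both links have the same number of colorings, $|X|^{|I_1|} = |X|^{|I_2|}$, which for $|X| \<ge> 2$
  forces $|I_1| = |I_2|$; for $|X| \<le> 1$ each quiver has at most one vertex, and both have equally many.

  The index $b_2(L)$ is attained at some diagram of $L$, while the quiver is formed from an arbitrary
  diagram of $L$. The passage between them has three steps, each of which is an equivariant bijection.
  Homomorphisms from the fundamental biquandle are the same as colorings of the Gauss diagram
  (\<open>Hom_colorings\<close>). Isomorphic Gauss diagrams have the same colorings (\<open>same_colorings_gauss_iso\<close>).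
  A Reidemeister move changes a coloring only inside the disc of the move: for each coloring of the
  boundary of the disc there is at most one extension to the inside, before and after the move, and
  one exists before the move iff one exists after it (\<open>local_move_coloring\<close>,
  \<open>same_colorings_reidemeister\<close>). For the third move this is the content of the exchange laws.

  That $b_2(L)$ is attained requires a diagram in $L$ that is generic with respect to the height
  function; all but finitely many rotations of a given diagram are generic, and a rotation does not
  change the Gauss diagram (\<open>second_bridge_index_attained\<close>).
\<close>

section \<open>Equivariant bijections\<close>

text \<open>
  Two sets with an action of \<open>\<Phi>\<close> are related by a bijection that commutes with the action. The first
  set is required to be stable under the action; stability of the second one follows.
\<close>

definition equivariantly_bijective ::
  "'f set \<Rightarrow> ('f \<Rightarrow> 's \<Rightarrow> 's) \<Rightarrow> 's set \<Rightarrow> ('f \<Rightarrow> 't \<Rightarrow> 't) \<Rightarrow> 't set \<Rightarrow> bool" where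
  "equivariantly_bijective \<Phi> act A act' B \<longleftrightarrow>
     (\<forall>\<phi>\<in>\<Phi>. \<forall>a\<in>A. act \<phi> a \<in> A) \<and>
     (\<exists>F. bij_betw F A B \<and> (\<forall>\<phi>\<in>\<Phi>. \<forall>a\<in>A. F (act \<phi> a) = act' \<phi> (F a)))"

text \<open>
  Most bijections of this development arise as correspondences in which neither side is given by an
  explicit formula in terms of the other. For this reason the introduction rule starts from a relation
  that is total and unique in both directions and that is preserved by the action.
\<close>

lemma equivariantly_bijectiveI:
  assumes "\<And>\<phi> a. \<phi> \<in> \<Phi> \<Longrightarrow> a \<in> A \<Longrightarrow> act \<phi> a \<in> A"
    and "\<And>a. a \<in> A \<Longrightarrow> \<exists>b\<in>B. R a b"
    and "\<And>b. b \<in> B \<Longrightarrow> \<exists>a\<in>A. R a b"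
    and right_unique: "\<And>a b b'. a \<in> A \<Longrightarrow> b \<in> B \<Longrightarrow> b' \<in> B \<Longrightarrow> R a b \<Longrightarrow> R a b' \<Longrightarrow> b = b'"
    and left_unique: "\<And>a a' b. a \<in> A \<Longrightarrow> a' \<in> A \<Longrightarrow> b \<in> B \<Longrightarrow> R a b \<Longrightarrow> R a' b \<Longrightarrow> a = a'"
    and equivariant: "\<And>\<phi> a b. \<phi> \<in> \<Phi> \<Longrightarrow> a \<in> A \<Longrightarrow> b \<in> B \<Longrightarrow> R a b \<Longrightarrow>
           act' \<phi> b \<in> B \<and> R (act \<phi> a) (act' \<phi> b)"
  shows "equivariantly_bijective \<Phi> act A act' B"
proof -
  from assms(2) obtain F where F: "\<And>a. a \<in> A \<Longrightarrow> F a \<in> B \<and> R a (F a)"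
    by metis
  have "inj_on F A"
  proof (rule inj_onI)
    fix a a' assume a: "a \<in> A" "a' \<in> A" "F a = F a'"
    then show "a = a'" using F[OF a(1)] F[OF a(2)] left_unique[OF a(1,2), of "F a"] by simp
  qed
  moreover have "F ` A = B"
  proof
    show "F ` A \<subseteq> B" using F by blast
    show "B \<subseteq> F ` A"
    proof
      fix b assume b: "b \<in> B"
      then obtain a where a: "a \<in> A" "R a b" using assms(3) by blast
      then have "b = F a" using F[OF a(1)] right_unique[OF a(1) b] by blast
      then show "b \<in> F ` A" using a by blast
    qed
  qed
  moreover have "F (act \<phi> a) = act' \<phi> (F a)" if "\<phi> \<in> \<Phi>" "a \<in> A" for \<phi> a
    using F[OF that(2)] F[OF assms(1)[OF that]] equivariant[OF that, of "F a"]
      right_unique[OF assms(1)[OF that]] by blast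
  ultimately show ?thesis
    unfolding equivariantly_bijective_def bij_betw_def using assms(1) by blast
qed

lemma equivariantly_bijective_refl:
  "(\<And>\<phi> a. \<phi> \<in> \<Phi> \<Longrightarrow> a \<in> A \<Longrightarrow> act \<phi> a \<in> A) \<Longrightarrow> equivariantly_bijective \<Phi> act A act A"
  unfolding equivariantly_bijective_def by (auto intro!: exI[of _ id])

lemma equivariantly_bijective_trans:
  assumes "equivariantly_bijective \<Phi> act A act' B" "equivariantly_bijective \<Phi> act' B act'' C"
  shows "equivariantly_bijective \<Phi> act A act'' C"
proof -
  obtain F where F: "bij_betw F A B" "\<And>\<phi> a. \<phi> \<in> \<Phi> \<Longrightarrow> a \<in> A \<Longrightarrow> F (act \<phi> a) = act' \<phi> (F a)"
    using assms(1) unfolding equivariantly_bijective_def by blast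
  obtain G where G: "bij_betw G B C" "\<And>\<phi> b. \<phi> \<in> \<Phi> \<Longrightarrow> b \<in> B \<Longrightarrow> G (act' \<phi> b) = act'' \<phi> (G b)"
    using assms(2) unfolding equivariantly_bijective_def by blast
  have "(G \<circ> F) (act \<phi> a) = act'' \<phi> ((G \<circ> F) a)" if "\<phi> \<in> \<Phi>" "a \<in> A" for \<phi> a
    using F(2)[OF that] G(2)[OF that(1) bij_betwE[OF F(1), rule_format, OF that(2)]] by simp
  with bij_betw_trans[OF F(1) G(1)] assms(1) show ?thesis
    unfolding equivariantly_bijective_def by blast
qed

lemma equivariantly_bijective_sym:
  assumes "equivariantly_bijective \<Phi> act A act' B"
  shows "equivariantly_bijective \<Phi> act' B act A"
proof -
  obtain F where F: "bij_betw F A B" "\<And>\<phi> a. \<phi> \<in> \<Phi> \<Longrightarrow> a \<in> A \<Longrightarrow> F (act \<phi> a) = act' \<phi> (F a)"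
    and closed: "\<And>\<phi> a. \<phi> \<in> \<Phi> \<Longrightarrow> a \<in> A \<Longrightarrow> act \<phi> a \<in> A"
    using assms unfolding equivariantly_bijective_def by blast
  have surj: "\<exists>a\<in>A. b = F a" if "b \<in> B" for b
    using F(1) that unfolding bij_betw_def by blast
  have into: "F a \<in> B" if "a \<in> A" for a
    using F(1) that unfolding bij_betw_def by blast
  have stable: "act' \<phi> b \<in> B" if "\<phi> \<in> \<Phi>" "b \<in> B" for \<phi> b
  proof -
    obtain a where "a \<in> A" "b = F a" using surj \<open>b \<in> B\<close> by blast
    then show ?thesis using into[OF closed] F(2) \<open>\<phi> \<in> \<Phi>\<close> by force
  qed
  show ?thesis
  proof (rule equivariantly_bijectiveI[where R = "\<lambda>b a. b = F a"])
    show "act \<phi> a \<in> A \<and> act' \<phi> b = F (act \<phi> a)"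
      if "\<phi> \<in> \<Phi>" "b \<in> B" "a \<in> A" "b = F a" for \<phi> b a
      using that F(2) closed by simp
    show "a = a'" if "a \<in> A" "a' \<in> A" "b = F a" "b = F a'" for a a' b
      using that F(1) unfolding bij_betw_def inj_on_def by blast
    show "\<exists>b\<in>B. b = F a" if "a \<in> A" for a
      using into[OF that] by blast
    show "b = b'" if "b = F a" "b' = F a" for b b' a using that by simp
  qed (use stable surj in blast)+
qed

section \<open>Crossings as relations in a biquandle\<close>

context biquandle
begin

text \<open>
  At a crossing, \<open>x\<close> is the under-arc on the left of the overstrand, \<open>y\<close> the over-arc on the left of
  the understrand, and \<open>x'\<close>, \<open>y'\<close> are the opposite arcs of the same strands. The pairs of one under-arc
  and one over-arc are \<open>(x, y)\<close>, \<open>(x, y')\<close>, \<open>(x', y)\<close> and \<open>(x', y')\<close>. The lemmas below say that each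
  of them may be prescribed arbitrarily and determines the other two arcs; the four cases correspond
  to the definition of the operations, to the invertibility of \<open>\<alpha>\<close>, of \<open>\<beta>\<close>, and of \<open>S\<close>.
\<close>

definition crossing :: "'a \<Rightarrow> 'a \<Rightarrow> 'a \<Rightarrow> 'a \<Rightarrow> bool" where
  "crossing x y x' y' \<longleftrightarrow>
     x \<in> carrier X \<and> y \<in> carrier X \<and> x' = unr X x y \<and> y' = ovr X y x"

lemma ovr_closed: "x \<in> carrier X \<Longrightarrow> y \<in> carrier X \<Longrightarrow> ovr X x y \<in> carrier X"
  using ovr_bij[of y] by (auto simp: bij_betw_def)

lemma unr_closed: "x \<in> carrier X \<Longrightarrow> y \<in> carrier X \<Longrightarrow> unr X x y \<in> carrier X"
  using unr_bij[of y] by (auto simp: bij_betw_def)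

lemma crossing_carrier:
  "crossing x y x' y' \<Longrightarrow>
     x \<in> carrier X \<and> y \<in> carrier X \<and> x' \<in> carrier X \<and> y' \<in> carrier X"
  by (auto simp: crossing_def ovr_closed unr_closed)

lemma crossing_ex_xy: "x \<in> carrier X \<Longrightarrow> y \<in> carrier X \<Longrightarrow> \<exists>x' y'. crossing x y x' y'"
  by (simp add: crossing_def)

lemma crossing_ex_xy':
  assumes "x \<in> carrier X" "y' \<in> carrier X" shows "\<exists>y x'. crossing x y x' y'"
proof -
  have "y' \<in> (\<lambda>y. ovr X y x) ` carrier X"
    using ovr_bij[OF assms(1)] assms(2) by (simp add: bij_betw_def)
  then show ?thesis using assms(1) unfolding crossing_def by blast
qed

lemma crossing_ex_x'y:
  assumes "x' \<in> carrier X" "y \<in> carrier X" shows "\<exists>x y'. crossing x y x' y'"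
proof -
  have "x' \<in> (\<lambda>x. unr X x y) ` carrier X"
    using unr_bij[OF assms(2)] assms(1) by (simp add: bij_betw_def)
  then show ?thesis using assms(2) unfolding crossing_def by blast
qed

lemma crossing_ex_x'y':
  assumes "x' \<in> carrier X" "y' \<in> carrier X" shows "\<exists>x y. crossing x y x' y'"
proof -
  have "(y', x') \<in> (\<lambda>(x, y). (ovr X y x, unr X x y)) ` (carrier X \<times> carrier X)"
    using S_bij assms by (simp add: bij_betw_def)
  then show ?thesis unfolding crossing_def by auto
qed

lemma crossing_det_xy: "crossing x y p q \<Longrightarrow> crossing x y p' q' \<Longrightarrow> p = p' \<and> q = q'"
  by (simp add: crossing_def)

lemma crossing_det_xy':
  assumes "crossing x y p q" "crossing x y' p' q" shows "y = y' \<and> p = p'"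
proof -
  have "x \<in> carrier X" "y \<in> carrier X" "y' \<in> carrier X" "ovr X y x = ovr X y' x"
    using assms by (auto simp: crossing_def)
  then have "y = y'"
    using ovr_bij[of x] unfolding bij_betw_def inj_on_def by blast
  then show ?thesis using assms by (simp add: crossing_def)
qed

lemma crossing_det_x'y:
  assumes "crossing x y p q" "crossing x' y p q'" shows "x = x' \<and> q = q'"
proof -
  have "x \<in> carrier X" "y \<in> carrier X" "x' \<in> carrier X" "unr X x y = unr X x' y"
    using assms by (auto simp: crossing_def)
  then have "x = x'"
    using unr_bij[of y] unfolding bij_betw_def inj_on_def by blast
  then show ?thesis using assms by (simp add: crossing_def)
qed

lemma crossing_det_x'y':
  assumes "crossing x y p q" "crossing x' y' p q" shows "x = x' \<and> y = y'"
proof -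
  have "(x, y) = (x', y')"
    using S_bij assms unfolding bij_betw_def by (elim conjE inj_onD) (auto simp: crossing_def)
  then show ?thesis by simp
qed

text \<open>
  The three exchange laws are one Reidemeister move of the third kind, with the top, bottom and middle
  strand colored \<open>x\<close>, \<open>y\<close> and \<open>z\<close> where they are sources of crossings: the six boundary arcs of the
  triangle spanned by these also bound a triangle on the other side of the move.
\<close>

lemma crossing_triangle_forward:
  assumes "crossing z x z1 t" "crossing y z b z2" "crossing b t bf tf"
  shows "\<exists>b1 t1 m. crossing y x b1 t1 \<and> crossing b1 z1 bf m \<and> crossing z2 t1 m tf"
proof -
  have c: "x \<in> carrier X" "y \<in> carrier X" "z \<in> carrier X"
    using assms by (auto simp: crossing_def)
  have "ovr X z1 (unr X y x) = unr X z2 (ovr X x y)"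
    "unr X (unr X y x) z1 = bf" "ovr X (ovr X x y) z2 = tf"
    using assms exchange1[OF c(1,2,3)] exchange2[OF c(3,1,2)] exchange3[OF c(2,1,3)]
    by (auto simp: crossing_def)
  then show ?thesis
    using assms c unfolding crossing_def by (auto simp: ovr_closed unr_closed)
qed

text \<open>
  The triangle on the other side is rebuilt from boundary arcs. The forward direction then yields a
  second triangle with the same source arcs as the given one, and the uniqueness of arcs at a crossing
  identifies the two.
\<close>

lemma crossing_triangle_backward:
  assumes "crossing y x b1 t1" "crossing b1 z1 bf m" "crossing z2 t1 m tf"
  shows "\<exists>z t b. crossing z x z1 t \<and> crossing y z b z2 \<and> crossing b t bf tf"
proof -
  obtain z t where z: "crossing z x z1 t"
    using assms crossing_ex_x'y crossing_carrier by meson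
  obtain b z2' where b: "crossing y z b z2'"
    using z assms crossing_ex_xy crossing_carrier by meson
  obtain bf' tf' where f: "crossing b t bf' tf'"
    using z b crossing_ex_xy crossing_carrier by meson
  obtain b1' t1' m' where *: "crossing y x b1' t1'" "crossing b1' z1 bf' m'" "crossing z2' t1' m' tf'"
    using crossing_triangle_forward[OF z b f] by blast
  have 1: "b1' = b1" "t1' = t1" using crossing_det_xy[OF *(1) assms(1)] by auto
  have 2: "bf' = bf" "m' = m" using crossing_det_xy[OF *(2)[unfolded 1] assms(2)] by auto
  have 3: "z2' = z2" "tf' = tf" using crossing_det_x'y[OF *(3)[unfolded 1 2] assms(3)] by auto
  show ?thesis using z b f unfolding 2 3 by blast
qed

lemma crossing_triangle:
  "(\<exists>z t b. crossing z x z1 t \<and> crossing y z b z2 \<and> crossing b t bf tf) \<longleftrightarrow>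
   (\<exists>b1 t1 m. crossing y x b1 t1 \<and> crossing b1 z1 bf m \<and> crossing z2 t1 m tf)"
  using crossing_triangle_forward crossing_triangle_backward by meson

text \<open>
  The remaining oriented moves follow from the canonical one. The canonical move is an identity
  $ABC = CBA$ between the bijections given by the three crossings; multiplying it by the inverse of an
  outer factor moves that crossing to the other side, with the opposite sign: $C^{-1} A B = B A C^{-1}$.
  Concretely, one adds the missing crossing by invertibility, applies the canonical move, and compares.
  Here the moved crossing is the one between the middle and the bottom strand.
\<close>

lemma crossing_triangle_flip_mb:
  "(\<exists>t z1 bf. crossing z x z1 t \<and> crossing b t bf tf \<and> crossing b1 z1 bf m) \<longleftrightarrow>
   (\<exists>y z2 t1. crossing y z b z2 \<and> crossing y x b1 t1 \<and> crossing z2 t1 m tf)"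
proof (intro iffI; elim exE conjE)
  fix t z1 bf assume *: "crossing z x z1 t" "crossing b t bf tf" "crossing b1 z1 bf m"
  obtain y z2 where c: "crossing y z b z2"
    using * crossing_ex_x'y crossing_carrier by meson
  obtain b1' t1' m' where B: "crossing y x b1' t1'" "crossing b1' z1 bf m'" "crossing z2 t1' m' tf"
    using crossing_triangle_forward[OF *(1) c *(2)] by blast
  have "b1' = b1" "m' = m" using crossing_det_x'y[OF B(2) *(3)] by auto
  then show "\<exists>y z2 t1. crossing y z b z2 \<and> crossing y x b1 t1 \<and> crossing z2 t1 m tf"
    using B c by blast
next
  fix y z2 t1 assume *: "crossing y z b z2" "crossing y x b1 t1" "crossing z2 t1 m tf"
  obtain z1 bf where c: "crossing b1 z1 bf m"
    using * crossing_ex_xy' crossing_carrier by meson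
  obtain z' t' b' where B: "crossing z' x z1 t'" "crossing y z' b' z2" "crossing b' t' bf tf"
    using crossing_triangle_backward[OF *(2) c *(3)] by blast
  have "z' = z" "b' = b" using crossing_det_xy'[OF B(2) *(1)] by auto
  then show "\<exists>t z1 bf. crossing z x z1 t \<and> crossing b t bf tf \<and> crossing b1 z1 bf m"
    using B c by blast
qed

text \<open>
  The crossing between the top and the bottom strand becomes an outer factor when the bottom strand is
  traversed in the opposite direction, so that it can be moved in the same way.
\<close>

lemma crossing_triangle_flip_tb:
  "(\<exists>x y z. crossing y x b1 t1 \<and> crossing z x z1 t \<and> crossing y z b z2) \<longleftrightarrow>
   (\<exists>bf m tf. crossing b1 z1 bf m \<and> crossing z2 t1 m tf \<and> crossing b t bf tf)"
proof (intro iffI; elim exE conjE)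
  fix x y z assume *: "crossing y x b1 t1" "crossing z x z1 t" "crossing y z b z2"
  obtain bf tf where c: "crossing b t bf tf"
    using * crossing_ex_xy crossing_carrier by meson
  obtain b1' t1' m' where B: "crossing y x b1' t1'" "crossing b1' z1 bf m'" "crossing z2 t1' m' tf"
    using crossing_triangle_forward[OF *(2,3) c] by blast
  have "b1' = b1" "t1' = t1" using crossing_det_xy[OF B(1) *(1)] by auto
  then show "\<exists>bf m tf. crossing b1 z1 bf m \<and> crossing z2 t1 m tf \<and> crossing b t bf tf"
    using B c by blast
next
  fix bf m tf assume *: "crossing b1 z1 bf m" "crossing z2 t1 m tf" "crossing b t bf tf"
  obtain y x where c: "crossing y x b1 t1"
    using * crossing_ex_x'y' crossing_carrier by meson
  obtain z' t' b' where B: "crossing z' x z1 t'" "crossing y z' b' z2" "crossing b' t' bf tf"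
    using crossing_triangle_backward[OF c *(1,2)] by blast
  have "b' = b" "t' = t" using crossing_det_x'y'[OF B(3) *(3)] by auto
  then show "\<exists>x y z. crossing y x b1 t1 \<and> crossing z x z1 t \<and> crossing y z b z2"
    using B c by blast
qed

lemma crossing_triangle_flip_tm:
  "(\<exists>z2 b tf. crossing z2 t1 m tf \<and> crossing y z b z2 \<and> crossing b t bf tf) \<longleftrightarrow>
   (\<exists>x b1 z1. crossing z x z1 t \<and> crossing y x b1 t1 \<and> crossing b1 z1 bf m)"
proof (intro iffI; elim exE conjE)
  fix z2 b tf assume *: "crossing z2 t1 m tf" "crossing y z b z2" "crossing b t bf tf"
  obtain x z1 where c: "crossing z x z1 t"
    using * crossing_ex_xy' crossing_carrier by meson
  obtain b1' t1' m' where B: "crossing y x b1' t1'" "crossing b1' z1 bf m'" "crossing z2 t1' m' tf"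
    using crossing_triangle_forward[OF c *(2,3)] by blast
  have "t1' = t1" "m' = m" using crossing_det_xy'[OF B(3) *(1)] by auto
  then show "\<exists>x b1 z1. crossing z x z1 t \<and> crossing y x b1 t1 \<and> crossing b1 z1 bf m"
    using B c by blast
next
  fix x b1 z1 assume *: "crossing z x z1 t" "crossing y x b1 t1" "crossing b1 z1 bf m"
  obtain z2 tf where c: "crossing z2 t1 m tf"
    using * crossing_ex_x'y crossing_carrier by meson
  obtain z' t' b' where B: "crossing z' x z1 t'" "crossing y z' b' z2" "crossing b' t' bf tf"
    using crossing_triangle_backward[OF *(2,3) c] by blast
  have "z' = z" "t' = t" using crossing_det_x'y[OF B(1) *(1)] by auto
  then show "\<exists>z2 b tf. crossing z2 t1 m tf \<and> crossing y z b z2 \<and> crossing b t bf tf"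
    using B c by blast
qed

text \<open>
  The arguments are the sign, the incoming and the outgoing arc of the overstrand, and the incoming
  and the outgoing arc of the understrand. At a positive crossing the understrand runs from right to
  left of the overstrand, so that the under-arc on the left is the outgoing one. Changing the sign has
  the same effect as reversing both strands.
\<close>

definition signed_crossing :: "int \<Rightarrow> 'a \<Rightarrow> 'a \<Rightarrow> 'a \<Rightarrow> 'a \<Rightarrow> bool" where
  "signed_crossing s i i' j j' \<longleftrightarrow> (if s = 1 then crossing j' i j i' else crossing j i' j' i)"

end

locale finite_biquandle = biquandle X for X :: "'a biquandle_struct" +
  assumes finite_carrier: "finite (carrier X)"
begin

text \<open>
  The map \<open>S\<close> sends the diagonal to the diagonal by the first biquandle axiom. It is injective, and
  the diagonal is finite, so every diagonal pair is the image of a diagonal pair.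
\<close>

lemma diagonal_surj:
  assumes "z \<in> carrier X" shows "\<exists>x\<in>carrier X. ovr X x x = z"
proof -
  have "inj_on (\<lambda>x. ovr X x x) (carrier X)"
  proof (rule inj_onI)
    fix x y assume *: "x \<in> carrier X" "y \<in> carrier X" "ovr X x x = ovr X y y"
    then have "crossing x x (ovr X x x) (ovr X x x)" "crossing y y (ovr X x x) (ovr X x x)"
      by (simp_all add: crossing_def diag)
    then show "x = y" using crossing_det_x'y' by blast
  qed
  moreover have "(\<lambda>x. ovr X x x) ` carrier X \<subseteq> carrier X"
    using ovr_closed by blast
  ultimately have "(\<lambda>x. ovr X x x) ` carrier X = carrier X"
    using endo_inj_surj[OF finite_carrier] by blast
  then have "z \<in> (\<lambda>x. ovr X x x) ` carrier X" using assms by simp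
  then show ?thesis by blast
qed

text \<open>
  The first Reidemeister move: if the two opposite arcs at a crossing have the same color, as they do
  in a kink, then so do the other two.
\<close>

lemma crossing_loop_target: "crossing x y z z \<Longrightarrow> x = y"
proof -
  assume *: "crossing x y z z"
  then obtain w where w: "w \<in> carrier X" "ovr X w w = z"
    using diagonal_surj crossing_carrier by blast
  then have "crossing w w z z" by (simp add: crossing_def diag)
  then show "x = y" using crossing_det_x'y'[OF *] by blast
qed

lemma crossing_loop_source: "crossing x x y z \<Longrightarrow> y = z"
  by (simp add: crossing_def diag)

lemma crossing_loop_source_ex: "x \<in> carrier X \<Longrightarrow> \<exists>y. crossing x x y y"
  by (simp add: crossing_def diag)

lemma crossing_loop_target_ex: "y \<in> carrier X \<Longrightarrow> \<exists>x. crossing x x y y"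
  using diagonal_surj[of y] diag unfolding crossing_def by force

end

section \<open>Colorings of Gauss diagrams\<close>

text \<open>
  A strand with colors \<open>x\<close>, \<open>ys\<close> is recorded by the color \<open>x\<close> before its first passage and the list
  of colors after each passage. An event is a passage together with the colors before and after it.
\<close>

fun events :: "'x \<Rightarrow> 'p list \<Rightarrow> 'x list \<Rightarrow> ('p \<times> 'x \<times> 'x) set" where
  "events x (p # w) (y # ys) = insert (p, x, y) (events y w ys)"
| "events x _ _ = {}"

definition run_events :: "'p list \<Rightarrow> 'x \<times> 'x list \<Rightarrow> ('p \<times> 'x \<times> 'x) set" where
  "run_events w c = events (fst c) w (snd c)"

definition recolor :: "('x \<Rightarrow> 'y) \<Rightarrow> ('x \<times> 'x list) list \<Rightarrow> ('y \<times> 'y list) list" where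
  "recolor \<phi> = map (map_prod \<phi> (map \<phi>))"

lemma events_append:
  "length ys = length u \<Longrightarrow>
     events x (u @ v) (ys @ zs) = events x u ys \<union> events (last (x # ys)) v zs"
  by (induction x u ys rule: events.induct) auto

lemma events_image:
  "events (\<phi> x) w (map \<phi> ys) = (\<lambda>(p, i, o'). (p, \<phi> i, \<phi> o')) ` events x w ys"
  by (induction x w ys rule: events.induct) auto

lemma events_map_word:
  "events x (map f w) ys = (\<lambda>(p, io). (f p, io)) ` events x w ys"
  by (induction x w ys rule: events.induct) auto

lemma events_subset: "(p, i, o') \<in> events x w ys \<Longrightarrow> p \<in> set w \<and> i \<in> set (x # ys) \<and> o' \<in> set ys"
  by (induction x w ys rule: events.induct) auto

lemma events_letter: "(p, io) \<in> events x w ys \<Longrightarrow> p \<in> set w"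
  using events_subset[of p "fst io" "snd io" x w ys] by simp

lemma events_zip: "events x w ys = set (zip w (zip (x # ys) ys))"
  by (induction x w ys rule: events.induct) auto

lemma events_nth:
  "length ys = length w \<Longrightarrow> events x w ys = {(w ! j, (x # ys) ! j, ys ! j) | j. j < length w}"
  by (auto simp: events_zip set_zip)

context finite_biquandle
begin

text \<open>
  Pairing an over- and an under-event with equal label and equal sign recovers the crossings.
\<close>

definition consistent :: "('c passage \<times> 'a \<times> 'a) set \<Rightarrow> bool" where
  "consistent E \<longleftrightarrow> (\<forall>a s i i' j j'. (Over a s, i, i') \<in> E \<longrightarrow> (Under a s, j, j') \<in> E \<longrightarrow>
     signed_crossing s i i' j j')"

text \<open>
  The color \<open>x\<close> is redundant unless the word is empty. Keeping it gives a component without crossings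
  its one color, in accordance with its one semiarc, and makes closing up the strand the same
  condition for all words.
\<close>

definition closed_runs :: "'p list \<Rightarrow> ('a \<times> 'a list) set" where
  "closed_runs w = {(x, ys). length ys = length w \<and> last (x # ys) = x \<and>
     x \<in> carrier X \<and> set ys \<subseteq> carrier X}"

definition colorings :: "'c gauss \<Rightarrow> ('a \<times> 'a list) list set" where
  "colorings G = {c. length c = length G \<and> (\<forall>i<length G. c ! i \<in> closed_runs (G ! i)) \<and>
     consistent (\<Union>i<length G. run_events (G ! i) (c ! i))}"

lemma signed_crossing_Hom:
  assumes "\<phi> \<in> Hom X X" "signed_crossing s i i' j j'"
  shows "signed_crossing s (\<phi> i) (\<phi> i') (\<phi> j) (\<phi> j')"
  using assms unfolding signed_crossing_def crossing_def Hom_def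
  by (auto simp: PiE_mem split: if_splits)

lemma Hom_carrier: "\<phi> \<in> Hom X X \<Longrightarrow> x \<in> carrier X \<Longrightarrow> \<phi> x \<in> carrier X"
  by (auto simp: Hom_def)

lemma consistent_Hom:
  assumes "\<phi> \<in> Hom X X" "consistent E"
  shows "consistent ((\<lambda>(p, i, o'). (p, \<phi> i, \<phi> o')) ` E)"
  unfolding consistent_def
proof (intro allI impI)
  fix a s i i' j j'
  assume "(Over a s, i, i') \<in> (\<lambda>(p, i, o'). (p, \<phi> i, \<phi> o')) ` E"
    and "(Under a s, j, j') \<in> (\<lambda>(p, i, o'). (p, \<phi> i, \<phi> o')) ` E"
  then obtain k k' l l' where "(Over a s, k, k') \<in> E" "(Under a s, l, l') \<in> E"
    "i = \<phi> k" "i' = \<phi> k'" "j = \<phi> l" "j' = \<phi> l'"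
    by auto
  then show "signed_crossing s i i' j j'"
    using assms signed_crossing_Hom unfolding consistent_def by metis
qed

lemma closed_runs_Hom:
  "\<phi> \<in> Hom X X \<Longrightarrow> c \<in> closed_runs w \<Longrightarrow> map_prod \<phi> (map \<phi>) c \<in> closed_runs w"
  by (cases c) (auto simp: closed_runs_def Hom_carrier last_map split: if_splits)

lemma run_events_recolor:
  "run_events w (map_prod \<phi> (map \<phi>) c) = (\<lambda>(p, i, o'). (p, \<phi> i, \<phi> o')) ` run_events w c"
  by (cases c) (simp add: run_events_def events_image)

lemma colorings_Hom:
  assumes "\<phi> \<in> Hom X X" "c \<in> colorings G"
  shows "recolor \<phi> c \<in> colorings G"
proof -
  let ?f = "(\<lambda>(p, i, o'). (p, \<phi> i, \<phi> o'))"
  have len: "length c = length G" using assms by (simp add: colorings_def)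
  have "(\<Union>i<length G. run_events (G ! i) (recolor \<phi> c ! i)) =
    ?f ` (\<Union>i<length G. run_events (G ! i) (c ! i))"
    using len by (simp add: recolor_def run_events_recolor image_UN)
  moreover have "\<forall>i<length G. recolor \<phi> c ! i \<in> closed_runs (G ! i)"
    using assms len by (simp add: recolor_def colorings_def closed_runs_Hom)
  ultimately show ?thesis
    using assms(2) len unfolding colorings_def by (simp add: recolor_def consistent_Hom[OF assms(1)])
qed

section \<open>Invariance under isomorphism of Gauss diagrams\<close>

abbreviation same_colorings :: "'c gauss \<Rightarrow> 'd gauss \<Rightarrow> bool" where
  "same_colorings G G' \<equiv>
     equivariantly_bijective (Hom X X) recolor (colorings G) recolor (colorings G')"

text \<open>
  Injectivity of the relabelling is essential: identifying two labels would impose additional crossing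
  relations.
\<close>

lemma consistent_relabel:
  assumes "inj_on f A" and "\<And>p io. (p, io) \<in> E \<Longrightarrow> set_passage p \<subseteq> A"
  shows "consistent ((\<lambda>(p, io). (map_passage f p, io)) ` E) \<longleftrightarrow> consistent E"
proof
  assume *: "consistent ((\<lambda>(p, io). (map_passage f p, io)) ` E)"
  show "consistent E"
    unfolding consistent_def
  proof (intro allI impI)
    fix a s i i' j j' assume "(Over a s, i, i') \<in> E" "(Under a s, j, j') \<in> E"
    then have "(Over (f a) s, i, i') \<in> (\<lambda>(p, io). (map_passage f p, io)) ` E"
      "(Under (f a) s, j, j') \<in> (\<lambda>(p, io). (map_passage f p, io)) ` E"
      by force+
    then show "signed_crossing s i i' j j'"
      using * unfolding consistent_def by blast
  qed
next
  assume *: "consistent E"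
  show "consistent ((\<lambda>(p, io). (map_passage f p, io)) ` E)"
    unfolding consistent_def
  proof (intro allI impI)
    fix b s i i' j j'
    assume "(Over b s, i, i') \<in> (\<lambda>(p, io). (map_passage f p, io)) ` E"
      and "(Under b s, j, j') \<in> (\<lambda>(p, io). (map_passage f p, io)) ` E"
    then obtain p q where pq: "(p, i, i') \<in> E" "Over b s = map_passage f p"
        "(q, j, j') \<in> E" "Under b s = map_passage f q"
      by auto
    obtain a where "p = Over a s" "b = f a" using pq(2) by (cases p) auto
    moreover obtain a' where "q = Under a' s" "b = f a'" using pq(4) by (cases q) auto
    ultimately have a: "p = Over a s" "q = Under a' s" "b = f a" "b = f a'" by simp_all
    then have "a = a'"
      using assms(2)[OF pq(1)] assms(2)[OF pq(3)] assms(1) by (auto dest: inj_onD)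
    then show "signed_crossing s i i' j j'"
      using * pq a unfolding consistent_def by blast
  qed
qed

lemma colorings_relabel:
  assumes "inj_on f (\<Union>w \<in> set G. \<Union>p \<in> set w. set_passage p)"
  shows "colorings (map (map (map_passage f)) G) = colorings G"
proof -
  have "consistent (\<Union>i<length G. run_events (map (map (map_passage f)) G ! i) (c ! i)) \<longleftrightarrow>
    consistent (\<Union>i<length G. run_events (G ! i) (c ! i))" for c
  proof -
    have ev: "(\<Union>i<length G. run_events (map (map (map_passage f)) G ! i) (c ! i)) =
      (\<lambda>(p, io). (map_passage f p, io)) ` (\<Union>i<length G. run_events (G ! i) (c ! i))"
      by (auto simp: run_events_def events_map_word)
    have labels: "set_passage p \<subseteq> (\<Union>w \<in> set G. \<Union>p \<in> set w. set_passage p)"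
      if mem: "(p, io) \<in> (\<Union>i<length G. run_events (G ! i) (c ! i))" for p io
    proof -
      obtain i where "i < length G" "(p, io) \<in> run_events (G ! i) (c ! i)"
        using mem by blast
      then have "p \<in> set (G ! i)" "G ! i \<in> set G"
        unfolding run_events_def by (auto intro: events_letter)
      then show ?thesis by blast
    qed
    show ?thesis unfolding ev by (rule consistent_relabel[OF assms labels])
  qed
  then show ?thesis unfolding colorings_def closed_runs_def by (intro Collect_cong) (auto simp: case_prod_beta)
qed

text \<open>
  As events carry all crossing conditions, a bijection of the closed runs that preserves the events of
  one component extends to the colorings of the whole diagram.
\<close>

definition word_equivalent :: "'p list \<Rightarrow> 'p list \<Rightarrow> bool" where
  "word_equivalent u v \<longleftrightarrow> (\<exists>f. bij_betw f (closed_runs u) (closed_runs v) \<and>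
     (\<forall>c\<in>closed_runs u. run_events v (f c) = run_events u c \<and>
        (\<forall>\<phi>\<in>Hom X X. f (map_prod \<phi> (map \<phi>) c) = map_prod \<phi> (map \<phi>) (f c))))"

lemma word_equivalent_refl: "word_equivalent u u"
  unfolding word_equivalent_def by (auto intro!: exI[of _ id])

lemma word_equivalent_trans:
  assumes "word_equivalent u v" "word_equivalent v w" shows "word_equivalent u w"
proof -
  obtain f where f: "bij_betw f (closed_runs u) (closed_runs v)"
     "\<And>c. c\<in>closed_runs u \<Longrightarrow> run_events v (f c) = run_events u c"
     "\<And>c \<phi>. c\<in>closed_runs u \<Longrightarrow> \<phi>\<in>Hom X X \<Longrightarrow> f (map_prod \<phi> (map \<phi>) c) = map_prod \<phi> (map \<phi>) (f c)"
    using assms(1) unfolding word_equivalent_def by blast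
  obtain g where g: "bij_betw g (closed_runs v) (closed_runs w)"
     "\<And>c. c\<in>closed_runs v \<Longrightarrow> run_events w (g c) = run_events v c"
     "\<And>c \<phi>. c\<in>closed_runs v \<Longrightarrow> \<phi>\<in>Hom X X \<Longrightarrow> g (map_prod \<phi> (map \<phi>) c) = map_prod \<phi> (map \<phi>) (g c)"
    using assms(2) unfolding word_equivalent_def by blast
  have "f c \<in> closed_runs v" if "c \<in> closed_runs u" for c
    using f(1) that by (auto simp: bij_betw_def)
  then have "\<forall>c\<in>closed_runs u. run_events w ((g \<circ> f) c) = run_events u c \<and>
        (\<forall>\<phi>\<in>Hom X X. (g \<circ> f) (map_prod \<phi> (map \<phi>) c) = map_prod \<phi> (map \<phi>) ((g \<circ> f) c))"
    using f g by simp
  then show ?thesis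
    using bij_betw_trans[OF f(1) g(1)] unfolding word_equivalent_def by blast
qed

fun rotate_run :: "'a \<times> 'a list \<Rightarrow> 'a \<times> 'a list" where
  "rotate_run (x, y # ys) = (y, ys @ [y])"
| "rotate_run (x, []) = (x, [])"

text \<open>
  Moving the base point past one passage moves the color after this passage to the front.
\<close>

lemma word_equivalent_rotate1: "word_equivalent w (rotate1 w)"
proof (cases w)
  case Nil
  then show ?thesis by (simp add: word_equivalent_refl)
next
  case (Cons p u)
  have run: "\<exists>x y ys. c = (x, y # ys) \<and> length ys = length u \<and> x = last (y # ys)
      \<and> y \<in> carrier X \<and> set ys \<subseteq> carrier X" if "c \<in> closed_runs w" for c
    using that Cons by (cases c; cases "snd c") (auto simp: closed_runs_def)
  have "bij_betw rotate_run (closed_runs w) (closed_runs (rotate1 w))"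
    unfolding bij_betw_def
  proof
    show "inj_on rotate_run (closed_runs w)"
    proof (rule inj_onI)
      fix c d assume "c \<in> closed_runs w" "d \<in> closed_runs w" "rotate_run c = rotate_run d"
      then show "c = d" using run[of c] run[of d] by auto
    qed
    show "rotate_run ` closed_runs w = closed_runs (rotate1 w)"
    proof
      show "rotate_run ` closed_runs w \<subseteq> closed_runs (rotate1 w)"
      proof
        fix d assume "d \<in> rotate_run ` closed_runs w"
        then obtain c where "c \<in> closed_runs w" "d = rotate_run c" by blast
        then show "d \<in> closed_runs (rotate1 w)"
          using run[of c] Cons by (auto simp: closed_runs_def subset_iff)
      qed
      show "closed_runs (rotate1 w) \<subseteq> rotate_run ` closed_runs w"
      proof
        fix d assume d: "d \<in> closed_runs (rotate1 w)"
        obtain x zs where xz: "d = (x, zs)" by fastforce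
        with d Cons obtain ys where ys: "zs = ys @ [x]" "length ys = length u"
          by (cases zs rule: rev_cases) (auto simp: closed_runs_def)
        have "(last (x # ys), x # ys) \<in> closed_runs w"
          using d ys xz Cons last_in_set[of "x # ys"] by (auto simp: closed_runs_def subset_iff)
        then show "d \<in> rotate_run ` closed_runs w"
          using ys xz by (auto intro!: rev_image_eqI)
      qed
    qed
  qed
  moreover have "run_events (rotate1 w) (rotate_run c) = run_events w c \<and>
        (\<forall>\<phi>\<in>Hom X X. rotate_run (map_prod \<phi> (map \<phi>) c) = map_prod \<phi> (map \<phi>) (rotate_run c))"
    if c: "c \<in> closed_runs w" for c
  proof -
    obtain x y ys where *: "c = (x, y # ys)" "length ys = length u" "x = last (y # ys)"
      using run[OF c] by blast
    have "run_events (rotate1 w) (rotate_run c) = events y (u @ [p]) (ys @ [y])"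
      using * Cons by (simp add: run_events_def)
    also have "\<dots> = events y u ys \<union> {(p, x, y)}"
      unfolding events_append[OF *(2)] *(3) by simp
    finally show ?thesis using * Cons by (simp add: run_events_def)
  qed
  ultimately show ?thesis unfolding word_equivalent_def by blast
qed

lemma word_equivalent_rotate: "word_equivalent w (rotate n w)"
  by (induction n) (auto intro: word_equivalent_refl word_equivalent_trans word_equivalent_rotate1)

text \<open>
  An isomorphism of Gauss diagrams permutes the components and changes their base points. Both are
  covered here: component \<open>i\<close> of \<open>H\<close> is, up to a change of base point, component \<open>p i\<close> of \<open>G\<close>.
\<close>

lemma same_colorings_rearrange:
  assumes len: "length H = length G" and p: "bij_betw p {..<length G} {..<length G}"
    and words: "\<And>i. i < length G \<Longrightarrow> word_equivalent (G ! p i) (H ! i)"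
  shows "same_colorings G H"
proof -
  let ?n = "length G"
  have lt: "p i < ?n" if "i < ?n" for i using p that by (auto simp: bij_betw_def)
  have onto: "\<exists>i<?n. p i = k" if "k < ?n" for k
  proof -
    have "k \<in> p ` {..<?n}" using p that by (simp add: bij_betw_def)
    then show ?thesis by auto
  qed
  have "\<forall>i<?n. \<exists>f. bij_betw f (closed_runs (G ! p i)) (closed_runs (H ! i)) \<and>
     (\<forall>c\<in>closed_runs (G ! p i). run_events (H ! i) (f c) = run_events (G ! p i) c \<and>
        (\<forall>\<phi>\<in>Hom X X. f (map_prod \<phi> (map \<phi>) c) = map_prod \<phi> (map \<phi>) (f c)))"
    using words unfolding word_equivalent_def by blast
  then obtain f where bij: "\<And>i. i < ?n \<Longrightarrow> bij_betw (f i) (closed_runs (G ! p i)) (closed_runs (H ! i))"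
    and ev: "\<And>i c. i < ?n \<Longrightarrow> c\<in>closed_runs (G ! p i) \<Longrightarrow> run_events (H ! i) (f i c) = run_events (G ! p i) c"
    and eq: "\<And>i c \<phi>. i < ?n \<Longrightarrow> c\<in>closed_runs (G ! p i) \<Longrightarrow> \<phi>\<in>Hom X X \<Longrightarrow>
       f i (map_prod \<phi> (map \<phi>) c) = map_prod \<phi> (map \<phi>) (f i c)"
    by metis
  have inH: "f i c \<in> closed_runs (H ! i)" if "i < ?n" "c \<in> closed_runs (G ! p i)" for i c
    using bij[OF that(1)] that(2) by (auto simp: bij_betw_def)
  define R where "R c d \<longleftrightarrow> (\<forall>i<?n. c ! p i \<in> closed_runs (G ! p i) \<and> d ! i = f i (c ! p i))"
    for c d :: "('a \<times> 'a list) list"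
  have col: "c \<in> colorings G \<longleftrightarrow> d \<in> colorings H" if "length c = ?n" "length d = ?n" "R c d" for c d
  proof -
    have "(\<Union>i<?n. run_events (H ! i) (d ! i)) = (\<Union>i<?n. run_events (G ! p i) (c ! p i))"
      using that(3) ev by (simp add: R_def)
    also have "\<dots> = (\<Union>k\<in>p ` {..<?n}. run_events (G ! k) (c ! k))" by simp
    also have "\<dots> = (\<Union>k<?n. run_events (G ! k) (c ! k))" unfolding bij_betw_imp_surj_on[OF p] ..
    finally have "consistent (\<Union>i<?n. run_events (H ! i) (d ! i)) \<longleftrightarrow>
        consistent (\<Union>k<?n. run_events (G ! k) (c ! k))" by simp
    moreover have "\<forall>k<?n. c ! k \<in> closed_runs (G ! k)" using that(3) onto unfolding R_def by blast
    moreover have "\<forall>i<?n. d ! i \<in> closed_runs (H ! i)" using that(3) inH by (simp add: R_def)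
    ultimately show ?thesis using that len by (simp add: colorings_def)
  qed
  have colen: "length c = ?n" if "c \<in> colorings G \<or> c \<in> colorings H" for c
    using that len by (auto simp: colorings_def)
  show ?thesis
  proof (rule equivariantly_bijectiveI[where R = R])
    fix c assume c: "c \<in> colorings G"
    let ?d = "map (\<lambda>i. f i (c ! p i)) [0..<?n]"
    have "R c ?d" using c lt by (simp add: R_def colorings_def)
    then show "\<exists>d\<in>colorings H. R c d"
      using col[of c ?d] colen c by (intro bexI[of _ ?d]) auto
  next
    fix d assume d: "d \<in> colorings H"
    have "\<forall>i<?n. \<exists>c\<in>closed_runs (G ! p i). d ! i = f i c"
    proof (intro allI impI)
      fix i assume i: "i < ?n"
      then have "d ! i \<in> f i ` closed_runs (G ! p i)"
        using d len bij_betw_imp_surj_on[OF bij[OF i]] by (simp add: colorings_def)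
      then show "\<exists>c\<in>closed_runs (G ! p i). d ! i = f i c" by blast
    qed
    then obtain c where c: "\<And>i. i < ?n \<Longrightarrow> c i \<in> closed_runs (G ! p i) \<and> d ! i = f i (c i)"
      by metis
    \<comment> \<open>The coloring is transported back along the inverse of the permutation.\<close>
    let ?c = "map (\<lambda>k. c (inv_into {..<?n} p k)) [0..<?n]"
    have "R ?c d" using c lt bij_betw_inv_into_left[OF p] by (simp add: R_def)
    then show "\<exists>c\<in>colorings G. R c d"
      using col[of ?c d] colen d by (intro bexI[of _ ?c]) auto
  next
    fix c d d' assume "d \<in> colorings H" "d' \<in> colorings H" "R c d" "R c d'"
    then show "d = d'" using colen by (intro nth_equalityI) (auto simp: R_def)
  next
    fix c c' d assume *: "c \<in> colorings G" "c' \<in> colorings G" "R c d" "R c' d"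
    have "c ! k = c' ! k" if k: "k < ?n" for k
    proof -
      obtain i where i: "i < ?n" "p i = k" using onto[OF k] by blast
      have "f i (c ! p i) = f i (c' ! p i)" "c ! p i \<in> closed_runs (G ! p i)"
        "c' ! p i \<in> closed_runs (G ! p i)" using *(3,4) i(1) by (simp_all add: R_def)
      from inj_onD[OF bij_betw_imp_inj_on[OF bij[OF i(1)]] this] show ?thesis unfolding i(2) .
    qed
    then show "c = c'" using colen * by (intro nth_equalityI) auto
  next
    fix \<phi> c d assume *: "\<phi> \<in> Hom X X" "c \<in> colorings G" "d \<in> colorings H" "R c d"
    then have "R (recolor \<phi> c) (recolor \<phi> d)"
      using colen eq lt by (simp add: R_def recolor_def closed_runs_Hom)
    then show "recolor \<phi> d \<in> colorings H \<and> R (recolor \<phi> c) (recolor \<phi> d)"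
      using colorings_Hom * by blast
  qed (rule colorings_Hom)
qed

lemma same_colorings_gauss_iso:
  assumes "gauss_iso G G'" shows "same_colorings G G'"
proof -
  obtain f H where f: "inj_on f (\<Union>w \<in> set G. \<Union>p \<in> set w. set_passage p)"
    and H: "mset H = mset (map (map (map_passage f)) G)"
    and rot: "list_all2 (\<lambda>u v. \<exists>n. v = rotate n u) H G'"
    using assms unfolding gauss_iso_def by blast
  let ?G = "map (map (map_passage f)) G"
  obtain p where p: "p permutes {..<length ?G}" "permute_list p ?G = H"
    using mset_eq_permutation[OF H] by blast
  have len: "length H = length ?G" "length G' = length H"
    using p(2) list_all2_lengthD[OF rot] by auto
  have "same_colorings ?G G'"
  proof (rule same_colorings_rearrange[OF _ permutes_imp_bij[OF p(1)]])
    fix i assume i: "i < length ?G"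
    have "H ! i = ?G ! p i" using permute_list_nth[OF p(1) i] p(2) by simp
    then show "word_equivalent (?G ! p i) (G' ! i)"
      using list_all2_nthD[OF rot, of i] i len word_equivalent_rotate by auto
  qed (use len in simp)
  then show ?thesis by (simp add: colorings_relabel[OF f])
qed

end

section \<open>Simple Gauss diagrams\<close>

definition overs :: "'c passage list \<Rightarrow> 'c list" where
  "overs w = concat (map (\<lambda>p. case p of Over a s \<Rightarrow> [a] | Under a s \<Rightarrow> []) w)"

definition unders :: "'c passage list \<Rightarrow> 'c list" where
  "unders w = concat (map (\<lambda>p. case p of Over a s \<Rightarrow> [] | Under a s \<Rightarrow> [a]) w)"

text \<open>
  In the Gauss diagram of a link diagram each crossing is passed at most once on top and at most once
  below. As both passages of a crossing in the disc of a Reidemeister move lie in the disc, the labels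
  used inside do not occur outside.
\<close>

definition simple_gauss :: "'c gauss \<Rightarrow> bool" where
  "simple_gauss G \<longleftrightarrow> distinct (overs (concat G)) \<and> distinct (unders (concat G))"

lemma overs_simps [simp]:
  "overs [] = []" "overs (Over a s # w) = a # overs w" "overs (Under a s # w) = overs w"
  "overs (u @ v) = overs u @ overs v"
  by (simp_all add: overs_def)

lemma unders_simps [simp]:
  "unders [] = []" "unders (Over a s # w) = unders w" "unders (Under a s # w) = a # unders w"
  "unders (u @ v) = unders u @ unders v"
  by (simp_all add: unders_def)

lemma in_overs_iff: "a \<in> set (overs w) \<longleftrightarrow> (\<exists>s. Over a s \<in> set w)"
  by (induction w) (auto split: passage.splits simp: overs_def)

lemma in_unders_iff: "a \<in> set (unders w) \<longleftrightarrow> (\<exists>s. Under a s \<in> set w)"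
  by (induction w) (auto split: passage.splits simp: unders_def)

lemma mset_concat_map: "mset (concat (map f w)) = (\<Sum>p\<in>#mset w. mset (f p))"
  by (induction w) auto

lemma simple_gauss_mset:
  assumes "mset (concat G) = mset w"
  shows "simple_gauss G \<longleftrightarrow> distinct (overs w) \<and> distinct (unders w)"
proof -
  have "mset (overs (concat G)) = mset (overs w)" "mset (unders (concat G)) = mset (unders w)"
    unfolding overs_def unders_def mset_concat_map assms by simp_all
  then show ?thesis
    unfolding simple_gauss_def using mset_eq_imp_distinct_iff by blast
qed

lemma overs_map: "overs (map (map_passage f) w) = map f (overs w)"
proof (induction w)
  case (Cons p w) then show ?case by (cases p) auto
qed simp

lemma unders_map: "unders (map (map_passage f) w) = map f (unders w)"
proof (induction w)
  case (Cons p w) then show ?case by (cases p) auto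
qed simp

lemma mset_concat_cong: "mset G = mset H \<Longrightarrow> mset (concat G) = mset (concat H)"
  by (metis map_ident mset_concat_map)

lemma gauss_iso_simple_gauss:
  assumes "gauss_iso G G'"
  shows "simple_gauss G' \<longleftrightarrow> simple_gauss G"
proof -
  obtain f H where f: "inj_on f (\<Union>w \<in> set G. \<Union>p \<in> set w. set_passage p)"
    and H: "mset H = mset (map (map (map_passage f)) G)"
    and rot: "list_all2 (\<lambda>u v. \<exists>n. v = rotate n u) H G'"
    using assms unfolding gauss_iso_def by blast
  have "mset (rotate n u) = mset u" for n and u :: "'b passage list"
  proof (induction n)
    case (Suc n)
    have "mset (rotate1 v) = mset v" for v :: "'b passage list" by (cases v) auto
    then show ?case using Suc by simp
  qed simp
  note mset_rotate = this
  have "mset (concat G') = mset (concat H)"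
    using rot by (induction rule: list_all2_induct) (auto simp: mset_rotate)
  also have "\<dots> = mset (map (map_passage f) (concat G))"
    using mset_concat_cong[OF H] by (simp add: map_concat)
  finally have eq: "mset (concat G') = mset (map (map_passage f) (concat G))" .
  have "set (overs (concat G)) \<subseteq> (\<Union>w \<in> set G. \<Union>p \<in> set w. set_passage p)"
    "set (unders (concat G)) \<subseteq> (\<Union>w \<in> set G. \<Union>p \<in> set w. set_passage p)"
    by (auto simp: in_overs_iff in_unders_iff) force+
  then have "inj_on f (set (overs (concat G)))" "inj_on f (set (unders (concat G)))"
    using f inj_on_subset by blast+
  then show ?thesis
    unfolding simple_gauss_mset[OF eq] overs_map unders_map
    by (simp add: simple_gauss_def distinct_map)
qed

section \<open>Templates and their fillings\<close>

abbreviation item_word :: "'p list list \<Rightarrow> nat + 'p \<Rightarrow> 'p list" where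
  "item_word ws \<equiv> case_sum (\<lambda>n. ws ! n) (\<lambda>p. [p])"

abbreviation fill_word :: "'p list list \<Rightarrow> (nat + 'p) list \<Rightarrow> 'p list" where
  "fill_word ws w \<equiv> concat (map (item_word ws) w)"

definition holes :: "(nat + 'p) list \<Rightarrow> nat list" where
  "holes w = [n. Inl n \<leftarrow> w]"

definition fixed_part :: "(nat + 'p) list \<Rightarrow> 'p list" where
  "fixed_part w = [p. Inr p \<leftarrow> w]"

lemma holes_simps [simp]:
  "holes [] = []" "holes (Inl n # w) = n # holes w" "holes (Inr p # w) = holes w"
  by (simp_all add: holes_def)

lemma fixed_part_simps [simp]:
  "fixed_part [] = []" "fixed_part (Inl n # w) = fixed_part w"
  "fixed_part (Inr p # w) = p # fixed_part w"
  by (simp_all add: fixed_part_def)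

lemma in_holes_iff: "n \<in> set (holes w) \<longleftrightarrow> Inl n \<in> set w"
proof (induction w)
  case (Cons p w) then show ?case by (cases p) auto
qed simp

lemma mset_fill_word:
  "mset (fill_word ws w) = mset (fixed_part w) + (\<Sum>n\<in>#mset (holes w). mset (ws ! n))"
proof (induction w)
  case (Cons p w) then show ?case by (cases p) auto
qed simp

lemma mset_fill:
  assumes "mset (concat (map holes T)) = mset [0..<length ws]"
  shows "mset (concat (fill ws T)) = mset (concat (map fixed_part T) @ concat ws)"
proof -
  have "mset (concat (fill ws T)) =
      mset (concat (map fixed_part T)) + (\<Sum>n\<in>#mset (concat (map holes T)). mset (ws ! n))"
    by (induction T) (auto simp: fill_def mset_fill_word)
  also have "(\<Sum>n\<in>#mset (concat (map holes T)). mset (ws ! n)) = mset (concat (map ((!) ws) [0..<length ws]))"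
    unfolding assms by (simp add: mset_concat_map)
  also have "map ((!) ws) [0..<length ws] = ws" by (rule map_nth)
  finally show ?thesis by simp
qed

text \<open>
  A coloring of a template assigns one color to each side of a hole; \<open>h n\<close> is the list of colors after
  the passages of the word that fills hole \<open>n\<close>. The color after the hole is then the last color of
  \<open>h n\<close>, and \<open>fits\<close> expresses that it agrees with the color that the template prescribes.
\<close>

fun fill_outs :: "(nat \<Rightarrow> 'x list) \<Rightarrow> (nat + 'p) list \<Rightarrow> 'x list \<Rightarrow> 'x list" where
  "fill_outs h (Inl n # w) (t # ts) = h n @ fill_outs h w ts"
| "fill_outs h (Inr p # w) (t # ts) = t # fill_outs h w ts"
| "fill_outs h _ _ = []"

definition hole_fits :: "'p list list \<Rightarrow> 'x set \<Rightarrow> nat \<Rightarrow> 'x \<Rightarrow> 'x \<Rightarrow> 'x list \<Rightarrow> bool" where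
  "hole_fits ws Q n i t ys \<longleftrightarrow> length ys = length (ws ! n) \<and> last (i # ys) = t \<and> set ys \<subseteq> Q"

definition fits :: "'p list list \<Rightarrow> (nat \<Rightarrow> 'x list) \<Rightarrow> 'x set \<Rightarrow> ((nat + 'p) \<times> 'x \<times> 'x) set \<Rightarrow> bool" where
  "fits ws h Q E \<longleftrightarrow> (\<forall>n i t. (Inl n, i, t) \<in> E \<longrightarrow> hole_fits ws Q n i t (h n))"

lemma fits_insert:
  "fits ws h Q (insert (Inl n, i, t) E) \<longleftrightarrow>
     hole_fits ws Q n i t (h n) \<and> fits ws h Q E"
  "fits ws h Q (insert (Inr p, io) E) \<longleftrightarrow> fits ws h Q E"
  by (auto simp: fits_def)

lemma last_Cons_append: "last (x # (ys @ zs)) = last (last (x # ys) # zs)"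
  by auto

lemma fill_outs_run:
  assumes "length ts = length w" "fits ws h Q (events x w ts)"
  shows "length (fill_outs h w ts) = length (fill_word ws w) \<and>
    last (x # fill_outs h w ts) = last (x # ts) \<and>
    (set ts \<subseteq> Q \<longrightarrow> set (fill_outs h w ts) \<subseteq> Q)"
  using assms
proof (induction h w ts arbitrary: x rule: fill_outs.induct)
  case (1 h n w t ts)
  then have n: "length (h n) = length (ws ! n)" "last (x # h n) = t" "set (h n) \<subseteq> Q"
    and "fits ws h Q (events t w ts)" by (auto simp: fits_insert hole_fits_def)
  with 1 have IH: "length (fill_outs h w ts) = length (fill_word ws w)"
    "last (t # fill_outs h w ts) = last (t # ts)"
    "set ts \<subseteq> Q \<longrightarrow> set (fill_outs h w ts) \<subseteq> Q" by auto
  have "last (x # (h n @ fill_outs h w ts)) = last (t # ts)"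
    unfolding last_Cons_append n(2) IH(2) ..
  then show ?case using n(1,3) IH(1,3) by simp
next
  case (2 h p w t ts)
  then show ?case by (auto simp: fits_insert)
qed auto

lemma fill_outs_events:
  assumes "length ts = length w" "fits ws h Q (events x w ts)"
  shows "events x (fill_word ws w) (fill_outs h w ts) =
    {(p, io). (Inr p, io) \<in> events x w ts} \<union>
    (\<Union>(q, i, t) \<in> events x w ts. case q of Inl n \<Rightarrow> events i (ws ! n) (h n) | Inr p \<Rightarrow> {})"
  using assms
proof (induction h w ts arbitrary: x rule: fill_outs.induct)
  case (1 h n w t ts)
  then have "length (h n) = length (ws ! n)" "last (x # h n) = t"
    and "fits ws h Q (events t w ts)" by (auto simp: fits_insert hole_fits_def)
  with 1 show ?case by (auto simp: events_append)
next
  case (2 h p w t ts)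
  then show ?case by (auto simp: fits_insert)
qed auto

lemma fill_outs_cong:
  assumes "\<And>n. n \<in> set (holes w) \<Longrightarrow> h n = h' n"
  shows "fill_outs h w ts = fill_outs h' w ts"
  using assms by (induction h w ts rule: fill_outs.induct) auto

lemma hole_event: "(Inl n, io) \<in> events x w ts \<Longrightarrow> n \<in> set (holes w)"
  unfolding in_holes_iff by (rule events_letter)

lemma hole_event_ex:
  "length ts = length w \<Longrightarrow> n \<in> set (holes w) \<Longrightarrow> \<exists>io. (Inl n, io) \<in> events x w ts"
proof (induction x w ts rule: events.induct)
  case (1 x p w y ys)
  then show ?case by (cases p) auto
qed auto

lemma hole_event_unique:
  "distinct (holes w) \<Longrightarrow> (Inl n, io) \<in> events x w ts \<Longrightarrow> (Inl n, io') \<in> events x w ts \<Longrightarrow> io = io'"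
proof (induction x w ts rule: events.induct)
  case (1 x p w y ys)
  then show ?case by (cases p) (auto dest: hole_event)
qed auto

lemma fits_cong:
  assumes "\<And>n. n \<in> set (holes w) \<Longrightarrow> h n = h' n"
  shows "fits ws h Q (events x w ts) \<longleftrightarrow> fits ws h' Q (events x w ts)"
  unfolding fits_def using assms hole_event by metis

text \<open>
  Cutting a colored filled word at the ends of the holes shows that every coloring of a filling comes
  from a coloring of the template. Distinctness of the holes makes it possible to index the pieces by
  the number of the hole.
\<close>

lemma fill_outs_ex:
  assumes "distinct (holes w)" "length ys = length (fill_word ws w)" "x \<in> Q" "set ys \<subseteq> Q"
  shows "\<exists>ts h. length ts = length w \<and> set ts \<subseteq> Q \<and> fits ws h Q (events x w ts) \<and>
    ys = fill_outs h w ts"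
  using assms
proof (induction w arbitrary: x ys)
  case Nil
  then show ?case by (auto simp: fits_def)
next
  case (Cons q w)
  show ?case
  proof (cases q)
    case (Inl n)
    define a b where "a = take (length (ws ! n)) ys" and "b = drop (length (ws ! n)) ys"
    have ab: "ys = a @ b" "length a = length (ws ! n)" "length b = length (fill_word ws w)"
      using Cons.prems Inl by (auto simp: a_def b_def)
    have "last (x # a) \<in> set (x # a)" by (rule last_in_set) simp
    then have last: "last (x # a) \<in> Q" using Cons.prems ab(1) by auto
    obtain ts h where *: "length ts = length w" "set ts \<subseteq> Q"
      "fits ws h Q (events (last (x # a)) w ts)" "b = fill_outs h w ts"
      using Cons.IH[of b "last (x # a)"] Cons.prems ab last Inl by auto
    define h' where "h' = h(n := a)"
    have same: "h m = h' m" if "m \<in> set (holes w)" for m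
      using that Cons.prems(1) Inl by (auto simp: h'_def)
    have "hole_fits ws Q n x (last (x # a)) (h' n)"
      using ab(1,2) Cons.prems(4) by (auto simp: hole_fits_def h'_def)
    moreover have "fits ws h' Q (events (last (x # a)) w ts)"
      using *(3) fits_cong[of w h h', OF same] by blast
    ultimately have "fits ws h' Q (events x (q # w) (last (x # a) # ts))"
      unfolding events.simps Inl fits_insert by blast
    moreover have "fill_outs h' w ts = fill_outs h w ts"
      by (rule fill_outs_cong) (simp add: same)
    then have "ys = fill_outs h' (q # w) (last (x # a) # ts)"
      unfolding Inl fill_outs.simps using ab(1) *(4) by (simp add: h'_def)
    ultimately show ?thesis
      using *(1,2) last by (intro exI[of _ "last (x # a) # ts"] exI[of _ h'] conjI) auto
  next
    case (Inr p)
    with Cons.prems obtain y b where ys: "ys = y # b" by (cases ys) auto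
    then obtain ts h where *: "length ts = length w" "set ts \<subseteq> Q"
      "fits ws h Q (events y w ts)" "b = fill_outs h w ts"
      using Cons.IH[of b y] Cons.prems Inr by auto
    then show ?thesis
      using ys Inr Cons.prems by (intro exI[of _ "y # ts"] exI[of _ h]) (auto simp: fits_insert)
  qed
qed

lemma fill_outs_inject:
  assumes "length ts = length w" "length ts' = length w"
    "fits ws h Q (events x w ts)" "fits ws h' Q (events x w ts')"
    "fill_outs h w ts = fill_outs h' w ts'"
  shows "ts = ts' \<and> (\<forall>n\<in>set (holes w). h n = h' n)"
  using assms
proof (induction w arbitrary: x ts ts')
  case (Cons q w)
  obtain t us where ts: "ts = t # us" "length us = length w"
    using Cons.prems(1) by (cases ts) auto
  obtain t' us' where ts': "ts' = t' # us'" "length us' = length w"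
    using Cons.prems(2) by (cases ts') auto
  show ?case
  proof (cases q)
    case (Inl n)
    have n: "hole_fits ws Q n x t (h n)" "hole_fits ws Q n x t' (h' n)"
      and w: "fits ws h Q (events t w us)" "fits ws h' Q (events t' w us')"
      using Cons.prems(3,4) unfolding ts(1) ts'(1) events.simps Inl fits_insert by simp_all
    have eq: "h n = h' n" "fill_outs h w us = fill_outs h' w us'"
      using Cons.prems(5) n unfolding ts(1) ts'(1) Inl hole_fits_def by simp_all
    then have t: "t = t'" using n by (simp add: hole_fits_def)
    then show ?thesis
      using Cons.IH[OF ts(2) ts'(2) w(1) w(2)[folded t] eq(2)] eq(1) ts(1) ts'(1) Inl by simp
  next
    case (Inr p)
    have w: "fits ws h Q (events t w us)" "fits ws h' Q (events t' w us')"
      using Cons.prems(3,4) unfolding ts(1) ts'(1) events.simps Inr fits_insert by simp_all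
    have eq: "t = t'" "fill_outs h w us = fill_outs h' w us'"
      using Cons.prems(5) unfolding ts(1) ts'(1) Inr by simp_all
    show ?thesis
      using Cons.IH[OF ts(2) ts'(2) w(1) w(2)[folded eq(1)] eq(2)] eq(1) ts(1) ts'(1) Inr by simp
  qed
qed simp

lemma fill_outs_map: "fill_outs (\<lambda>n. map \<phi> (h n)) w (map \<phi> ts) = map \<phi> (fill_outs h w ts)"
  by (induction h w ts rule: fill_outs.induct) auto

lemma concat_index_unique:
  assumes "distinct (concat L)" "i < length L" "j < length L" "x \<in> set (L ! i)" "x \<in> set (L ! j)"
  shows "i = j"
  using assms
proof (induction L arbitrary: i j)
  case (Cons l L)
  have no: "x \<notin> set (L ! k)" if "x \<in> set l" "k < length L" for k
  proof -
    have "set (L ! k) \<subseteq> set (concat L)" using nth_mem[OF that(2)] by auto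
    then show ?thesis using Cons.prems(1) that(1) by auto
  qed
  show ?case
  proof (cases i; cases j)
    fix i' j' assume "i = Suc i'" "j = Suc j'"
    then show "i = j" using Cons by simp
  qed (use Cons.prems no in auto)
qed simp

section \<open>The third Reidemeister move in algebraic form\<close>

context finite_biquandle
begin

lemma crossing_unique:
  assumes "crossing x y p q" "crossing x' y' p' q'" "x = x' \<or> p = p'" "y = y' \<or> q = q'"
  shows "x = x' \<and> y = y' \<and> p = p' \<and> q = q'"
  using assms(3)
proof
  assume x: "x = x'"
  show ?thesis using assms(4)
  proof
    assume "y = y'" then show ?thesis using crossing_det_xy[of x y] assms(1,2) x by blast
  next
    assume "q = q'" then show ?thesis using crossing_det_xy'[of x y p q] assms(1,2) x by blast
  qed
next
  assume p: "p = p'"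
  show ?thesis using assms(4)
  proof
    assume "y = y'" then show ?thesis using crossing_det_x'y[of x y p q] assms(1,2) p by blast
  next
    assume "q = q'" then show ?thesis using crossing_det_x'y'[of x y p q] assms(1,2) p by blast
  qed
qed

lemma signed_crossing_unique:
  assumes "signed_crossing s i i' j j'" "signed_crossing s k k' l l'"
    and "i = k \<or> i' = k'" "j = l \<or> j' = l'"
  shows "i = k \<and> i' = k' \<and> j = l \<and> j' = l'"
proof (cases "s = 1")
  case True
  then have "crossing j' i j i'" "crossing l' k l k'"
    using assms(1,2) by (simp_all add: signed_crossing_def)
  from crossing_unique[OF this] show ?thesis using assms(3,4) by blast
next
  case False
  then have "crossing j i' j' i" "crossing l k' l' k"
    using assms(1,2) by (simp_all add: signed_crossing_def)
  from crossing_unique[OF this] show ?thesis using assms(3,4) by blast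
qed

lemma signed_crossing_carrier:
  "signed_crossing s i i' j j' \<Longrightarrow>
     i \<in> carrier X \<and> i' \<in> carrier X \<and> j \<in> carrier X \<and> j' \<in> carrier X"
  unfolding signed_crossing_def using crossing_carrier by (auto split: if_splits)

text \<open>
  The three strands \<open>t\<close>, \<open>m\<close>, \<open>b\<close> (top, middle, bottom) of a third Reidemeister move consist of three
  arcs each. The crossings top/middle, top/bottom and middle/bottom have signs \<open>k\<close>, \<open>l\<close>, \<open>m\<close>. The flags
  say for each strand which crossing comes first: \<open>\<alpha>\<close> that the top strand meets the middle before the
  bottom strand, \<open>\<beta>\<close> that the middle strand meets the top before the bottom strand, and \<open>\<gamma>\<close> that the
  bottom strand meets the top before the middle strand. The move negates all three flags.
\<close>

definition triangle :: "int \<Rightarrow> int \<Rightarrow> int \<Rightarrow> bool \<Rightarrow> bool \<Rightarrow> bool \<Rightarrow>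
    'a \<Rightarrow> 'a \<Rightarrow> 'a \<Rightarrow> 'a \<Rightarrow> 'a \<Rightarrow> 'a \<Rightarrow> 'a \<Rightarrow> 'a \<Rightarrow> 'a \<Rightarrow> bool" where
  "triangle k l m \<alpha> \<beta> \<gamma> t0 t1 t2 m0 m1 m2 b0 b1 b2 \<longleftrightarrow>
   signed_crossing k (if \<alpha> then t0 else t1) (if \<alpha> then t1 else t2)
     (if \<beta> then m0 else m1) (if \<beta> then m1 else m2) \<and>
   signed_crossing l (if \<alpha> then t1 else t0) (if \<alpha> then t2 else t1)
     (if \<gamma> then b0 else b1) (if \<gamma> then b1 else b2) \<and>
   signed_crossing m (if \<beta> then m1 else m0) (if \<beta> then m2 else m1)
     (if \<gamma> then b1 else b0) (if \<gamma> then b2 else b1)"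

text \<open>
  Of the four arcs at the crossing top/middle one of each strand lies on the boundary of the disc. These
  two determine the inner arcs of both strands, and similarly for the crossing top/bottom.
\<close>

lemma triangle_unique:
  assumes "triangle k l m \<alpha> \<beta> \<gamma> t0 t1 t2 m0 m1 m2 b0 b1 b2"
    and "triangle k l m \<alpha> \<beta> \<gamma> t0 t1' t2 m0 m1' m2 b0 b1' b2"
  shows "t1 = t1' \<and> m1 = m1' \<and> b1 = b1'"
proof -
  note k = signed_crossing_unique[OF assms[unfolded triangle_def, THEN conjunct1]]
    and l = signed_crossing_unique[OF assms[unfolded triangle_def, THEN conjunct2, THEN conjunct1]]
  have "t1 = t1' \<and> m1 = m1'" using k by (cases \<alpha>; cases \<beta>) simp_all
  moreover have "t1 = t1' \<and> b1 = b1'" using l by (cases \<alpha>; cases \<gamma>) simp_all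
  ultimately show ?thesis by simp
qed

text \<open>
  The eight sign patterns fall into four pairs; reversing all strands exchanges the two patterns of
  a pair and the indices 0 and 2. Equal signs give the canonical move, the other pairs are the three
  moves in which one crossing has been moved to the other side.
\<close>

lemma triangle_move:
  assumes "k \<in> {1, -1}" "l \<in> {1, -1}" "m \<in> {1, -1::int}"
  shows "(\<exists>t1 m1 b1. triangle k l m (k * l = 1) (k * m = 1) (l * m = 1) t0 t1 t2 m0 m1 m2 b0 b1 b2) \<longleftrightarrow>
    (\<exists>t1 m1 b1. triangle k l m (k * l \<noteq> 1) (k * m \<noteq> 1) (l * m \<noteq> 1) t0 t1 t2 m0 m1 m2 b0 b1 b2)"
proof -
  consider "k = 1 \<and> l = 1 \<and> m = 1" | "k = 1 \<and> l = 1 \<and> m = -1" | "k = 1 \<and> l = -1 \<and> m = 1"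
    | "k = 1 \<and> l = -1 \<and> m = -1" | "k = -1 \<and> l = 1 \<and> m = 1" | "k = -1 \<and> l = 1 \<and> m = -1"
    | "k = -1 \<and> l = -1 \<and> m = 1" | "k = -1 \<and> l = -1 \<and> m = -1"
    using assms by auto
  then show ?thesis
  proof cases
    case 1
    then show ?thesis
      using crossing_triangle[of t0 m0 b2 m2 b0 t2] by (simp add: triangle_def signed_crossing_def, meson)
  next
    case 2
    then show ?thesis
      using crossing_triangle_flip_mb[of m2 t0 b2 t2 b0 m0] by (simp add: triangle_def signed_crossing_def, meson)
  next
    case 3
    then show ?thesis
      using crossing_triangle_flip_tb[of b2 t0 m0 t2 b0 m2] by (simp add: triangle_def signed_crossing_def, meson)
  next
    case 4
    then show ?thesis
      using crossing_triangle_flip_tm[of t0 m0 b0 m2 t2 b2] by (simp add: triangle_def signed_crossing_def, meson)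
  next
    case 5
    then show ?thesis
      using crossing_triangle_flip_tm[of t2 m2 b2 m0 t0 b0] by (simp add: triangle_def signed_crossing_def, meson)
  next
    case 6
    then show ?thesis
      using crossing_triangle_flip_tb[of b0 t2 m2 t0 b2 m0] by (simp add: triangle_def signed_crossing_def, meson)
  next
    case 7
    then show ?thesis
      using crossing_triangle_flip_mb[of m0 t2 b0 t0 b2 m2] by (simp add: triangle_def signed_crossing_def, meson)
  next
    case 8
    then show ?thesis
      using crossing_triangle[of t2 m2 b0 m0 b2 t0] by (simp add: triangle_def signed_crossing_def, meson)
  qed
qed

end

section \<open>Reidemeister moves inside a disc\<close>

context finite_biquandle
begin

lemma signed_crossing_ex_in_in:
  assumes "i \<in> carrier X" "j \<in> carrier X"
  shows "\<exists>i' j'. signed_crossing s i i' j j'"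
  using assms crossing_ex_x'y[of j i] crossing_ex_xy'[of j i]
  unfolding signed_crossing_def by (cases "s = 1") auto

lemma signed_crossing_ex_in_out:
  assumes "i \<in> carrier X" "j' \<in> carrier X"
  shows "\<exists>i' j. signed_crossing s i i' j j'"
  using assms crossing_ex_xy[of j' i] crossing_ex_x'y'[of j' i]
  unfolding signed_crossing_def by (cases "s = 1") auto

lemma signed_crossing_uminus:
  "s \<in> {1, -1} \<Longrightarrow> signed_crossing (- s) i i' j j' \<longleftrightarrow> signed_crossing s i' i j' j"
  by (auto simp: signed_crossing_def)

text \<open>
  \<open>\<beta> n\<close> consists of the colors with which strand \<open>n\<close> enters and leaves the disc of the move.
\<close>

definition local_coloring ::
  "'c passage list list \<Rightarrow> (nat \<Rightarrow> 'a \<times> 'a) \<Rightarrow> (nat \<Rightarrow> 'a list) \<Rightarrow> bool" where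
  "local_coloring ws \<beta> h \<longleftrightarrow>
     (\<forall>n<length ws. hole_fits ws (carrier X) n (fst (\<beta> n)) (snd (\<beta> n)) (h n)) \<and>
     consistent (\<Union>n<length ws. events (fst (\<beta> n)) (ws ! n) (h n))"

text \<open>
  The colors on the boundary of the disc determine those in its interior.
\<close>

definition rigid :: "'c passage list list \<Rightarrow> (nat \<Rightarrow> 'a \<times> 'a) \<Rightarrow> bool" where
  "rigid ws \<beta> \<longleftrightarrow> (\<forall>h h'. local_coloring ws \<beta> h \<longrightarrow> local_coloring ws \<beta> h' \<longrightarrow>
     (\<forall>n<length ws. h n = h' n))"

lemma hole_fits_Nil: "ws ! n = [] \<Longrightarrow> hole_fits ws Q n i t ys \<longleftrightarrow> ys = [] \<and> i = t"
  by (auto simp: hole_fits_def)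

lemma consistent_empty: "consistent {}"
  by (simp add: consistent_def)

lemma consistent_one:
  assumes "E = {(Over a s, i, i'), (Under a s, j, j')}"
  shows "consistent E \<longleftrightarrow> signed_crossing s i i' j j'"
  unfolding consistent_def assms by auto

lemma consistent_two:
  assumes "a \<noteq> b"
    and "E = {(Over a s, i, i'), (Under a s, j, j'), (Over b t, k, k'), (Under b t, l, l')}"
  shows "consistent E \<longleftrightarrow> signed_crossing s i i' j j' \<and> signed_crossing t k k' l l'"
  unfolding consistent_def assms(2) using assms(1) by auto

lemma consistent_three:
  assumes "a \<noteq> b" "a \<noteq> c" "b \<noteq> c"
    and "E = {(Over a s, i, i'), (Under a s, j, j'), (Over b t, k, k'), (Under b t, l, l'),
      (Over c u, m, m'), (Under c u, n, n')}"
  shows "consistent E \<longleftrightarrow>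
    signed_crossing s i i' j j' \<and> signed_crossing t k k' l l' \<and> signed_crossing u m m' n n'"
proof
  assume "consistent E"
  then have "(Over d v, x, x') \<in> E \<Longrightarrow> (Under d v, y, y') \<in> E \<Longrightarrow> signed_crossing v x x' y y'"
    for d v x x' y y' unfolding consistent_def by blast
  from this[of a s i i' j j'] this[of b t k k' l l'] this[of c u m m' n n']
  show "signed_crossing s i i' j j' \<and> signed_crossing t k k' l l' \<and> signed_crossing u m m' n n'"
    unfolding assms(4) by simp
next
  assume "signed_crossing s i i' j j' \<and> signed_crossing t k k' l l' \<and> signed_crossing u m m' n n'"
  then show "consistent E"
    unfolding consistent_def assms(4) using assms(1-3) by auto
qed

lemma local_coloring_Nil1: "local_coloring [[]] \<beta> h \<longleftrightarrow> h 0 = [] \<and> fst (\<beta> 0) = snd (\<beta> 0)"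
  by (simp add: local_coloring_def hole_fits_Nil consistent_empty)

lemma local_coloring_Nil2:
  "local_coloring [[], []] \<beta> h \<longleftrightarrow> h 0 = [] \<and> h 1 = [] \<and>
     fst (\<beta> 0) = snd (\<beta> 0) \<and> fst (\<beta> 1) = snd (\<beta> 1)"
  by (auto simp: local_coloring_def hole_fits_Nil consistent_empty lessThan_Suc less_Suc_eq)

text \<open>
  If strand \<open>n\<close> has two passages, then it has a single inner arc, whose color is \<open>m n\<close>.
\<close>

definition local_solution ::
  "'c passage list list \<Rightarrow> (nat \<Rightarrow> 'a \<times> 'a) \<Rightarrow> (nat \<Rightarrow> 'a) \<Rightarrow> bool" where
  "local_solution ws \<beta> m \<longleftrightarrow> (\<forall>n<length ws. m n \<in> carrier X) \<and>
     consistent (\<Union>n<length ws. events (fst (\<beta> n)) (ws ! n) [m n, snd (\<beta> n)])"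

definition two_letter_words :: "'c passage list list \<Rightarrow> (nat \<Rightarrow> 'a \<times> 'a) \<Rightarrow> bool" where
  "two_letter_words ws \<beta> \<longleftrightarrow> (\<forall>n<length ws. length (ws ! n) = 2 \<and> snd (\<beta> n) \<in> carrier X)"

lemma local_coloring_two_letters:
  assumes two: "two_letter_words ws \<beta>"
  shows "local_coloring ws \<beta> h \<longleftrightarrow>
    (\<exists>m. (\<forall>n<length ws. h n = [m n, snd (\<beta> n)]) \<and> local_solution ws \<beta> m)"
proof -
  have fits: "hole_fits ws (carrier X) n (fst (\<beta> n)) (snd (\<beta> n)) ys \<longleftrightarrow>
      (\<exists>x. ys = [x, snd (\<beta> n)] \<and> x \<in> carrier X)" if n: "n < length ws" for n ys
  proof -
    have len: "length (ws ! n) = 2" "snd (\<beta> n) \<in> carrier X"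
      using two n by (simp_all add: two_letter_words_def)
    show ?thesis
      unfolding hole_fits_def len(1) using len(2) by (auto simp: length_Suc_conv numeral_2_eq_2)
  qed
  have ev: "(\<Union>n<length ws. events (fst (\<beta> n)) (ws ! n) (h n)) =
      (\<Union>n<length ws. events (fst (\<beta> n)) (ws ! n) [m n, snd (\<beta> n)])"
    if "\<forall>n<length ws. h n = [m n, snd (\<beta> n)]" for m using that by simp
  show ?thesis
  proof
    assume h: "local_coloring ws \<beta> h"
    then have "\<forall>n<length ws. \<exists>x. h n = [x, snd (\<beta> n)] \<and> x \<in> carrier X"
      using fits unfolding local_coloring_def by blast
    then obtain m where m: "\<forall>n<length ws. h n = [m n, snd (\<beta> n)] \<and> m n \<in> carrier X" by metis
    then show "\<exists>m. (\<forall>n<length ws. h n = [m n, snd (\<beta> n)]) \<and> local_solution ws \<beta> m"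
      using h ev[of m] unfolding local_coloring_def local_solution_def by auto
  next
    assume "\<exists>m. (\<forall>n<length ws. h n = [m n, snd (\<beta> n)]) \<and> local_solution ws \<beta> m"
    then obtain m where "\<forall>n<length ws. h n = [m n, snd (\<beta> n)]" "local_solution ws \<beta> m" by blast
    then show "local_coloring ws \<beta> h"
      using ev[of m] fits unfolding local_coloring_def local_solution_def by simp
  qed
qed

lemma local_coloring_iff_solution:
  assumes "two_letter_words ws \<beta>"
  shows "(\<exists>h. local_coloring ws \<beta> h) \<longleftrightarrow> (\<exists>m. local_solution ws \<beta> m)"
proof
  assume "\<exists>m. local_solution ws \<beta> m"
  then obtain m where "local_solution ws \<beta> m" by blast
  then have "local_coloring ws \<beta> (\<lambda>n. [m n, snd (\<beta> n)])"
    unfolding local_coloring_two_letters[OF assms] by blast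
  then show "\<exists>h. local_coloring ws \<beta> h" by blast
qed (use local_coloring_two_letters[OF assms] in blast)

lemma rigid_solution:
  assumes "two_letter_words ws \<beta>"
    and unique: "\<And>m m' n. local_solution ws \<beta> m \<Longrightarrow> local_solution ws \<beta> m' \<Longrightarrow> n < length ws \<Longrightarrow> m n = m' n"
  shows "rigid ws \<beta>"
  unfolding rigid_def local_coloring_two_letters[OF assms(1)]
proof (intro allI impI; elim exE conjE)
  fix h h' n m m'
  assume "\<forall>n<length ws. h n = [m n, snd (\<beta> n)]" "local_solution ws \<beta> m"
    and "\<forall>n<length ws. h' n = [m' n, snd (\<beta> n)]" "local_solution ws \<beta> m'" and n: "n < length ws"
  then show "h n = h' n" using unique[of m m' n] by simp
qed

text \<open>
  The two ends of a kink are opposite to its loop, whose two ends carry the same color. A coloring of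
  the kink therefore exists iff the ends agree, and the color of the loop is determined by them.
\<close>

lemma R1_local_colorings:
  assumes \<beta>: "fst (\<beta> 0) \<in> carrier X" "snd (\<beta> 0) \<in> carrier X"
    and w: "w = (if first then [Over a s, Under a s] else [Under a s, Over a s])"
  shows "rigid [w] \<beta>" and "(\<exists>h. local_coloring [[]] \<beta> h) \<longleftrightarrow> (\<exists>h. local_coloring [w] \<beta> h)"
proof -
  let ?i = "fst (\<beta> 0)" and ?o = "snd (\<beta> 0)"
  define F where "F x = signed_crossing s (if first then ?i else x) (if first then x else ?o)
      (if first then x else ?i) (if first then ?o else x)" for x
  have two: "two_letter_words [w] \<beta>" using w \<beta> by (simp add: two_letter_words_def)
  have "consistent (events ?i w [x, ?o]) \<longleftrightarrow> F x" for x
    unfolding F_def by (rule consistent_one) (use w in \<open>cases first; auto\<close>)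
  moreover have "x \<in> carrier X" if "F x" for x
    using signed_crossing_carrier[OF that[unfolded F_def]] by (cases first) simp_all
  ultimately have sol: "local_solution [w] \<beta> m \<longleftrightarrow> F (m 0)" for m
    unfolding local_solution_def by (auto simp: lessThan_Suc)
  have uniq: "x = x'" if "F x" "F x'" for x x'
    using signed_crossing_unique[OF that[unfolded F_def]] by (cases first) simp_all
  show "rigid [w] \<beta>"
    by (rule rigid_solution[OF two]) (use uniq sol in auto)
  have "(\<exists>x. F x) \<longleftrightarrow> ?i = ?o"
  proof (cases "first \<longleftrightarrow> s = 1")
    case True
    then have "F = (\<lambda>x. if first then crossing ?o ?i x x else crossing ?i ?o x x)"
      unfolding F_def signed_crossing_def by (intro ext) auto
    then show ?thesis
      using crossing_loop_target[of ?o ?i, THEN HOL.sym] crossing_loop_target[of ?i ?o]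
        crossing_loop_source_ex[OF \<beta>(1)] by (cases first) auto
  next
    case False
    then have "F = (\<lambda>x. if first then crossing x x ?o ?i else crossing x x ?i ?o)"
      unfolding F_def signed_crossing_def by (intro ext) auto
    then show ?thesis
      using crossing_loop_source[of _ ?o ?i, THEN HOL.sym] crossing_loop_source[of _ ?i ?o]
        crossing_loop_target_ex[OF \<beta>(1)] by (cases first) auto
  qed
  moreover have "(\<exists>m. F (m (0::nat))) \<longleftrightarrow> (\<exists>x. F x)"
    by (rule iffI, blast, elim exE, rule exI[of _ "\<lambda>_. _"])
  moreover have "(\<exists>h. local_coloring [[]] \<beta> h) \<longleftrightarrow> ?i = ?o"
    unfolding local_coloring_Nil1 by (auto intro!: exI[of _ "\<lambda>n. []"])
  ultimately show "(\<exists>h. local_coloring [[]] \<beta> h) \<longleftrightarrow> (\<exists>h. local_coloring [w] \<beta> h)"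
    unfolding local_coloring_iff_solution[OF two] sol by simp
qed

text \<open>
  The second crossing has the opposite sign and therefore undoes the first: both express the same
  crossing relation, once between the inner arcs and the incoming over-arc, once between the inner arcs
  and the outgoing over-arc. By uniqueness at a crossing the outer arcs of each strand agree.
\<close>

lemma R2_local_colorings:
  assumes s: "s \<in> {1, -1}" and \<beta>: "\<And>n. n < 2 \<Longrightarrow> fst (\<beta> n) \<in> carrier X \<and> snd (\<beta> n) \<in> carrier X"
    and ab: "a \<noteq> b" and v: "v = (if par then [Under a s, Under b (-s)] else [Under b (-s), Under a s])"
  shows "rigid [[Over a s, Over b (-s)], v] \<beta>"
    and "(\<exists>h. local_coloring [[], []] \<beta> h) \<longleftrightarrow>
         (\<exists>h. local_coloring [[Over a s, Over b (-s)], v] \<beta> h)"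
proof -
  let ?ws = "[[Over a s, Over b (-s)], v]"
  let ?i = "fst (\<beta> 0)" and ?o = "snd (\<beta> 0)" and ?j = "fst (\<beta> 1)" and ?u = "snd (\<beta> 1)"
  define A where "A x y = signed_crossing s ?i x (if par then ?j else y) (if par then y else ?u)" for x y
  define B where "B x y = signed_crossing s ?o x (if par then ?u else y) (if par then y else ?j)" for x y
  have two: "two_letter_words ?ws \<beta>"
    using v \<beta>[of 0] \<beta>[of 1] by (auto simp: two_letter_words_def less_Suc_eq)
  have sol: "local_solution ?ws \<beta> m \<longleftrightarrow> A (m 0) (m 1) \<and> B (m 0) (m 1)" for m
  proof -
    have "(\<Union>n<length ?ws. events (fst (\<beta> n)) (?ws ! n) [m n, snd (\<beta> n)]) =
        events ?i [Over a s, Over b (-s)] [m 0, ?o] \<union> events ?j v [m 1, ?u]"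
      by (simp add: lessThan_Suc Un_commute)
    also have "consistent \<dots> \<longleftrightarrow> signed_crossing s ?i (m 0) (if par then ?j else m 1) (if par then m 1 else ?u) \<and>
        signed_crossing (-s) (m 0) ?o (if par then m 1 else ?j) (if par then ?u else m 1)"
      by (rule consistent_two[OF ab]) (cases par; simp add: v insert_commute)
    finally have eq: "consistent (\<Union>n<length ?ws. events (fst (\<beta> n)) (?ws ! n) [m n, snd (\<beta> n)]) \<longleftrightarrow>
        A (m 0) (m 1) \<and> B (m 0) (m 1)"
      unfolding A_def B_def signed_crossing_uminus[OF s] .
    have "m 0 \<in> carrier X \<and> m 1 \<in> carrier X" if "A (m 0) (m 1)"
      using signed_crossing_carrier[OF that[unfolded A_def]] by (cases par) simp_all
    then show ?thesis unfolding local_solution_def eq by (auto simp: less_Suc_eq)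
  qed
  have uniq: "x = x' \<and> y = y'" if "A x y" "A x' y'" for x y x' y'
    using signed_crossing_unique[OF that[unfolded A_def]] by (cases par) simp_all
  show "rigid ?ws \<beta>"
  proof (rule rigid_solution[OF two])
    fix m m' n assume "local_solution ?ws \<beta> m" "local_solution ?ws \<beta> m'" and n: "n < length ?ws"
    then have "m 0 = m' 0 \<and> m 1 = m' 1" using uniq unfolding sol by blast
    moreover have "n = 0 \<or> n = 1" using n by auto
    ultimately show "m n = m' n" by blast
  qed
  have trivial: "?i = ?o \<and> ?j = ?u" if "A x y" "B x y" for x y
  proof -
    note eq = signed_crossing_unique[OF that[unfolded A_def B_def] disjI2[OF HOL.refl]]
    show ?thesis using eq by (cases par) simp_all
  qed
  have there: "\<exists>x y. A x y \<and> B x y" if eq: "?i = ?o" "?j = ?u"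
  proof -
    have c: "?o \<in> carrier X" "?u \<in> carrier X" using \<beta>[of 0] \<beta>[of 1] by simp_all
    have "A = B" by (intro ext) (simp only: A_def B_def eq)
    moreover have "\<exists>x y. B x y"
      unfolding B_def eq
      using signed_crossing_ex_in_in[OF c, of s] signed_crossing_ex_in_out[OF c, of s]
      by (cases par) auto
    ultimately show ?thesis by simp
  qed
  have "(\<exists>m. A (m 0) (m (1::nat)) \<and> B (m 0) (m 1)) \<longleftrightarrow> ?i = ?o \<and> ?j = ?u"
  proof
    assume "?i = ?o \<and> ?j = ?u"
    then obtain x y where "A x y \<and> B x y" using there by blast
    then show "\<exists>m. A (m 0) (m (1::nat)) \<and> B (m 0) (m 1)"
      by (intro exI[of _ "\<lambda>n. if n = 0 then x else y"]) simp
  qed (use trivial in blast)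
  moreover have "(\<exists>h. local_coloring [[], []] \<beta> h) \<longleftrightarrow> ?i = ?o \<and> ?j = ?u"
    unfolding local_coloring_Nil2 by (auto intro!: exI[of _ "\<lambda>n. []"])
  ultimately show "(\<exists>h. local_coloring [[], []] \<beta> h) \<longleftrightarrow> (\<exists>h. local_coloring ?ws \<beta> h)"
    unfolding local_coloring_iff_solution[OF two] sol by blast
qed

lemma local_solution_triangle:
  assumes abc: "a \<noteq> b" "a \<noteq> c" "b \<noteq> c"
    and tp: "tp = (if \<alpha> then [Over a k, Over b l] else [Over b l, Over a k])"
    and md: "md = (if \<gamma> then [Under a k, Over c m] else [Over c m, Under a k])"
    and bt: "bt = (if \<delta> then [Under b l, Under c m] else [Under c m, Under b l])"
  shows "local_solution [tp, md, bt] \<beta> x \<longleftrightarrow>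
    triangle k l m \<alpha> \<gamma> \<delta> (fst (\<beta> 0)) (x 0) (snd (\<beta> 0)) (fst (\<beta> 1)) (x 1) (snd (\<beta> 1))
      (fst (\<beta> 2)) (x 2) (snd (\<beta> 2))" (is "_ \<longleftrightarrow> ?T")
proof -
  let ?ws = "[tp, md, bt]"
  have "(\<Union>n<length ?ws. events (fst (\<beta> n)) (?ws ! n) [x n, snd (\<beta> n)]) =
      events (fst (\<beta> 0)) tp [x 0, snd (\<beta> 0)] \<union> events (fst (\<beta> 1)) md [x 1, snd (\<beta> 1)] \<union>
      events (fst (\<beta> 2)) bt [x 2, snd (\<beta> 2)]"
    by (auto simp: numeral_2_eq_2 lessThan_Suc)
  also have "consistent \<dots> \<longleftrightarrow> ?T"
    unfolding triangle_def
    by (rule consistent_three[OF abc]) (simp add: tp md bt insert_commute)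
  finally have eq: "consistent (\<Union>n<length ?ws. events (fst (\<beta> n)) (?ws ! n) [x n, snd (\<beta> n)]) \<longleftrightarrow> ?T" .
  have car: "x 0 \<in> carrier X \<and> x 1 \<in> carrier X \<and> x 2 \<in> carrier X" if T: ?T
  proof -
    have "x 0 \<in> carrier X \<and> x 1 \<in> carrier X"
      using signed_crossing_carrier[OF T[unfolded triangle_def, THEN conjunct1]]
      by (cases \<alpha>; cases \<gamma>) simp_all
    moreover have "x 2 \<in> carrier X"
      using signed_crossing_carrier[OF T[unfolded triangle_def, THEN conjunct2, THEN conjunct1]]
      by (cases \<alpha>; cases \<delta>) simp_all
    ultimately show ?thesis by simp
  qed
  have "(\<forall>n<length ?ws. x n \<in> carrier X) \<longleftrightarrow> x 0 \<in> carrier X \<and> x 1 \<in> carrier X \<and> x 2 \<in> carrier X"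
    by (auto simp: numeral_2_eq_2 less_Suc_eq)
  then show ?thesis unfolding local_solution_def eq using car by blast
qed

lemma R3_local_colorings:
  assumes klmq: "k \<in> {1, -1}" "l \<in> {1, -1}" "m \<in> {1, -1}" "q \<in> {1, -1}"
    and tp: "tp = ordered_by (q * k * l) [Over a k, Over b l]"
    and md: "md = ordered_by (q * k * m) [Under a k, Over c m]"
    and bt: "bt = ordered_by (q * l * m) [Under b l, Under c m]"
    and abc: "a \<noteq> b" "a \<noteq> c" "b \<noteq> c"
    and \<beta>: "\<And>n. n < 3 \<Longrightarrow> fst (\<beta> n) \<in> carrier X \<and> snd (\<beta> n) \<in> carrier X"
  shows "rigid [tp, md, bt] \<beta>" and "rigid [rev tp, rev md, rev bt] \<beta>"
    and "(\<exists>h. local_coloring [tp, md, bt] \<beta> h) \<longleftrightarrow>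
         (\<exists>h. local_coloring [rev tp, rev md, rev bt] \<beta> h)"
proof -
  let ?\<alpha> = "q * k * l = -1" and ?\<gamma> = "q * k * m = -1" and ?\<delta> = "q * l * m = -1"
  let ?T = "\<lambda>\<alpha> \<gamma> \<delta> x y z. triangle k l m \<alpha> \<gamma> \<delta> (fst (\<beta> 0)) x (snd (\<beta> 0))
         (fst (\<beta> 1)) y (snd (\<beta> 1)) (fst (\<beta> 2)) z (snd (\<beta> 2))"
  have 1: "local_solution [tp, md, bt] \<beta> x \<longleftrightarrow> ?T ?\<alpha> ?\<gamma> ?\<delta> (x 0) (x 1) (x 2)" for x
    by (rule local_solution_triangle[OF abc]) (simp_all add: tp md bt ordered_by_def)
  have 2: "local_solution [rev tp, rev md, rev bt] \<beta> x \<longleftrightarrow>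
      ?T (\<not> ?\<alpha>) (\<not> ?\<gamma>) (\<not> ?\<delta>) (x 0) (x 1) (x 2)" for x
    by (rule local_solution_triangle[OF abc]) (simp_all add: tp md bt ordered_by_def)
  have less_3: "n = 0 \<or> n = 1 \<or> n = 2" if "n < 3" for n :: nat using that by auto
  have two: "two_letter_words [tp, md, bt] \<beta>" "two_letter_words [rev tp, rev md, rev bt] \<beta>"
    using \<beta>[of 0] \<beta>[of 1] \<beta>[of 2]
    by (auto simp: two_letter_words_def tp md bt ordered_by_def less_Suc_eq numeral_2_eq_2)
  have uniq: "x n = x' n" if "n < 3" "?T \<alpha> \<gamma> \<delta> (x 0) (x 1) (x 2)" "?T \<alpha> \<gamma> \<delta> (x' 0) (x' 1) (x' 2)"
    for x x' :: "nat \<Rightarrow> 'a" and \<alpha> \<gamma> \<delta> n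
    using triangle_unique[OF that(2,3)] less_3[OF that(1)] by blast
  show "rigid [tp, md, bt] \<beta>"
    by (rule rigid_solution[OF two(1)]) (use uniq in \<open>simp_all add: 1\<close>)
  show "rigid [rev tp, rev md, rev bt] \<beta>"
    by (rule rigid_solution[OF two(2)]) (use uniq in \<open>simp_all add: 2\<close>)
  have ex: "(\<exists>x. ?T \<alpha> \<gamma> \<delta> (x 0) (x 1) (x (2::nat))) \<longleftrightarrow> (\<exists>x y z. ?T \<alpha> \<gamma> \<delta> x y z)" for \<alpha> \<gamma> \<delta>
  proof
    assume "\<exists>x y z. ?T \<alpha> \<gamma> \<delta> x y z"
    then obtain x y z where T: "?T \<alpha> \<gamma> \<delta> x y z" by blast
    show "\<exists>x. ?T \<alpha> \<gamma> \<delta> (x 0) (x 1) (x (2::nat))"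
      by (rule exI[of _ "\<lambda>n. if n = 0 then x else if n = 1 then y else z"]) (use T in simp)
  qed blast
  have pos: "(\<exists>x y z. ?T (k * l = 1) (k * m = 1) (l * m = 1) x y z) \<longleftrightarrow>
     (\<exists>x y z. ?T (k * l \<noteq> 1) (k * m \<noteq> 1) (l * m \<noteq> 1) x y z)"
    by (rule triangle_move[OF klmq(1-3)])
  have sign: "x * y \<noteq> 1 \<longleftrightarrow> x * y = -1" if "x \<in> {1, -1}" "y \<in> {1, -1}" for x y :: int
    using that by auto
  show "(\<exists>h. local_coloring [tp, md, bt] \<beta> h) \<longleftrightarrow>
         (\<exists>h. local_coloring [rev tp, rev md, rev bt] \<beta> h)"
    unfolding local_coloring_iff_solution[OF two(1)]
      local_coloring_iff_solution[OF two(2)] 1 2 ex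
  proof (cases "q = 1")
    case True
    then have "?\<alpha> \<longleftrightarrow> k * l \<noteq> 1" "?\<gamma> \<longleftrightarrow> k * m \<noteq> 1" "?\<delta> \<longleftrightarrow> l * m \<noteq> 1"
      using sign[OF klmq(1,2)] sign[OF klmq(1,3)] sign[OF klmq(2,3)] by simp_all
    then show "(\<exists>x y z. ?T ?\<alpha> ?\<gamma> ?\<delta> x y z) \<longleftrightarrow> (\<exists>x y z. ?T (\<not> ?\<alpha>) (\<not> ?\<gamma>) (\<not> ?\<delta>) x y z)"
      using pos by simp
  next
    case False
    then have "?\<alpha> \<longleftrightarrow> k * l = 1" "?\<gamma> \<longleftrightarrow> k * m = 1" "?\<delta> \<longleftrightarrow> l * m = 1"
      using klmq(4) by simp_all
    then show "(\<exists>x y z. ?T ?\<alpha> ?\<gamma> ?\<delta> x y z) \<longleftrightarrow> (\<exists>x y z. ?T (\<not> ?\<alpha>) (\<not> ?\<gamma>) (\<not> ?\<delta>) x y z)"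
      using pos by simp
  qed
qed

lemma rigid_Nil: "rigid [[]] \<beta>" "rigid [[], []] \<beta>"
  unfolding rigid_def local_coloring_Nil1 local_coloring_Nil2 by (auto simp: less_Suc_eq)

lemma local_move_coloring:
  assumes "local_move us vs"
    and "distinct (overs (concat us))" "distinct (unders (concat us))"
    and "distinct (overs (concat vs))" "distinct (unders (concat vs))"
    and "\<And>n. n < length us \<Longrightarrow> fst (\<beta> n) \<in> carrier X \<and> snd (\<beta> n) \<in> carrier X"
  shows "length vs = length us \<and> rigid us \<beta> \<and> rigid vs \<beta> \<and>
    ((\<exists>h. local_coloring us \<beta> h) \<longleftrightarrow> (\<exists>h. local_coloring vs \<beta> h))"
  using assms
proof cases
  case (R1a s a)
  then show ?thesis using assms R1_local_colorings[of \<beta> "[Over a s, Under a s]" True a s] by (simp add: rigid_Nil)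
next
  case (R1b s a)
  then show ?thesis using assms R1_local_colorings[of \<beta> "[Under a s, Over a s]" False a s] by (simp add: rigid_Nil)
next
  case (R2a s a b)
  then show ?thesis
    using assms R2_local_colorings[of s \<beta> a b "[Under a s, Under b (-s)]" True] by (simp add: rigid_Nil)
next
  case (R2b s a b)
  then show ?thesis
    using assms R2_local_colorings[of s \<beta> a b "[Under b (-s), Under a s]" False] by (simp add: rigid_Nil)
next
  case (R3 k l m q tp a b md c bt)
  have mset: "mset (ordered_by n w) = mset w" for n and w :: "'c passage list"
    by (simp add: ordered_by_def)
  have "mset (concat us) = mset [Over a k, Over b l, Under a k, Over c m, Under b l, Under c m]"
    unfolding R3 by (simp add: mset)
  from simple_gauss_mset[OF this] have "simple_gauss us \<longleftrightarrow> a \<noteq> b \<and> a \<noteq> c \<and> b \<noteq> c"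
    by auto
  then have abc: "a \<noteq> b" "a \<noteq> c" "b \<noteq> c"
    using assms(2,3) by (simp_all add: simple_gauss_def)
  have \<beta>: "\<And>n. n < 3 \<Longrightarrow> fst (\<beta> n) \<in> carrier X \<and> snd (\<beta> n) \<in> carrier X"
    using assms(6) R3(1) by simp
  show ?thesis
    using R3_local_colorings[OF R3(3-9) abc \<beta>] R3(1,2) by simp
qed

end

section \<open>Invariance under Reidemeister moves\<close>

text \<open>
  Both strands of a crossing in the disc of a move run inside of the disc.
\<close>

lemma local_move_closed:
  assumes "local_move us vs"
  shows "length vs = length us" "set (overs (concat us)) = set (unders (concat us))"
    "set (overs (concat vs)) = set (unders (concat vs))"
  using assms by (induction rule: local_move.induct) (auto simp: ordered_by_def)

context finite_biquandle
begin

text \<open>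
  Two families of events without common crossings do not interact.
\<close>

lemma consistent_Un:
  assumes "\<And>a s t io io'. (Over a s, io) \<in> A \<Longrightarrow> (Under a t, io') \<in> B \<Longrightarrow> False"
    and "\<And>a s t io io'. (Under a s, io) \<in> A \<Longrightarrow> (Over a t, io') \<in> B \<Longrightarrow> False"
  shows "consistent (A \<union> B) \<longleftrightarrow> consistent A \<and> consistent B"
proof
  show "consistent A \<and> consistent B" if "consistent (A \<union> B)"
    using that unfolding consistent_def by blast
  assume AB: "consistent A \<and> consistent B"
  show "consistent (A \<union> B)"
    unfolding consistent_def
  proof (intro allI impI)
    fix a s i i' j j'
    assume "(Over a s, i, i') \<in> A \<union> B" "(Under a s, j, j') \<in> A \<union> B"
    then consider "(Over a s, i, i') \<in> A" "(Under a s, j, j') \<in> A"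
      | "(Over a s, i, i') \<in> B" "(Under a s, j, j') \<in> B"
      using assms(1)[of a s "(i, i')" s "(j, j')"] assms(2)[of a s "(j, j')" s "(i, i')"] by blast
    then show "signed_crossing s i i' j j'"
      using AB unfolding consistent_def by cases blast+
  qed
qed

text \<open>
  A skeleton is a coloring of the template, where holes and passages alike are letters with an incoming
  and an outgoing color. It records a coloring of a filled diagram outside of the disc of the move.
\<close>

definition skeletons :: "(nat + 'p) list list \<Rightarrow> ('a \<times> 'a list) list set" where
  "skeletons T = {c. length c = length T \<and> (\<forall>i<length T. c ! i \<in> closed_runs (T ! i))}"

definition skeleton_events ::
  "(nat + 'p) list list \<Rightarrow> ('a \<times> 'a list) list \<Rightarrow> ((nat + 'p) \<times> 'a \<times> 'a) set" where
  "skeleton_events T c = (\<Union>i<length T. run_events (T ! i) (c ! i))"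

definition fill_coloring ::
  "(nat \<Rightarrow> 'a list) \<Rightarrow> (nat + 'p) list list \<Rightarrow> ('a \<times> 'a list) list \<Rightarrow> ('a \<times> 'a list) list" where
  "fill_coloring h T c = map (\<lambda>i. (fst (c ! i), fill_outs h (T ! i) (snd (c ! i)))) [0..<length T]"

text \<open>
  A hole that occurs exactly once in the template has a unique event, which the description operator
  selects.
\<close>

definition hole_boundary ::
  "(nat + 'p) list list \<Rightarrow> ('a \<times> 'a list) list \<Rightarrow> nat \<Rightarrow> 'a \<times> 'a" where
  "hole_boundary T c n = (THE io. (Inl n, io) \<in> skeleton_events T c)"

lemma skeleton_run:
  assumes "c \<in> skeletons T" "i < length T"
  shows "length (snd (c ! i)) = length (T ! i)" "last (fst (c ! i) # snd (c ! i)) = fst (c ! i)"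
    "fst (c ! i) \<in> carrier X" "set (snd (c ! i)) \<subseteq> carrier X"
proof -
  have "c ! i \<in> closed_runs (T ! i)" using assms by (simp add: skeletons_def)
  then show "length (snd (c ! i)) = length (T ! i)" "last (fst (c ! i) # snd (c ! i)) = fst (c ! i)"
    "fst (c ! i) \<in> carrier X" "set (snd (c ! i)) \<subseteq> carrier X"
    unfolding closed_runs_def case_prod_beta by blast+
qed

lemma skeleton_events_carrier:
  assumes "c \<in> skeletons T" "(q, i, t) \<in> skeleton_events T c"
  shows "i \<in> carrier X \<and> t \<in> carrier X"
proof -
  obtain k where k: "k < length T" "(q, i, t) \<in> events (fst (c ! k)) (T ! k) (snd (c ! k))"
    using assms(2) by (auto simp: skeleton_events_def run_events_def)
  show ?thesis
    using events_subset[OF k(2)] skeleton_run[OF assms(1) k(1)] by auto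
qed

lemma fits_skeleton:
  "fits ws h Q (skeleton_events T c) \<longleftrightarrow>
     (\<forall>i<length T. fits ws h Q (events (fst (c ! i)) (T ! i) (snd (c ! i))))"
  by (auto simp: fits_def skeleton_events_def run_events_def)

context
  fixes T :: "(nat + 'c passage) list list" and k :: nat
  assumes holes: "mset (concat (map holes T)) = mset [0..<k]"
begin

lemma holes_distinct: "distinct (concat (map holes T))"
  using holes mset_eq_imp_distinct_iff distinct_upt by blast

lemma holes_set: "set (concat (map holes T)) = {..<k}"
  using holes by (metis lessThan_atLeast0 set_mset_mset set_upt)

lemma hole_unique:
  assumes "i < length T" "j < length T" "n \<in> set (holes (T ! i))" "n \<in> set (holes (T ! j))"
  shows "i = j"
  using concat_index_unique[OF holes_distinct, of i j n] assms by simp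

lemma holes_word_distinct: "i < length T \<Longrightarrow> distinct (holes (T ! i))"
  using holes_distinct nth_mem[of i T] by (auto simp: distinct_concat_iff)

lemma hole_boundary:
  assumes "c \<in> skeletons T"
  shows "(Inl n, io) \<in> skeleton_events T c \<longleftrightarrow> n < k \<and> io = hole_boundary T c n"
proof -
  have unique: "io = io'"
    if io: "(Inl n, io) \<in> skeleton_events T c" and io': "(Inl n, io') \<in> skeleton_events T c" for io io'
  proof -
    obtain i where i: "i < length T" "(Inl n, io) \<in> events (fst (c ! i)) (T ! i) (snd (c ! i))"
      using io by (auto simp: skeleton_events_def run_events_def)
    obtain j where j: "j < length T" "(Inl n, io') \<in> events (fst (c ! j)) (T ! j) (snd (c ! j))"
      using io' by (auto simp: skeleton_events_def run_events_def)
    have "i = j" using hole_unique[OF i(1) j(1) hole_event[OF i(2)] hole_event[OF j(2)]] .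
    then show ?thesis
      using hole_event_unique[OF holes_word_distinct[OF i(1)] i(2)] j(2) by simp
  qed
  have less: "n < k" if io: "(Inl n, io) \<in> skeleton_events T c" for io
  proof -
    obtain i where i: "i < length T" "(Inl n, io) \<in> events (fst (c ! i)) (T ! i) (snd (c ! i))"
      using io by (auto simp: skeleton_events_def run_events_def)
    have "n \<in> set (concat (map holes T))" using hole_event[OF i(2)] nth_mem[OF i(1)] by auto
    then show ?thesis unfolding holes_set by simp
  qed
  have ex: "\<exists>io. (Inl n, io) \<in> skeleton_events T c" if "n < k"
  proof -
    have "n \<in> set (concat (map holes T))" unfolding holes_set using that by simp
    then obtain w where w: "w \<in> set T" "n \<in> set (holes w)" by auto
    obtain i where i: "i < length T" "n \<in> set (holes (T ! i))"
      using w in_set_conv_nth[of w T] by blast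
    obtain io where "(Inl n, io) \<in> events (fst (c ! i)) (T ! i) (snd (c ! i))"
      using hole_event_ex[OF skeleton_run(1)[OF assms i(1)] i(2)] by blast
    then show ?thesis using i(1) unfolding skeleton_events_def run_events_def by blast
  qed
  have "(Inl n, hole_boundary T c n) \<in> skeleton_events T c" if n: "n < k"
  proof -
    obtain io where io: "(Inl n, io) \<in> skeleton_events T c" using ex[OF n] by blast
    have "hole_boundary T c n = io"
      unfolding hole_boundary_def by (rule the_equality[where P = "\<lambda>io. (Inl n, io) \<in> skeleton_events T c", OF io unique[OF _ io]])
    then show ?thesis using io by simp
  qed
  then show ?thesis using less unique by blast
qed

lemma fill_coloring_events:
  assumes "c \<in> skeletons T" "fits ws h (carrier X) (skeleton_events T c)"
  shows "(\<Union>i<length (fill ws T). run_events (fill ws T ! i) (fill_coloring h T c ! i)) =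
    {(p, io). (Inr p, io) \<in> skeleton_events T c} \<union>
    (\<Union>n<k. events (fst (hole_boundary T c n)) (ws ! n) (h n))"
proof -
  let ?E = "\<lambda>i. events (fst (c ! i)) (T ! i) (snd (c ! i))"
  let ?H = "\<lambda>E. \<Union>(q, i, t) \<in> E. case q of Inl n \<Rightarrow> events i (ws ! n) (h n) | Inr p \<Rightarrow> {}"
  have "(\<Union>i<length (fill ws T). run_events (fill ws T ! i) (fill_coloring h T c ! i)) =
    (\<Union>i<length T. events (fst (c ! i)) (fill_word ws (T ! i)) (fill_outs h (T ! i) (snd (c ! i))))"
    by (simp add: fill_def fill_coloring_def run_events_def)
  also have "\<dots> = (\<Union>i<length T. {(p, io). (Inr p, io) \<in> ?E i} \<union> ?H (?E i))"
  proof (rule SUP_cong[OF HOL.refl])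
    fix i assume "i \<in> {..<length T}"
    then have i: "i < length T" by simp
    have "fits ws h (carrier X) (?E i)" using assms(2) i unfolding fits_skeleton by blast
    from fill_outs_events[OF skeleton_run(1)[OF assms(1) i] this]
    show "events (fst (c ! i)) (fill_word ws (T ! i)) (fill_outs h (T ! i) (snd (c ! i))) =
      {(p, io). (Inr p, io) \<in> ?E i} \<union> ?H (?E i)" .
  qed
  also have "\<dots> = {(p, io). (Inr p, io) \<in> skeleton_events T c} \<union> ?H (skeleton_events T c)"
    unfolding skeleton_events_def run_events_def by blast
  also have "?H (skeleton_events T c) = (\<Union>n<k. events (fst (hole_boundary T c n)) (ws ! n) (h n))"
  proof
    show "?H (skeleton_events T c) \<subseteq> (\<Union>n<k. events (fst (hole_boundary T c n)) (ws ! n) (h n))"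
    proof
      fix e assume "e \<in> ?H (skeleton_events T c)"
      then obtain q i t where q: "(q, i, t) \<in> skeleton_events T c"
        "e \<in> (case q of Inl n \<Rightarrow> events i (ws ! n) (h n) | Inr p \<Rightarrow> {})" by blast
      then obtain n where n: "q = Inl n" "e \<in> events i (ws ! n) (h n)"
        by (cases q) auto
      then have nk: "n < k" and b: "(i, t) = hole_boundary T c n"
        using q(1) hole_boundary[OF assms(1), of n "(i, t)"] by simp_all
      have "fst (hole_boundary T c n) = i" using b[symmetric] by simp
      then show "e \<in> (\<Union>n<k. events (fst (hole_boundary T c n)) (ws ! n) (h n))"
        using n(2) nk by blast
    qed
    show "(\<Union>n<k. events (fst (hole_boundary T c n)) (ws ! n) (h n)) \<subseteq> ?H (skeleton_events T c)"
    proof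
      fix e assume "e \<in> (\<Union>n<k. events (fst (hole_boundary T c n)) (ws ! n) (h n))"
      then obtain n where n: "n < k" "e \<in> events (fst (hole_boundary T c n)) (ws ! n) (h n)" by blast
      then have "(Inl n, fst (hole_boundary T c n), snd (hole_boundary T c n)) \<in> skeleton_events T c"
        using hole_boundary[OF assms(1)] by simp
      then show "e \<in> ?H (skeleton_events T c)" by (rule UN_I) (simp add: n(2) case_prod_beta)
    qed
  qed
  finally show ?thesis .
qed

lemma local_coloring_iff:
  assumes "c \<in> skeletons T" "length ws = k"
  shows "local_coloring ws (hole_boundary T c) h \<longleftrightarrow>
    fits ws h (carrier X) (skeleton_events T c) \<and>
    consistent (\<Union>n<k. events (fst (hole_boundary T c n)) (ws ! n) (h n))"
proof -
  have "fits ws h (carrier X) (skeleton_events T c) \<longleftrightarrow> (\<forall>n<k. hole_fits ws (carrier X) n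
     (fst (hole_boundary T c n)) (snd (hole_boundary T c n)) (h n))"
    unfolding fits_def hole_boundary[OF assms(1)] by (auto simp: prod_eq_iff)
  then show ?thesis unfolding local_coloring_def assms(2) by simp
qed

text \<open>
  The labels of the filling are disjoint from those of the template, so the crossing conditions
  separate into those outside and those inside of the disc.
\<close>

lemma fill_coloring_in_colorings:
  assumes c: "c \<in> skeletons T" and len: "length ws = k"
    and simple: "simple_gauss (fill ws T)"
    and closed: "set (overs (concat ws)) = set (unders (concat ws))"
    and fits: "fits ws h (carrier X) (skeleton_events T c)"
  shows "fill_coloring h T c \<in> colorings (fill ws T) \<longleftrightarrow>
    consistent {(p, io). (Inr p, io) \<in> skeleton_events T c} \<and>
    local_coloring ws (hole_boundary T c) h"
proof -
  let ?A = "{(p, io). (Inr p, io) \<in> skeleton_events T c}"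
  let ?B = "\<Union>n<k. events (fst (hole_boundary T c n)) (ws ! n) (h n)"
  have runs: "fill_coloring h T c ! i \<in> closed_runs (fill ws T ! i)" if "i < length T" for i
    using fill_outs_run[OF skeleton_run(1)[OF c that], of ws h "carrier X" "fst (c ! i)"]
      fits that skeleton_run[OF c that]
    unfolding fits_skeleton by (simp add: fill_coloring_def fill_def closed_runs_def del: last.simps)
  have "simple_gauss (fill ws T) \<longleftrightarrow>
      distinct (overs (concat (map fixed_part T) @ concat ws)) \<and>
      distinct (unders (concat (map fixed_part T) @ concat ws))"
    using holes len by (intro simple_gauss_mset mset_fill) simp
  then have disj: "set (overs (concat (map fixed_part T))) \<inter> set (overs (concat ws)) = {}"
    "set (unders (concat (map fixed_part T))) \<inter> set (overs (concat ws)) = {}"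
    using simple closed by auto
  have A: "p \<in> set (concat (map fixed_part T))" if p: "(p, io) \<in> ?A" for p io
  proof -
    obtain i where i: "i < length T" "(Inr p, io) \<in> events (fst (c ! i)) (T ! i) (snd (c ! i))"
      using p by (auto simp: skeleton_events_def run_events_def)
    have "Inr p \<in> set (T ! i)" by (rule events_letter[OF i(2)])
    then have "p \<in> set (fixed_part (T ! i))" by (force simp: fixed_part_def)
    then show ?thesis using nth_mem[OF i(1)] by auto
  qed
  have B: "p \<in> set (concat ws)" if p: "(p, io) \<in> ?B" for p io
  proof -
    obtain n where n: "n < k" "(p, io) \<in> events (fst (hole_boundary T c n)) (ws ! n) (h n)"
      using p by blast
    have "p \<in> set (ws ! n)" by (rule events_letter[OF n(2)])
    then show ?thesis using nth_mem n(1) len by auto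
  qed
  have "consistent (?A \<union> ?B) \<longleftrightarrow> consistent ?A \<and> consistent ?B"
  proof (rule consistent_Un)
    fix a s t io io'
    assume "(Over a s, io) \<in> ?A" "(Under a t, io') \<in> ?B"
    then have "a \<in> set (overs (concat (map fixed_part T)))" "a \<in> set (unders (concat ws))"
      using A B unfolding in_overs_iff in_unders_iff by blast+
    then show False using disj closed by blast
  next
    fix a s t io io'
    assume "(Under a s, io) \<in> ?A" "(Over a t, io') \<in> ?B"
    then have "a \<in> set (unders (concat (map fixed_part T)))" "a \<in> set (overs (concat ws))"
      using A B unfolding in_overs_iff in_unders_iff by blast+
    then show False using disj by blast
  qed
  moreover have "length (fill_coloring h T c) = length (fill ws T)" "length (fill ws T) = length T"
    by (simp_all add: fill_coloring_def fill_def)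
  ultimately show ?thesis
    unfolding colorings_def local_coloring_iff[OF c len] using runs fill_coloring_events[OF c fits] fits
    by simp
qed

lemma fill_coloring_ex:
  assumes d: "d \<in> colorings (fill ws T)" and len: "length ws = k"
  shows "\<exists>c\<in>skeletons T. \<exists>h. fits ws h (carrier X) (skeleton_events T c) \<and> d = fill_coloring h T c"
proof -
  have dlen: "length d = length T" using d by (simp add: colorings_def fill_def)
  have run: "d ! i \<in> closed_runs (fill_word ws (T ! i))" if "i < length T" for i
    using d that by (simp add: colorings_def fill_def)
  have "\<exists>ts h. length ts = length (T ! i) \<and> set ts \<subseteq> carrier X \<and>
      fits ws h (carrier X) (events (fst (d ! i)) (T ! i) ts) \<and> snd (d ! i) = fill_outs h (T ! i) ts"
    if i: "i < length T" for i
  proof (rule fill_outs_ex[OF holes_word_distinct[OF i]])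
    show "length (snd (d ! i)) = length (fill_word ws (T ! i))" "fst (d ! i) \<in> carrier X"
      "set (snd (d ! i)) \<subseteq> carrier X"
      using run[OF i] by (auto simp: closed_runs_def)
  qed
  then obtain ts hs where *: "\<And>i. i < length T \<Longrightarrow> length (ts i) = length (T ! i) \<and>
      set (ts i) \<subseteq> carrier X \<and> fits ws (hs i) (carrier X) (events (fst (d ! i)) (T ! i) (ts i)) \<and>
      snd (d ! i) = fill_outs (hs i) (T ! i) (ts i)"
    by metis
  \<comment> \<open>The pieces obtained for the single words are put together; each hole belongs to exactly one word.\<close>
  define h where "h n = hs (SOME i. i < length T \<and> n \<in> set (holes (T ! i))) n" for n
  have h: "h n = hs i n" if "i < length T" "n \<in> set (holes (T ! i))" for i n
  proof -
    have "(SOME i. i < length T \<and> n \<in> set (holes (T ! i))) = i"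
      using that hole_unique by (intro some_equality) blast+
    then show ?thesis by (simp add: h_def)
  qed
  define c where "c = map (\<lambda>i. (fst (d ! i), ts i)) [0..<length T]"
  have nth: "c ! i = (fst (d ! i), ts i)" if "i < length T" for i using that by (simp add: c_def)
  have fit: "fits ws h (carrier X) (events (fst (d ! i)) (T ! i) (ts i))" if i: "i < length T" for i
    using * fits_cong[of "T ! i" h "hs i", OF h[OF i]] i by blast
  have outs: "snd (d ! i) = fill_outs h (T ! i) (ts i)" if i: "i < length T" for i
    using * fill_outs_cong[of "T ! i" h "hs i", OF h[OF i]] i by simp
  have "c \<in> skeletons T"
    unfolding skeletons_def
  proof (intro CollectI conjI allI impI)
    show "length c = length T" by (simp add: c_def)
    fix i assume i: "i < length T"
    have "last (fst (d ! i) # snd (d ! i)) = fst (d ! i)" "fst (d ! i) \<in> carrier X"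
      using run[OF i] by (auto simp: closed_runs_def simp del: last.simps)
    then have "last (fst (d ! i) # ts i) = fst (d ! i)" "fst (d ! i) \<in> carrier X"
      using fill_outs_run[of "ts i" "T ! i", OF _ fit[OF i]] * i outs[OF i] by simp_all
    then show "c ! i \<in> closed_runs (T ! i)"
      using * i nth[OF i] by (simp add: closed_runs_def del: last.simps)
  qed
  moreover have "fits ws h (carrier X) (skeleton_events T c)"
    unfolding fits_skeleton using fit nth by simp
  moreover have "d = fill_coloring h T c"
    using dlen nth outs by (intro nth_equalityI) (simp_all add: fill_coloring_def prod_eq_iff)
  ultimately show ?thesis by blast
qed

lemma fill_coloring_inject:
  assumes "c \<in> skeletons T" "c' \<in> skeletons T"
    and "fits ws h (carrier X) (skeleton_events T c)" "fits ws h' (carrier X) (skeleton_events T c')"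
    and eq: "fill_coloring h T c = fill_coloring h' T c'"
  shows "c = c'"
proof -
  have "c ! i = c' ! i" if i: "i < length T" for i
  proof -
    have "fill_coloring h T c ! i = fill_coloring h' T c' ! i" using eq by simp
    then have fst: "fst (c ! i) = fst (c' ! i)"
      and outs: "fill_outs h (T ! i) (snd (c ! i)) = fill_outs h' (T ! i) (snd (c' ! i))"
      using i by (simp_all add: fill_coloring_def)
    have "snd (c ! i) = snd (c' ! i)"
      using fill_outs_inject[OF skeleton_run(1)[OF assms(1) i] skeleton_run(1)[OF assms(2) i] _ _ outs]
        assms(3,4) i fst unfolding fits_skeleton by metis
    then show ?thesis using fst by (simp add: prod_eq_iff)
  qed
  moreover have "length c = length T" "length c' = length T"
    using assms by (simp_all add: skeletons_def)
  ultimately show ?thesis by (intro nth_equalityI) simp_all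
qed

lemma fill_coloring_cong:
  assumes "\<And>n. n < k \<Longrightarrow> h n = h' n"
  shows "fill_coloring h T c = fill_coloring h' T c"
proof -
  have "fill_outs h (T ! i) ts = fill_outs h' (T ! i) ts" if i: "i < length T" for i ts
  proof (rule fill_outs_cong)
    fix n assume "n \<in> set (holes (T ! i))"
    then have "n \<in> set (concat (map holes T))" using nth_mem[OF i] by auto
    then show "h n = h' n" unfolding holes_set using assms by simp
  qed
  then show ?thesis by (simp add: fill_coloring_def)
qed

lemma skeletons_Hom: "\<phi> \<in> Hom X X \<Longrightarrow> c \<in> skeletons T \<Longrightarrow> recolor \<phi> c \<in> skeletons T"
  by (simp add: skeletons_def recolor_def closed_runs_Hom)

lemma fits_Hom:
  assumes \<phi>: "\<phi> \<in> Hom X X" and c: "c \<in> skeletons T"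
    and fits: "fits ws h (carrier X) (skeleton_events T c)"
  shows "fits ws (\<lambda>n. map \<phi> (h n)) (carrier X) (skeleton_events T (recolor \<phi> c))"
proof -
  have ev: "skeleton_events T (recolor \<phi> c) = (\<lambda>(p, i, o'). (p, \<phi> i, \<phi> o')) ` skeleton_events T c"
    using c by (simp add: skeletons_def skeleton_events_def recolor_def run_events_recolor image_UN)
  have "hole_fits ws (carrier X) n (\<phi> i) (\<phi> t) (map \<phi> ys)"
    if "hole_fits ws (carrier X) n i t ys" for n i t ys
    using that Hom_carrier[OF \<phi>] by (auto simp: hole_fits_def last_map split: if_splits)
  then show ?thesis using fits unfolding fits_def ev by force
qed

lemma recolor_fill_coloring:
  assumes "c \<in> skeletons T"
  shows "recolor \<phi> (fill_coloring h T c) = fill_coloring (\<lambda>n. map \<phi> (h n)) T (recolor \<phi> c)"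
  using assms
  by (auto simp: recolor_def fill_coloring_def skeletons_def fill_outs_map intro!: nth_equalityI)

definition admissible_filling :: "'c passage list list \<Rightarrow> bool" where
  "admissible_filling ws \<longleftrightarrow> length ws = k \<and> simple_gauss (fill ws T) \<and>
     set (overs (concat ws)) = set (unders (concat ws))"

definition same_skeleton :: "'c passage list list \<Rightarrow> 'c passage list list \<Rightarrow>
    ('a \<times> 'a list) list \<Rightarrow> ('a \<times> 'a list) list \<Rightarrow> bool" where
  "same_skeleton us vs d e \<longleftrightarrow> (\<exists>c\<in>skeletons T. \<exists>h h'.
      fits us h (carrier X) (skeleton_events T c) \<and> fits vs h' (carrier X) (skeleton_events T c) \<and>
      d = fill_coloring h T c \<and> e = fill_coloring h' T c)"

lemma same_skeleton_sym: "same_skeleton us vs d e \<longleftrightarrow> same_skeleton vs us e d"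
  unfolding same_skeleton_def by blast

lemma filling_in_colorings:
  assumes "admissible_filling ws" "c \<in> skeletons T" "fits ws h (carrier X) (skeleton_events T c)"
  shows "fill_coloring h T c \<in> colorings (fill ws T) \<longleftrightarrow>
    consistent {(p, io). (Inr p, io) \<in> skeleton_events T c} \<and>
    local_coloring ws (hole_boundary T c) h"
  using assms fill_coloring_in_colorings unfolding admissible_filling_def by blast

lemma same_skeleton_ex:
  assumes us: "admissible_filling us" and vs: "admissible_filling vs"
    and ex: "\<And>c h. c \<in> skeletons T \<Longrightarrow> local_coloring us (hole_boundary T c) h \<Longrightarrow>
       \<exists>h. local_coloring vs (hole_boundary T c) h"
    and d: "d \<in> colorings (fill us T)"
  shows "\<exists>e\<in>colorings (fill vs T). same_skeleton us vs d e"
proof -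
  have len: "length us = k" "length vs = k" using us vs by (simp_all add: admissible_filling_def)
  obtain c h where c: "c \<in> skeletons T" "fits us h (carrier X) (skeleton_events T c)"
    "d = fill_coloring h T c" using fill_coloring_ex[OF d len(1)] by blast
  have *: "consistent {(p, io). (Inr p, io) \<in> skeleton_events T c}"
    "local_coloring us (hole_boundary T c) h"
    using d filling_in_colorings[OF us c(1,2)] c(3) by blast+
  then obtain h' where h': "local_coloring vs (hole_boundary T c) h'" using ex[OF c(1)] by blast
  have f: "fits vs h' (carrier X) (skeleton_events T c)"
    using h' local_coloring_iff[OF c(1) len(2)] by blast
  have "fill_coloring h' T c \<in> colorings (fill vs T)"
    using filling_in_colorings[OF vs c(1) f] *(1) h' by blast
  then show ?thesis using c f unfolding same_skeleton_def by blast
qed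

lemma same_skeleton_unique:
  assumes vs: "admissible_filling vs" and rigid: "\<And>c. c \<in> skeletons T \<Longrightarrow> rigid vs (hole_boundary T c)"
    and e: "e \<in> colorings (fill vs T)" "e' \<in> colorings (fill vs T)"
    and same: "same_skeleton us vs d e" "same_skeleton us vs d e'"
  shows "e = e'"
proof -
  obtain c h g where c: "c \<in> skeletons T" "fits us h (carrier X) (skeleton_events T c)"
    "fits vs g (carrier X) (skeleton_events T c)" "d = fill_coloring h T c" "e = fill_coloring g T c"
    using same(1) unfolding same_skeleton_def by blast
  obtain c' h' g' where c': "c' \<in> skeletons T" "fits us h' (carrier X) (skeleton_events T c')"
    "fits vs g' (carrier X) (skeleton_events T c')" "d = fill_coloring h' T c'" "e' = fill_coloring g' T c'"
    using same(2) unfolding same_skeleton_def by blast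
  have "c = c'" using fill_coloring_inject[OF c(1) c'(1) c(2) c'(2)] c(4) c'(4) by simp
  then have "local_coloring vs (hole_boundary T c) g" "local_coloring vs (hole_boundary T c) g'"
    using filling_in_colorings[OF vs c(1) c(3)] filling_in_colorings[OF vs c'(1) c'(3)] e c(5) c'(5)
    by simp_all
  then have "\<forall>n<k. g n = g' n"
    using rigid[OF c(1)] vs unfolding rigid_def admissible_filling_def by blast
  then show "e = e'"
    using fill_coloring_cong[of g g' c] c(5) c'(5) \<open>c = c'\<close> by simp
qed

lemma same_skeleton_Hom:
  assumes \<phi>: "\<phi> \<in> Hom X X" and same: "same_skeleton us vs d e"
  shows "same_skeleton us vs (recolor \<phi> d) (recolor \<phi> e)"
proof -
  obtain c h g where c: "c \<in> skeletons T" "fits us h (carrier X) (skeleton_events T c)"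
    "fits vs g (carrier X) (skeleton_events T c)" "d = fill_coloring h T c" "e = fill_coloring g T c"
    using same unfolding same_skeleton_def by blast
  show ?thesis
    unfolding same_skeleton_def c(4,5) recolor_fill_coloring[OF c(1)]
    using skeletons_Hom[OF \<phi> c(1)] fits_Hom[OF \<phi> c(1,2)] fits_Hom[OF \<phi> c(1,3)] by blast
qed

text \<open>
  Two colorings, before and after the move, correspond to each other if they have the same skeleton,
  that is, if they agree outside of the disc. This correspondence is a bijection because of the local
  statements about the move, and agreement outside of the disc is preserved by recoloring.
\<close>

lemma same_colorings_fill:
  assumes move: "local_move us vs" and len: "length us = k"
    and simple: "simple_gauss (fill us T)" "simple_gauss (fill vs T)"
  shows "same_colorings (fill us T) (fill vs T)"
proof -
  note closed = local_move_closed[OF move]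
  have adm: "admissible_filling us" "admissible_filling vs"
    using closed len simple by (simp_all add: admissible_filling_def)
  have distinct: "distinct (overs (concat ws))" "distinct (unders (concat ws))"
    if "admissible_filling ws" for ws
    using that holes mset_fill[of T ws] simple_gauss_mset[of "fill ws T"]
    unfolding admissible_filling_def by fastforce+
  have local: "rigid us (hole_boundary T c) \<and> rigid vs (hole_boundary T c) \<and>
      ((\<exists>h. local_coloring us (hole_boundary T c) h) \<longleftrightarrow>
       (\<exists>h. local_coloring vs (hole_boundary T c) h))" if c: "c \<in> skeletons T" for c
  proof -
    have "fst (hole_boundary T c n) \<in> carrier X \<and> snd (hole_boundary T c n) \<in> carrier X"
      if "n < length us" for n
      using skeleton_events_carrier[OF c] hole_boundary[OF c] len that by (metis prod.collapse)
    then show ?thesis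
      using local_move_coloring[OF move distinct[OF adm(1)] distinct[OF adm(2)]] by blast
  qed
  show ?thesis
  proof (rule equivariantly_bijectiveI[where R = "same_skeleton us vs"])
    show "\<exists>e\<in>colorings (fill vs T). same_skeleton us vs d e" if "d \<in> colorings (fill us T)" for d
      using same_skeleton_ex[OF adm _ that] local by blast
    show "\<exists>d\<in>colorings (fill us T). same_skeleton us vs d e" if "e \<in> colorings (fill vs T)" for e
      unfolding same_skeleton_sym[of us] using same_skeleton_ex[OF adm(2,1) _ that] local by blast
    show "e = e'" if "e \<in> colorings (fill vs T)" "e' \<in> colorings (fill vs T)"
      "same_skeleton us vs d e" "same_skeleton us vs d e'" for d e e'
      using same_skeleton_unique[OF adm(2) _ that] local by blast
    show "d = d'" if "d \<in> colorings (fill us T)" "d' \<in> colorings (fill us T)"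
      "same_skeleton us vs d e" "same_skeleton us vs d' e" for d d' e
      using same_skeleton_unique[OF adm(1) _ that(1,2)] that(3,4) local
      unfolding same_skeleton_sym[of us] by blast
    show "recolor \<phi> e \<in> colorings (fill vs T) \<and> same_skeleton us vs (recolor \<phi> d) (recolor \<phi> e)"
      if "\<phi> \<in> Hom X X" "e \<in> colorings (fill vs T)" "same_skeleton us vs d e" for \<phi> d e
      using colorings_Hom[OF that(1,2)] same_skeleton_Hom[OF that(1,3)] by blast
  qed (rule colorings_Hom)
qed

end

lemma same_colorings_reidemeister:
  assumes "reidemeister G G'" "simple_gauss G" "simple_gauss G'"
  shows "same_colorings G G'"
proof -
  obtain us vs T where move: "local_move us vs"
    and holes: "mset [n. w \<leftarrow> T, Inl n \<leftarrow> w] = mset [0..<length us]"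
    and G: "G = fill us T" "G' = fill vs T"
    using assms(1) unfolding reidemeister_def by blast
  have "[n. w \<leftarrow> T, Inl n \<leftarrow> w] = concat (map holes T)"
    by (simp add: holes_def[abs_def])
  then show ?thesis
    using same_colorings_fill[OF _ move HOL.refl] holes assms(2,3) G by simp
qed

end

section \<open>Homomorphisms out of a presented biquandle\<close>

lemma equiv_bq_rel: "equiv (bq_terms A) (bq_rel A R)"
  unfolding equiv_def refl_on_def sym_def trans_def bq_rel_def
  by (auto intro: bq_eq.refl bq_eq.sym bq_eq.trans)

definition bq_class :: "'g set \<Rightarrow> ('g bq_term \<times> 'g bq_term) set \<Rightarrow> 'g bq_term \<Rightarrow> 'g bq_term set" where
  "bq_class A R t = bq_rel A R `` {t}"

lemma bq_terms_simps [simp]: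
  "Gen g \<in> bq_terms A \<longleftrightarrow> g \<in> A"
  "OvrT s t \<in> bq_terms A \<longleftrightarrow> s \<in> bq_terms A \<and> t \<in> bq_terms A"
  "UnrT s t \<in> bq_terms A \<longleftrightarrow> s \<in> bq_terms A \<and> t \<in> bq_terms A"
  "OvrInv s t \<in> bq_terms A \<longleftrightarrow> s \<in> bq_terms A \<and> t \<in> bq_terms A"
  "UnrInv s t \<in> bq_terms A \<longleftrightarrow> s \<in> bq_terms A \<and> t \<in> bq_terms A"
  "SInv1 s t \<in> bq_terms A \<longleftrightarrow> s \<in> bq_terms A \<and> t \<in> bq_terms A"
  "SInv2 s t \<in> bq_terms A \<longleftrightarrow> s \<in> bq_terms A \<and> t \<in> bq_terms A"
  by (simp_all add: bq_terms_def)

lemma bq_class_eq_iff: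
  "s \<in> bq_terms A \<Longrightarrow> t \<in> bq_terms A \<Longrightarrow> bq_class A R s = bq_class A R t \<longleftrightarrow> bq_eq R s t"
  unfolding bq_class_def eq_equiv_class_iff[OF equiv_bq_rel] by (simp add: bq_rel_def)

lemma bq_class_self: "t \<in> bq_terms A \<Longrightarrow> t \<in> bq_class A R t"
  unfolding bq_class_def by (rule equiv_class_self[OF equiv_bq_rel])

lemma carrier_presented: "carrier (presented_biquandle A R) = bq_class A R ` bq_terms A"
  by (auto simp: presented_biquandle_def quotient_def bq_class_def)

lemma bq_rel_Image:
  assumes "T \<subseteq> bq_class A R t" "t \<in> T" "t \<in> bq_terms A"
  shows "bq_rel A R `` T = bq_class A R t"
proof -
  have "bq_rel A R `` {u} = bq_class A R t" if "u \<in> T" for u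
    using that assms(1) equiv_class_eq[OF equiv_bq_rel, of t u A R] unfolding bq_class_def by auto
  then show ?thesis using assms(2) by (subst Image_eq_UN) auto
qed

lemma ovr_presented:
  assumes "s \<in> bq_terms A" "t \<in> bq_terms A"
  shows "ovr (presented_biquandle A R) (bq_class A R s) (bq_class A R t) = bq_class A R (OvrT s t)"
proof -
  have "bq_rel A R `` {OvrT u v | u v. u \<in> bq_class A R s \<and> v \<in> bq_class A R t} = bq_class A R (OvrT s t)"
    using bq_class_self[OF assms(1)] bq_class_self[OF assms(2)] assms
    by (intro bq_rel_Image) (auto simp: bq_class_def bq_rel_def intro: bq_eq.cong_OvrT)
  then show ?thesis by (simp add: presented_biquandle_def)
qed

lemma unr_presented:
  assumes "s \<in> bq_terms A" "t \<in> bq_terms A"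
  shows "unr (presented_biquandle A R) (bq_class A R s) (bq_class A R t) = bq_class A R (UnrT s t)"
proof -
  have "bq_rel A R `` {UnrT u v | u v. u \<in> bq_class A R s \<and> v \<in> bq_class A R t} = bq_class A R (UnrT s t)"
    using bq_class_self[OF assms(1)] bq_class_self[OF assms(2)] assms
    by (intro bq_rel_Image) (auto simp: bq_class_def bq_rel_def intro: bq_eq.cong_UnrT)
  then show ?thesis by (simp add: presented_biquandle_def)
qed

context biquandle
begin

abbreviation sideways :: "'a \<times> 'a \<Rightarrow> 'a \<times> 'a" where
  "sideways \<equiv> \<lambda>(x, y). (ovr X y x, unr X x y)"

primrec eval_term :: "('g \<Rightarrow> 'a) \<Rightarrow> 'g bq_term \<Rightarrow> 'a" where
  "eval_term \<rho> (Gen g) = \<rho> g"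
| "eval_term \<rho> (OvrT s t) = ovr X (eval_term \<rho> s) (eval_term \<rho> t)"
| "eval_term \<rho> (UnrT s t) = unr X (eval_term \<rho> s) (eval_term \<rho> t)"
| "eval_term \<rho> (OvrInv s t) = inv_into (carrier X) (\<lambda>x. ovr X x (eval_term \<rho> t)) (eval_term \<rho> s)"
| "eval_term \<rho> (UnrInv s t) = inv_into (carrier X) (\<lambda>x. unr X x (eval_term \<rho> t)) (eval_term \<rho> s)"
| "eval_term \<rho> (SInv1 s t) =
     fst (inv_into (carrier X \<times> carrier X) sideways (eval_term \<rho> s, eval_term \<rho> t))"
| "eval_term \<rho> (SInv2 s t) =
     snd (inv_into (carrier X \<times> carrier X) sideways (eval_term \<rho> s, eval_term \<rho> t))"

lemma ovr_inv:
  assumes "x \<in> carrier X" "y \<in> carrier X"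
  shows "inv_into (carrier X) (\<lambda>x. ovr X x y) x \<in> carrier X"
    "ovr X (inv_into (carrier X) (\<lambda>x. ovr X x y) x) y = x"
    "inv_into (carrier X) (\<lambda>x. ovr X x y) (ovr X x y) = x"
  using assms ovr_bij[OF assms(2)] bij_betw_inv_into_right[OF ovr_bij[OF assms(2)]]
    bij_betw_inv_into_left[OF ovr_bij[OF assms(2)]]
  by (auto simp: bij_betw_def intro: inv_into_into)

lemma unr_inv:
  assumes "x \<in> carrier X" "y \<in> carrier X"
  shows "inv_into (carrier X) (\<lambda>x. unr X x y) x \<in> carrier X"
    "unr X (inv_into (carrier X) (\<lambda>x. unr X x y) x) y = x"
    "inv_into (carrier X) (\<lambda>x. unr X x y) (unr X x y) = x"
  using assms unr_bij[OF assms(2)] bij_betw_inv_into_right[OF unr_bij[OF assms(2)]]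
    bij_betw_inv_into_left[OF unr_bij[OF assms(2)]]
  by (auto simp: bij_betw_def intro: inv_into_into)

lemma sideways_inv:
  assumes "u \<in> carrier X" "v \<in> carrier X"
  shows "inv_into (carrier X \<times> carrier X) sideways (u, v) \<in> carrier X \<times> carrier X"
    "sideways (inv_into (carrier X \<times> carrier X) sideways (u, v)) = (u, v)"
    "inv_into (carrier X \<times> carrier X) sideways (ovr X v u, unr X u v) = (u, v)"
proof -
  have "(u, v) \<in> sideways ` (carrier X \<times> carrier X)"
    using S_bij assms by (simp add: bij_betw_def)
  then show "inv_into (carrier X \<times> carrier X) sideways (u, v) \<in> carrier X \<times> carrier X"
    by (rule inv_into_into)
  show "sideways (inv_into (carrier X \<times> carrier X) sideways (u, v)) = (u, v)"
    by (rule bij_betw_inv_into_right[OF S_bij]) (simp add: assms)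
  show "inv_into (carrier X \<times> carrier X) sideways (ovr X v u, unr X u v) = (u, v)"
    using bij_betw_inv_into_left[OF S_bij, of "(u, v)"] assms by simp
qed

lemma eval_term_carrier:
  assumes "\<And>g. \<rho> g \<in> carrier X"
  shows "eval_term \<rho> t \<in> carrier X"
proof (induction t)
  case (SInv1 s t)
  then show ?case using sideways_inv(1) by (simp add: mem_Times_iff)
next
  case (SInv2 s t)
  then show ?case using sideways_inv(1) by (simp add: mem_Times_iff)
qed (simp_all add: assms ovr_closed unr_closed ovr_inv unr_inv)

text \<open>
  A derivation of an equation between terms over some generators may pass through terms with further
  generators. Therefore every generator must be given a value in the carrier.
\<close>

lemma eval_term_sound:
  assumes \<rho>: "\<And>g. \<rho> g \<in> carrier X"
    and R: "\<And>s t. (s, t) \<in> R \<Longrightarrow> eval_term \<rho> s = eval_term \<rho> t"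
    and eq: "bq_eq R s t"
  shows "eval_term \<rho> s = eval_term \<rho> t"
proof -
  note car = eval_term_carrier[of \<rho>, OF \<rho>]
  show ?thesis
    using eq
  proof induction
    case (ax_S1 u v)
    then show ?case
      using sideways_inv(2)[OF car car, of u v]
      by (simp add: case_prod_beta)
  next
    case (ax_S2 u v)
    then show ?case
      using sideways_inv(2)[OF car car, of u v]
      by (simp add: case_prod_beta)
  next
    case (ax_S3 y x)
    then show ?case
      using sideways_inv(3)[OF car car] by simp
  next
    case (ax_S4 y x)
    then show ?case
      using sideways_inv(3)[OF car car] by simp
  qed (simp_all add: R diag exchange1 exchange2 exchange3 ovr_inv unr_inv car)
qed

definition satisfies :: "('g bq_term \<times> 'g bq_term) set \<Rightarrow> ('g \<Rightarrow> 'a) \<Rightarrow> bool" where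
  "satisfies R \<rho> \<longleftrightarrow> (\<forall>(s, t)\<in>R. eval_term \<rho> s = eval_term \<rho> t)"

text \<open>
  Generators outside of \<open>A\<close> receive the dummy value \<open>q\<close>, an arbitrary element of the carrier.
\<close>

definition generator_labels ::
  "'g set \<Rightarrow> ('g bq_term \<times> 'g bq_term) set \<Rightarrow> 'a \<Rightarrow> ('g bq_term set \<Rightarrow> 'a) \<Rightarrow> 'g \<Rightarrow> 'a" where
  "generator_labels A R q v g = (if g \<in> A then v (bq_class A R (Gen g)) else q)"

text \<open>
  A homomorphism is only required to preserve the two operations. It also commutes with the inverse
  operations, as these are determined by the operations in the target.
\<close>

lemma Hom_presented_eval:
  assumes v: "v \<in> Hom (presented_biquandle A R) X" and q: "q \<in> carrier X"
    and "t \<in> bq_terms A"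
  shows "v (bq_class A R t) = eval_term (generator_labels A R q v) t"
  using assms(3)
proof (induction t)
  have car: "v (bq_class A R t) \<in> carrier X" if "t \<in> bq_terms A" for t
    using v that carrier_presented[of A R] by (auto simp: Hom_def)
  have ovr: "v (bq_class A R (OvrT s t)) = ovr X (v (bq_class A R s)) (v (bq_class A R t))"
    and unr: "v (bq_class A R (UnrT s t)) = unr X (v (bq_class A R s)) (v (bq_class A R t))"
    if "s \<in> bq_terms A" "t \<in> bq_terms A" for s t
  proof -
    have "bq_class A R s \<in> carrier (presented_biquandle A R)"
      "bq_class A R t \<in> carrier (presented_biquandle A R)"
      using that by (simp_all add: carrier_presented)
    then show "v (bq_class A R (OvrT s t)) = ovr X (v (bq_class A R s)) (v (bq_class A R t))"
      "v (bq_class A R (UnrT s t)) = unr X (v (bq_class A R s)) (v (bq_class A R t))"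
      using v unfolding Hom_def ovr_presented[OF that, of R, symmetric]
        unr_presented[OF that, of R, symmetric] by blast+
  qed
  have class_cong: "v (bq_class A R s) = v (bq_class A R t)"
    if "bq_eq R s t" "s \<in> bq_terms A" "t \<in> bq_terms A" for s t
    using bq_class_eq_iff[OF that(2,3), of R] that(1) by simp
  {
    case (Gen g) then show ?case by (simp add: generator_labels_def)
  next
    case (OvrT s t) then show ?case by (simp add: ovr)
  next
    case (UnrT s t) then show ?case by (simp add: unr)
  next
    case (OvrInv s t)
    then have "ovr X (v (bq_class A R (OvrInv s t))) (v (bq_class A R t)) = v (bq_class A R s)"
      using ovr[of "OvrInv s t" t] class_cong[OF bq_eq.ax_ovr1] by simp
    then show ?case
      using OvrInv ovr_inv(3)[OF car[of "OvrInv s t"] car[of t]] by simp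
  next
    case (UnrInv s t)
    then have "unr X (v (bq_class A R (UnrInv s t))) (v (bq_class A R t)) = v (bq_class A R s)"
      using unr[of "UnrInv s t" t] class_cong[OF bq_eq.ax_unr1] by simp
    then show ?case
      using UnrInv unr_inv(3)[OF car[of "UnrInv s t"] car[of t]] by simp
  next
    case (SInv1 s t)
    then have "ovr X (v (bq_class A R (SInv2 s t))) (v (bq_class A R (SInv1 s t))) = v (bq_class A R s)"
      "unr X (v (bq_class A R (SInv1 s t))) (v (bq_class A R (SInv2 s t))) = v (bq_class A R t)"
      using ovr[of "SInv2 s t" "SInv1 s t"] unr[of "SInv1 s t" "SInv2 s t"]
        class_cong[OF bq_eq.ax_S1] class_cong[OF bq_eq.ax_S2] by simp_all
    then show ?case
      using SInv1 sideways_inv(3)[OF car[of "SInv1 s t"] car[of "SInv2 s t"]] by simp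
  next
    case (SInv2 s t)
    then have "ovr X (v (bq_class A R (SInv2 s t))) (v (bq_class A R (SInv1 s t))) = v (bq_class A R s)"
      "unr X (v (bq_class A R (SInv1 s t))) (v (bq_class A R (SInv2 s t))) = v (bq_class A R t)"
      using ovr[of "SInv2 s t" "SInv1 s t"] unr[of "SInv1 s t" "SInv2 s t"]
        class_cong[OF bq_eq.ax_S1] class_cong[OF bq_eq.ax_S2] by simp_all
    then show ?case
      using SInv2 sideways_inv(3)[OF car[of "SInv1 s t"] car[of "SInv2 s t"]] by simp
  }
qed

lemma Hom_presented_carrier:
  assumes "v \<in> Hom (presented_biquandle A R) X" "g \<in> A"
  shows "v (bq_class A R (Gen g)) \<in> carrier X"
proof -
  have "bq_class A R (Gen g) \<in> carrier (presented_biquandle A R)"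
    using assms(2) by (simp add: carrier_presented)
  then show ?thesis using assms(1) unfolding Hom_def by blast
qed

lemma generator_labels_satisfies:
  assumes v: "v \<in> Hom (presented_biquandle A R) X" and q: "q \<in> carrier X"
    and R: "R \<subseteq> bq_terms A \<times> bq_terms A"
  shows "satisfies R (generator_labels A R q v)"
  unfolding satisfies_def
proof clarify
  fix s t assume st: "(s, t) \<in> R"
  then have s: "s \<in> bq_terms A" and t: "t \<in> bq_terms A" and "bq_eq R s t"
    using R by (auto intro: relator)
  then have "bq_class A R s = bq_class A R t" by (simp add: bq_class_eq_iff)
  then show "eval_term (generator_labels A R q v) s = eval_term (generator_labels A R q v) t"
    using Hom_presented_eval[OF v q s] Hom_presented_eval[OF v q t] by simp
qed

lemma Hom_presented_eqI:
  assumes v: "v \<in> Hom (presented_biquandle A R) X" and w: "w \<in> Hom (presented_biquandle A R) X"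
    and q: "q \<in> carrier X"
    and eq: "\<And>g. g \<in> A \<Longrightarrow> v (bq_class A R (Gen g)) = w (bq_class A R (Gen g))"
  shows "v = w"
proof (rule extensionalityI)
  show "v \<in> extensional (carrier (presented_biquandle A R))"
    "w \<in> extensional (carrier (presented_biquandle A R))"
    using v w by (auto simp: Hom_def PiE_def)
  fix a assume "a \<in> carrier (presented_biquandle A R)"
  then obtain t where t: "t \<in> bq_terms A" "a = bq_class A R t"
    using carrier_presented[of A R] by auto
  have "generator_labels A R q v = generator_labels A R q w"
    using eq by (auto simp: generator_labels_def)
  then show "v a = w a"
    using Hom_presented_eval[OF v q t(1)] Hom_presented_eval[OF w q t(1)] t(2) by simp
qed

lemma Hom_presented_ex:
  assumes \<rho>: "\<And>g. \<rho> g \<in> carrier X" and R: "satisfies R \<rho>"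
  shows "\<exists>v\<in>Hom (presented_biquandle A R) X. \<forall>g\<in>A. v (bq_class A R (Gen g)) = \<rho> g"
proof -
  let ?F = "presented_biquandle A R"
  define v where "v = (\<lambda>a\<in>carrier ?F. eval_term \<rho> (SOME t. t \<in> a))"
  have v: "v (bq_class A R t) = eval_term \<rho> t" if t: "t \<in> bq_terms A" for t
  proof -
    have "(SOME u. u \<in> bq_class A R t) \<in> bq_class A R t"
      using bq_class_self[OF t] by (rule someI)
    then have eq: "bq_eq R t (SOME u. u \<in> bq_class A R t)"
      by (auto simp: bq_class_def bq_rel_def)
    have "eval_term \<rho> s = eval_term \<rho> u" if "(s, u) \<in> R" for s u
      using R that unfolding satisfies_def by blast
    then have "eval_term \<rho> t = eval_term \<rho> (SOME u. u \<in> bq_class A R t)"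
      using eq by (rule eval_term_sound[OF \<rho>])
    then show ?thesis using t carrier_presented[of A R] by (simp add: v_def)
  qed
  have "v \<in> Hom ?F X"
    unfolding Hom_def
  proof (intro CollectI conjI ballI PiE_I)
    fix a b assume "a \<in> carrier ?F" "b \<in> carrier ?F"
    then obtain s t where st: "s \<in> bq_terms A" "a = bq_class A R s" "t \<in> bq_terms A" "b = bq_class A R t"
      using carrier_presented[of A R] by auto
    show "v (ovr ?F a b) = ovr X (v a) (v b)" "v (unr ?F a b) = unr X (v a) (v b)"
      unfolding st(2,4) ovr_presented[OF st(1,3)] unr_presented[OF st(1,3)] using v st(1,3) by simp_all
  next
    fix a assume "a \<in> carrier ?F"
    then show "v a \<in> carrier X"
      using v eval_term_carrier[OF \<rho>] carrier_presented[of A R] by auto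
  qed (simp add: v_def)
  then show ?thesis using v by (intro bexI[of _ v]) auto
qed

lemma Hom_presented_compose:
  assumes \<phi>: "\<phi> \<in> Hom X X" and v: "v \<in> Hom (presented_biquandle A R) X"
  shows "compose (carrier (presented_biquandle A R)) \<phi> v \<in> Hom (presented_biquandle A R) X"
proof -
  let ?F = "presented_biquandle A R"
  have closed: "ovr ?F a b \<in> carrier ?F" "unr ?F a b \<in> carrier ?F"
    if "a \<in> carrier ?F" "b \<in> carrier ?F" for a b
    using that ovr_presented[of _ A _ R] unr_presented[of _ A _ R]
    by (auto simp: carrier_presented)
  have "v a \<in> carrier X" if "a \<in> carrier ?F" for a using v that by (auto simp: Hom_def)
  then show ?thesis
    using \<phi> v closed unfolding Hom_def by (auto simp: compose_def PiE_iff)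
qed

end

section \<open>Homomorphisms of the fundamental biquandle are colorings\<close>

lemma semiarc_in_less:
  assumes "i < length G" "j < length (G ! i)"
  shows "semiarc_in G i j = (i, if j = 0 then length (G ! i) - 1 else j - 1)"
proof (cases j)
  case (Suc j')
  have "(j + length (G ! i) - 1) = j' + length (G ! i)" using Suc by simp
  then show ?thesis using assms Suc by (simp add: semiarc_in_def)
qed (use assms in \<open>simp add: semiarc_in_def\<close>)

lemma semiarc_in_semiarcs: "i < length G \<Longrightarrow> j < length (G ! i) \<Longrightarrow> semiarc_in G i j \<in> semiarcs G"
  unfolding semiarc_in_less by (auto simp: semiarcs_def)

lemma semiarc_out_semiarcs: "i < length G \<Longrightarrow> j < length (G ! i) \<Longrightarrow> semiarc_out G i j \<in> semiarcs G"
  by (auto simp: semiarcs_def semiarc_out_def)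

lemma crossing_relators_terms:
  "crossing_relators G \<subseteq> bq_terms (semiarcs G) \<times> bq_terms (semiarcs G)"
proof clarify
  fix t u assume "(t, u) \<in> crossing_relators G"
  then obtain i j k l s x y x' y' where *: "i < length G" "j < length (G ! i)" "k < length G"
      "l < length (G ! k)"
      "(x, x') = (if s = (1::int) then (semiarc_out G k l, semiarc_in G k l)
                else (semiarc_in G k l, semiarc_out G k l))"
      "(y, y') = (if s = 1 then (semiarc_in G i j, semiarc_out G i j)
                else (semiarc_out G i j, semiarc_in G i j))"
      "(t, u) = (UnrT (Gen x) (Gen y), Gen x') \<or> (t, u) = (OvrT (Gen y) (Gen x), Gen y')"
    unfolding crossing_relators_def by blast
  have "x \<in> semiarcs G" "x' \<in> semiarcs G" "y \<in> semiarcs G" "y' \<in> semiarcs G"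
    using *(1-6) semiarc_in_semiarcs[OF *(1,2)] semiarc_in_semiarcs[OF *(3,4)]
      semiarc_out_semiarcs[OF *(1,2)] semiarc_out_semiarcs[OF *(3,4)] by (auto split: if_splits)
  then show "t \<in> bq_terms (semiarcs G) \<and> u \<in> bq_terms (semiarcs G)"
    using *(7) by auto
qed

text \<open>
  A component without crossings has the single semiarc \<open>(i, 0)\<close>. Its index equals \<open>length (G ! i) - 1\<close>
  because subtraction of natural numbers is truncated, so that the color before the first passage is
  that of the semiarc \<open>(i, length (G ! i) - 1)\<close> in all cases.
\<close>

definition coloring_of :: "'c gauss \<Rightarrow> (nat \<times> nat \<Rightarrow> 'x) \<Rightarrow> ('x \<times> 'x list) list" where
  "coloring_of G l = map (\<lambda>i. (l (i, length (G ! i) - 1), map (\<lambda>j. l (i, j)) [0..<length (G ! i)]))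
     [0..<length G]"

lemma coloring_of_cong:
  "(\<And>a. a \<in> semiarcs G \<Longrightarrow> l a = l' a) \<Longrightarrow> coloring_of G l = coloring_of G l'"
  by (auto simp: coloring_of_def semiarcs_def)

lemma coloring_of_inject:
  assumes "coloring_of G l = coloring_of G l'" "a \<in> semiarcs G"
  shows "l a = l' a"
proof -
  obtain i j where a: "a = (i, j)" "i < length G" "j < max 1 (length (G ! i))"
    using assms(2) by (auto simp: semiarcs_def)
  have "coloring_of G l ! i = coloring_of G l' ! i" using assms(1) by simp
  then have *: "l (i, length (G ! i) - 1) = l' (i, length (G ! i) - 1)"
    "map (\<lambda>j. l (i, j)) [0..<length (G ! i)] = map (\<lambda>j. l' (i, j)) [0..<length (G ! i)]"
    using a(2) by (simp_all add: coloring_of_def)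
  show ?thesis
  proof (cases "j < length (G ! i)")
    case True
    then show ?thesis using *(2) a(1) by simp
  next
    case False
    then have j: "j = 0" using a(3) by (simp add: less_max_iff_disj)
    then have "length (G ! i) = 0" using False by simp
    then show ?thesis using *(1) a(1) j by simp
  qed
qed

lemma recolor_coloring_of: "recolor \<phi> (coloring_of G l) = coloring_of G (\<lambda>a. \<phi> (l a))"
  by (simp add: recolor_def coloring_of_def)

lemma coloring_of_events:
  assumes "i < length G"
  shows "run_events (G ! i) (coloring_of G l ! i) =
    {(G ! i ! j, l (semiarc_in G i j), l (semiarc_out G i j)) | j. j < length (G ! i)}"
proof -
  let ?n = "length (G ! i)"
  let ?ys = "map (\<lambda>j. l (i, j)) [0..<?n]"
  have "(l (i, ?n - 1) # ?ys) ! j = l (semiarc_in G i j)" "?ys ! j = l (semiarc_out G i j)" if "j < ?n" for j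
    using that assms by (auto simp: semiarc_in_less semiarc_out_def nth_Cons')
  then show ?thesis
    using assms by (auto simp: run_events_def coloring_of_def events_nth)
qed

context finite_biquandle
begin

lemma coloring_of_closed_runs:
  assumes "\<And>a. l a \<in> carrier X" "i < length G"
  shows "coloring_of G l ! i \<in> closed_runs (G ! i)"
proof -
  have "last (map (\<lambda>j. l (i, j)) [0..<length (G ! i)]) = l (i, length (G ! i) - 1)"
    if "G ! i \<noteq> []"
    using that by (simp add: last_map)
  then show ?thesis using assms by (auto simp: closed_runs_def coloring_of_def)
qed

text \<open>
  The relators are the crossing relations, written with generators in place of colors.
\<close>

lemma coloring_of_in_colorings:
  assumes l: "\<And>a. l a \<in> carrier X"
  shows "coloring_of G l \<in> colorings G \<longleftrightarrow> satisfies (crossing_relators G) l"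
proof -
  let ?E = "\<Union>i<length G. run_events (G ! i) (coloring_of G l ! i)"
  have mem: "(p, x, y) \<in> ?E \<longleftrightarrow> (\<exists>i j. i < length G \<and> j < length (G ! i) \<and> p = G ! i ! j \<and>
      x = l (semiarc_in G i j) \<and> y = l (semiarc_out G i j))" for p x y
    using coloring_of_events[of _ G l] by auto
  have sc: "signed_crossing s (l i) (l i') (l j) (l j') \<longleftrightarrow>
     (\<forall>x x' y y'. (x, x') = (if s = 1 then (j', j) else (j, j')) \<longrightarrow>
       (y, y') = (if s = 1 then (i, i') else (i', i)) \<longrightarrow>
       unr X (l x) (l y) = l x' \<and> ovr X (l y) (l x) = l y')" for s i i' j j'
    by (cases "s = 1")
      (auto simp: signed_crossing_def crossing_def l simp del: split_paired_All split_paired_Ex)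
  have "consistent ?E \<longleftrightarrow> satisfies (crossing_relators G) l"
  proof
    assume *: "consistent ?E"
    show "satisfies (crossing_relators G) l"
      unfolding satisfies_def
    proof clarify
      fix t u assume "(t, u) \<in> crossing_relators G"
      then obtain i j k m c s x y x' y' where
        ij: "i < length G" "j < length (G ! i)" "G ! i ! j = Over c s" and
        km: "k < length G" "m < length (G ! k)" "G ! k ! m = Under c s" and
        x: "(x, x') = (if s = 1 then (semiarc_out G k m, semiarc_in G k m)
                else (semiarc_in G k m, semiarc_out G k m))" and
        y: "(y, y') = (if s = 1 then (semiarc_in G i j, semiarc_out G i j)
                else (semiarc_out G i j, semiarc_in G i j))" and
        tu: "(t, u) = (UnrT (Gen x) (Gen y), Gen x') \<or> (t, u) = (OvrT (Gen y) (Gen x), Gen y')"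
        unfolding crossing_relators_def by blast
      have "(Over c s, l (semiarc_in G i j), l (semiarc_out G i j)) \<in> ?E"
        "(Under c s, l (semiarc_in G k m), l (semiarc_out G k m)) \<in> ?E"
        unfolding mem using ij km by metis+
      then have "signed_crossing s (l (semiarc_in G i j)) (l (semiarc_out G i j))
          (l (semiarc_in G k m)) (l (semiarc_out G k m))"
        using * unfolding consistent_def by blast
      then have "unr X (l x) (l y) = l x' \<and> ovr X (l y) (l x) = l y'"
        unfolding sc using x y by blast
      then show "eval_term l t = eval_term l u" using tu by auto
    qed
  next
    assume *: "satisfies (crossing_relators G) l"
    show "consistent ?E"
      unfolding consistent_def
    proof (intro allI impI)
      fix c s o1 o2 u1 u2
      assume "(Over c s, o1, o2) \<in> ?E" "(Under c s, u1, u2) \<in> ?E"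
      then obtain i j k m where
        ij: "i < length G" "j < length (G ! i)" "G ! i ! j = Over c s"
          "o1 = l (semiarc_in G i j)" "o2 = l (semiarc_out G i j)" and
        km: "k < length G" "m < length (G ! k)" "G ! k ! m = Under c s"
          "u1 = l (semiarc_in G k m)" "u2 = l (semiarc_out G k m)"
        unfolding mem by metis
      show "signed_crossing s o1 o2 u1 u2"
        unfolding ij(4,5) km(4,5) sc
      proof (intro allI impI)
        fix x x' y y'
        assume x: "(x, x') = (if s = 1 then (semiarc_out G k m, semiarc_in G k m)
                else (semiarc_in G k m, semiarc_out G k m))" and
          y: "(y, y') = (if s = 1 then (semiarc_in G i j, semiarc_out G i j)
                else (semiarc_out G i j, semiarc_in G i j))"
        have "(UnrT (Gen x) (Gen y), Gen x') \<in> crossing_relators G"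
          "(OvrT (Gen y) (Gen x), Gen y') \<in> crossing_relators G"
          unfolding crossing_relators_def using ij(1-3) km(1-3) x y by blast+
        then show "unr X (l x) (l y) = l x' \<and> ovr X (l y) (l x) = l y'"
          using * unfolding satisfies_def by force
      qed
    qed
  qed
  then show ?thesis
    unfolding colorings_def using coloring_of_closed_runs[of l _ G, OF l]
    by (simp add: coloring_of_def[of G l, THEN arg_cong[of _ _ length]])
qed

lemma coloring_of_ex:
  assumes c: "c \<in> colorings G" and q: "q \<in> carrier X"
  shows "\<exists>l. (\<forall>a. l a \<in> carrier X) \<and> c = coloring_of G l"
proof -
  define l where "l = (\<lambda>(i, j). if i < length G then
     (if j < length (G ! i) then snd (c ! i) ! j else fst (c ! i)) else q)"
  have run: "length (snd (c ! i)) = length (G ! i)" "last (fst (c ! i) # snd (c ! i)) = fst (c ! i)"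
    "fst (c ! i) \<in> carrier X" "set (snd (c ! i)) \<subseteq> carrier X" if "i < length G" for i
  proof -
    have "c ! i \<in> closed_runs (G ! i)" using c that by (simp add: colorings_def)
    then show "length (snd (c ! i)) = length (G ! i)" "last (fst (c ! i) # snd (c ! i)) = fst (c ! i)"
      "fst (c ! i) \<in> carrier X" "set (snd (c ! i)) \<subseteq> carrier X"
      unfolding closed_runs_def case_prod_beta by blast+
  qed
  have "l a \<in> carrier X" for a
  proof (cases a)
    case (Pair i j)
    have "snd (c ! i) ! j \<in> carrier X" if "i < length G" "j < length (G ! i)"
      using run(1,4)[OF that(1)] nth_mem[of j "snd (c ! i)"] that(2) by auto
    then show ?thesis using run(3) q Pair by (simp add: l_def)
  qed
  moreover have "c = coloring_of G l"
  proof (rule nth_equalityI)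
    show "length c = length (coloring_of G l)" using c by (simp add: coloring_of_def colorings_def)
    fix i assume "i < length c"
    then have i: "i < length G" using c by (simp add: colorings_def)
    have "snd (c ! i) = map (\<lambda>j. l (i, j)) [0..<length (G ! i)]"
      using run(1)[OF i] i by (intro nth_equalityI) (simp_all add: l_def)
    moreover have "fst (c ! i) = l (i, length (G ! i) - 1)"
    proof (cases "G ! i = []")
      case False
      then have ne: "snd (c ! i) \<noteq> []" using run(1)[OF i] by force
      then have "last (snd (c ! i)) = fst (c ! i)" using run(2)[OF i] by simp
      then show ?thesis using ne run(1)[OF i] False i by (simp add: l_def last_conv_nth)
    qed (simp add: l_def i)
    ultimately show "c ! i = coloring_of G l ! i"
      using i by (simp add: coloring_of_def prod_eq_iff)
  qed
  ultimately show ?thesis by blast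
qed

lemma Hom_colorings:
  assumes q: "q \<in> carrier X"
  shows "equivariantly_bijective (Hom X X)
    (\<lambda>\<phi> v. compose (carrier (fundamental_biquandle D)) \<phi> v) (Hom (fundamental_biquandle D) X)
    recolor (colorings (gauss_of D))"
proof -
  let ?G = "gauss_of D"
  let ?A = "semiarcs ?G" and ?R = "crossing_relators ?G"
  let ?F = "fundamental_biquandle D"
  have F: "?F = presented_biquandle ?A ?R" by (simp add: fundamental_biquandle_def)
  let ?l = "generator_labels ?A ?R q"
  have label: "?l v a \<in> carrier X" if "v \<in> Hom ?F X" for v a
    using Hom_presented_carrier[of v ?A ?R a] that q by (simp add: generator_labels_def F)
  have gen: "bq_class ?A ?R (Gen a) \<in> carrier ?F" if "a \<in> ?A" for a
    using that by (simp add: F carrier_presented)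
  show ?thesis
  proof (rule equivariantly_bijectiveI[where R = "\<lambda>v c. c = coloring_of ?G (?l v)"])
    fix v assume v: "v \<in> Hom ?F X"
    have "satisfies ?R (?l v)"
      using generator_labels_satisfies[OF v[unfolded F] q crossing_relators_terms] .
    then show "\<exists>c\<in>colorings ?G. c = coloring_of ?G (?l v)"
      using coloring_of_in_colorings[of "?l v" ?G] label[OF v] by blast
  next
    fix c assume c: "c \<in> colorings ?G"
    then obtain l where l: "\<And>a. l a \<in> carrier X" "c = coloring_of ?G l"
      using coloring_of_ex[OF c q] by blast
    then have "satisfies ?R l" using coloring_of_in_colorings[of l ?G] c by blast
    then obtain v where v: "v \<in> Hom ?F X" "\<And>a. a \<in> ?A \<Longrightarrow> v (bq_class ?A ?R (Gen a)) = l a"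
      using Hom_presented_ex[of l ?R ?A] l(1) unfolding F by blast
    have "coloring_of ?G l = coloring_of ?G (?l v)"
      by (rule coloring_of_cong) (simp add: generator_labels_def v(2))
    then show "\<exists>v\<in>Hom ?F X. c = coloring_of ?G (?l v)" using v(1) l(2) by blast
  next
    fix v w c assume v: "v \<in> Hom ?F X" and w: "w \<in> Hom ?F X"
      and "c = coloring_of ?G (?l v)" "c = coloring_of ?G (?l w)"
    then have "coloring_of ?G (?l v) = coloring_of ?G (?l w)" by simp
    note inj = coloring_of_inject[OF this]
    have "v (bq_class ?A ?R (Gen a)) = w (bq_class ?A ?R (Gen a))" if "a \<in> ?A" for a
      using inj[OF that] that by (simp add: generator_labels_def)
    then show "v = w" by (rule Hom_presented_eqI[OF v[unfolded F] w[unfolded F] q])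
  next
    fix \<phi> v c assume \<phi>: "\<phi> \<in> Hom X X" and c: "c \<in> colorings ?G" and vc: "c = coloring_of ?G (?l v)"
    have "recolor \<phi> c = coloring_of ?G (?l (compose (carrier ?F) \<phi> v))"
      unfolding vc recolor_coloring_of
      by (rule coloring_of_cong) (simp add: generator_labels_def compose_def gen)
    then show "recolor \<phi> c \<in> colorings ?G \<and>
        recolor \<phi> c = coloring_of ?G (?l (compose (carrier ?F) \<phi> v))"
      using colorings_Hom[OF \<phi> c] by blast
  qed (use Hom_presented_compose[of _ _ ?A ?R] in \<open>simp_all add: F\<close>)
qed

end

section \<open>Crossing points of a link diagram\<close>

text \<open>
  Sorting a set by a key is well-behaved only if the key is injective on the set. For the crossings on
  an edge, with the distance from its source as the key, this is what general position provides.
\<close>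

lemma sorted_key_list_of_set_inj:
  fixes f :: "'b \<Rightarrow> 'a :: linorder"
  assumes inj: "inj_on f A" and "finite A"
  shows "set (sorted_key_list_of_set f A) = A \<and> distinct (sorted_key_list_of_set f A) \<and>
    sorted (map f (sorted_key_list_of_set f A))"
proof -
  interpret folding_on A "insort_key f" "[]"
  proof
    fix x y assume "x \<in> A" "y \<in> A"
    then show "insort_key f y \<circ> insort_key f x = insort_key f x \<circ> insort_key f y"
      using inj insort_key_left_comm[of f x y] by (cases "x = y") (auto simp: fun_eq_iff dest: inj_onD)
  qed
  have "B \<subseteq> A \<longrightarrow> set (F B) = B \<and> distinct (F B) \<and> sorted (map f (F B))" if "finite B" for B
    using that
  proof induction
    case (insert x B)
    then show ?case by (auto simp: set_insort_key distinct_insort sorted_insort_key)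
  qed simp
  then show ?thesis using assms(2) unfolding sorted_key_list_of_set_def by blast
qed

lemma sorted_key_list_of_set_strict:
  fixes f :: "'b \<Rightarrow> 'a :: linorder"
  assumes "inj_on f A" "finite A"
  shows "sorted_wrt (<) (map f (sorted_key_list_of_set f A))"
  using sorted_key_list_of_set_inj[OF assms] assms(1)
  by (simp add: strict_sorted_iff distinct_map)

lemma distinct_concat_map_key:
  assumes "distinct es" "\<And>e. e \<in> set es \<Longrightarrow> distinct (g e)"
    and "\<And>e x. e \<in> set es \<Longrightarrow> x \<in> set (g e) \<Longrightarrow> key x = e"
  shows "distinct (concat (map g es))"
  using assms
proof (induction es)
  case (Cons e es)
  have "False" if "x \<in> set (g e)" "e' \<in> set es" "x \<in> set (g e')" for x e'
    using Cons.prems(1) Cons.prems(3)[of e x] Cons.prems(3)[of e' x] that by auto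
  then show ?case using Cons by auto
qed simp

lemma open_segment_dist:
  fixes a b p :: "'a :: euclidean_space"
  assumes "p \<in> open_segment a b"
  shows "p = a + (dist a p / dist a b) *\<^sub>R (b - a)" "0 < dist a p" "dist a p < dist a b"
proof -
  obtain u where u: "a \<noteq> b" "0 < u" "u < 1" "p = (1 - u) *\<^sub>R a + u *\<^sub>R b"
    using assms in_segment(2) by blast
  then have p: "p = a + u *\<^sub>R (b - a)" by (simp add: algebra_simps)
  then have "dist a p = u * dist a b"
    using u(2) by (simp add: dist_norm norm_minus_commute)
  then show "p = a + (dist a p / dist a b) *\<^sub>R (b - a)" "0 < dist a p" "dist a p < dist a b"
    using p u(1-3) by simp_all
qed

definition crossing_partners :: "vdiagram \<Rightarrow> edge \<Rightarrow> edge set" where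
  "crossing_partners D e = {f. (e, f) \<in> over_rel D \<or> (f, e) \<in> over_rel D}"

definition partner_list :: "vdiagram \<Rightarrow> edge \<Rightarrow> edge list" where
  "partner_list D e =
     sorted_key_list_of_set (\<lambda>f. dist (src D e) (crossing_point D e f)) (crossing_partners D e)"

lemma edge_word_partner_list: "edge_word D e = map (passage_of D e) (partner_list D e)"
  by (simp add: edge_word_def partner_list_def crossing_partners_def)

lemma next_edge_in_edges: "e \<in> edges D \<Longrightarrow> next_edge D e \<in> edges D"
  by (cases e) (auto simp: edges_def next_edge_def intro: mod_less_divisor)

lemma finite_edges: "finite (edges D)"
proof -
  have "edges D \<subseteq> (\<Union>i<length (comps D). (\<lambda>j. (i, j)) ` {..<length (comps D ! i)})"
    by (auto simp: edges_def)
  then show ?thesis by (rule finite_subset) auto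
qed

locale link_diagram =
  fixes D :: vdiagram
  assumes diagram: "virtual_diagram D"
begin

lemma src_neq_tgt: "e \<in> edges D \<Longrightarrow> src D e \<noteq> tgt D e"
  using diagram unfolding virtual_diagram_def by (elim conjE) (erule (1) bspec)

lemma comp_length: "i < length (comps D) \<Longrightarrow> 3 \<le> length (comps D ! i)"
  using diagram unfolding virtual_diagram_def by (elim conjE) (erule bspec, rule nth_mem)

lemma adjacent_edges: "e \<in> edges D \<Longrightarrow> closed_edge D e \<inter> closed_edge D (next_edge D e) = {tgt D e}"
  using diagram unfolding virtual_diagram_def by (elim conjE) (erule (1) bspec)

lemma nonadjacent_edges:
  assumes "e \<in> edges D" "f \<in> edges D" "e \<noteq> f" "f \<noteq> next_edge D e" "e \<noteq> next_edge D f"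
  shows "closed_edge D e \<inter> closed_edge D f = {} \<or>
        (\<exists>p \<in> open_edge D e \<inter> open_edge D f. closed_edge D e \<inter> closed_edge D f = {p})"
proof -
  have "\<forall>e \<in> edges D. \<forall>f \<in> edges D. e \<noteq> f \<and> f \<noteq> next_edge D e \<and> e \<noteq> next_edge D f \<longrightarrow>
        closed_edge D e \<inter> closed_edge D f = {} \<or>
        (\<exists>p \<in> open_edge D e \<inter> open_edge D f. closed_edge D e \<inter> closed_edge D f = {p})"
    using diagram unfolding virtual_diagram_def by (elim conjE)
  from bspec[OF bspec[OF this assms(1)] assms(2)] show ?thesis using assms(3-5) by blast
qed

lemma no_triple_point:
  assumes "e \<in> edges D" "f \<in> edges D" "g \<in> edges D" "e \<noteq> f" "f \<noteq> g" "e \<noteq> g"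
  shows "closed_edge D e \<inter> closed_edge D f \<inter> closed_edge D g = {}"
proof -
  have "\<forall>e \<in> edges D. \<forall>f \<in> edges D. \<forall>g \<in> edges D. e \<noteq> f \<and> f \<noteq> g \<and> e \<noteq> g \<longrightarrow>
        closed_edge D e \<inter> closed_edge D f \<inter> closed_edge D g = {}"
    using diagram unfolding virtual_diagram_def by (elim conjE)
  from bspec[OF bspec[OF bspec[OF this assms(1)] assms(2)] assms(3)] show ?thesis
    using assms(4-6) by blast
qed

lemma over_crosses: "(e, f) \<in> over_rel D \<Longrightarrow> crosses D e f"
  and over_asym: "(e, f) \<in> over_rel D \<Longrightarrow> (f, e) \<notin> over_rel D"
proof -
  assume "(e, f) \<in> over_rel D"
  moreover have "\<forall>(e, f) \<in> over_rel D. crosses D e f \<and> (f, e) \<notin> over_rel D"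
    using diagram unfolding virtual_diagram_def by (elim conjE)
  ultimately show "crosses D e f" "(f, e) \<notin> over_rel D" by auto
qed

lemma crosses_sym: "crosses D e f \<Longrightarrow> crosses D f e"
  unfolding crosses_def by auto

lemma not_crosses_next: "\<not> crosses D e (next_edge D e)"
proof
  assume c: "crosses D e (next_edge D e)"
  then obtain p where p: "p \<in> open_edge D e" "p \<in> open_edge D (next_edge D e)"
    unfolding crosses_def by blast
  then have "p \<in> closed_edge D e \<inter> closed_edge D (next_edge D e)"
    by (auto simp: open_edge_def closed_edge_def open_segment_def)
  moreover have "closed_edge D e \<inter> closed_edge D (next_edge D e) = {tgt D e}"
    using adjacent_edges c unfolding crosses_def by blast
  ultimately show False using p(1) by (simp add: open_edge_def open_segment_def)
qed

lemma crosses_point: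
  assumes "crosses D e f"
  shows "crossing_point D e f \<in> open_edge D e \<inter> open_edge D f"
    "p \<in> open_edge D e \<inter> open_edge D f \<Longrightarrow> p = crossing_point D e f"
proof -
  have sub: "open_edge D g \<subseteq> closed_edge D g" for g
    by (auto simp: open_edge_def closed_edge_def open_segment_def)
  have "f \<noteq> next_edge D e" "e \<noteq> next_edge D f"
    using assms crosses_sym not_crosses_next by blast+
  then have "closed_edge D e \<inter> closed_edge D f = {} \<or>
        (\<exists>p \<in> open_edge D e \<inter> open_edge D f. closed_edge D e \<inter> closed_edge D f = {p})"
    using nonadjacent_edges[of e f] assms unfolding crosses_def by simp
  moreover have "closed_edge D e \<inter> closed_edge D f \<noteq> {}"
    using assms sub unfolding crosses_def by blast
  ultimately obtain q where q: "q \<in> open_edge D e \<inter> open_edge D f"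
    "closed_edge D e \<inter> closed_edge D f = {q}" by blast
  have eq: "p = q" if "p \<in> open_edge D e \<inter> open_edge D f" for p
    using that q(2) sub by blast
  have cp: "crossing_point D e f = q"
    unfolding crossing_point_def using q(1) eq by (rule the_equality)
  show "crossing_point D e f \<in> open_edge D e \<inter> open_edge D f"
    unfolding cp by (rule q(1))
  show "p \<in> open_edge D e \<inter> open_edge D f \<Longrightarrow> p = crossing_point D e f"
    unfolding cp by (rule eq)
qed

lemma crossing_point_sym: "crosses D e f \<Longrightarrow> crossing_point D e f = crossing_point D f e"
  using crosses_point(2)[OF crosses_sym] crosses_point(1) by (simp add: Int_commute)

lemma partner_crosses: "f \<in> crossing_partners D e \<Longrightarrow> crosses D e f"
  unfolding crossing_partners_def mem_Collect_eq using over_crosses crosses_sym by blast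

lemma partner_sym: "f \<in> crossing_partners D e \<Longrightarrow> e \<in> crossing_partners D f"
  by (auto simp: crossing_partners_def)

lemma partner_edges: "f \<in> crossing_partners D e \<Longrightarrow> e \<in> edges D \<and> f \<in> edges D"
  using partner_crosses unfolding crosses_def by blast

lemma finite_partners: "finite (crossing_partners D e)"
proof (rule finite_subset)
  show "crossing_partners D e \<subseteq> edges D" using partner_edges by blast
qed (rule finite_edges)

lemma crossing_point_inj: "inj_on (crossing_point D e) (crossing_partners D e)"
proof (rule inj_onI, rule ccontr)
  fix f g assume f: "f \<in> crossing_partners D e" and g: "g \<in> crossing_partners D e"
    and eq: "crossing_point D e f = crossing_point D e g" and "f \<noteq> g"
  have cf: "crosses D e f" and cg: "crosses D e g" using f g partner_crosses by blast+
  have "crossing_point D e f \<in> closed_edge D e \<inter> closed_edge D f \<inter> closed_edge D g"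
    using crosses_point(1)[OF cf] crosses_point(1)[OF cg] eq
    by (auto simp: open_edge_def closed_edge_def open_segment_def)
  moreover have "closed_edge D e \<inter> closed_edge D f \<inter> closed_edge D g = {}"
    using no_triple_point[of e f g] cf cg \<open>f \<noteq> g\<close> unfolding crosses_def by simp
  ultimately show False by blast
qed

lemma crossing_dist_inj:
  "inj_on (\<lambda>f. dist (src D e) (crossing_point D e f)) (crossing_partners D e)"
proof (rule inj_onI)
  fix f g assume f: "f \<in> crossing_partners D e" and g: "g \<in> crossing_partners D e"
    and eq: "dist (src D e) (crossing_point D e f) = dist (src D e) (crossing_point D e g)"
  have on: "crossing_point D e h \<in> open_segment (src D e) (tgt D e)" if "h \<in> crossing_partners D e" for h
    using crosses_point(1)[OF partner_crosses[OF that]] unfolding open_edge_def by blast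
  have "crossing_point D e f = crossing_point D e g"
    by (subst open_segment_dist(1)[OF on[OF f]], subst open_segment_dist(1)[OF on[OF g]])
      (simp add: eq)
  then show "f = g" by (rule inj_onD[OF crossing_point_inj _ f g])
qed

lemma set_partner_list: "set (partner_list D e) = crossing_partners D e"
  and distinct_partner_list: "distinct (partner_list D e)"
  and sorted_partner_list:
    "sorted_wrt (<) (map (\<lambda>f. dist (src D e) (crossing_point D e f)) (partner_list D e))"
  unfolding partner_list_def
  using sorted_key_list_of_set_inj[OF crossing_dist_inj finite_partners]
    sorted_key_list_of_set_strict[OF crossing_dist_inj finite_partners] by blast+

definition edge_list :: "edge list" where
  "edge_list = concat (map (\<lambda>i. map (Pair i) [0..<length (comps D ! i)]) [0..<length (comps D)])"

lemma distinct_edge_list: "distinct edge_list"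
  unfolding edge_list_def
  by (rule distinct_concat_map_key[where key = fst]) (auto simp: distinct_map inj_on_def)

lemma concat_gauss_of: "concat (gauss_of D) = concat (map (edge_word D) edge_list)"
proof -
  have flat: "concat (map (\<lambda>i. concat (map (\<lambda>j. g (i, j)) (js i))) ks) =
      concat (map g (concat (map (\<lambda>i. map (Pair i) (js i)) ks)))"
    for g :: "edge \<Rightarrow> (edge \<times> edge) passage list" and js ks by (induction ks) (auto simp: comp_def)
  show ?thesis unfolding gauss_of_def edge_list_def by (rule flat)
qed

lemma overs_concat_map: "overs (concat (map f es)) = concat (map (\<lambda>e. overs (f e)) es)"
  by (induction es) auto

lemma unders_concat_map: "unders (concat (map f es)) = concat (map (\<lambda>e. unders (f e)) es)"
  by (induction es) auto

text \<open>
  The label \<open>(e, f)\<close> of an over-passage names the edge \<open>e\<close> on which it lies, that of an under-passage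
  names it in the second component. So labels on different edges differ, and on one edge they differ
  because an edge meets another one at most once.
\<close>

lemma simple_gauss_of: "simple_gauss (gauss_of D)"
proof -
  have overs: "overs (map (passage_of D e) fs) = map (Pair e) (filter (\<lambda>f. (e, f) \<in> over_rel D) fs)"
    for e fs by (induction fs) (auto simp: passage_of_def)
  have unders: "unders (map (passage_of D e) fs) = map (\<lambda>f. (f, e)) (filter (\<lambda>f. (e, f) \<notin> over_rel D) fs)"
    for e fs by (induction fs) (auto simp: passage_of_def)
  have "distinct (overs (concat (gauss_of D)))"
    unfolding concat_gauss_of overs_concat_map edge_word_partner_list overs
    by (rule distinct_concat_map_key[where key = fst])
      (auto simp: distinct_edge_list distinct_map distinct_partner_list inj_on_def)
  moreover have "distinct (unders (concat (gauss_of D)))"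
    unfolding concat_gauss_of unders_concat_map edge_word_partner_list unders
    by (rule distinct_concat_map_key[where key = snd])
      (auto simp: distinct_edge_list distinct_map distinct_partner_list inj_on_def)
  ultimately show ?thesis by (simp add: simple_gauss_def)
qed

end

section \<open>Rotating a diagram into generic position\<close>

definition rotate_point :: "real \<Rightarrow> real \<Rightarrow> point \<Rightarrow> point" where
  "rotate_point c s p = (c * fst p - s * snd p, s * fst p + c * snd p)"

definition rotate_diagram :: "real \<Rightarrow> real \<Rightarrow> vdiagram \<Rightarrow> vdiagram" where
  "rotate_diagram c s D = D\<lparr>comps := map (map (rotate_point c s)) (comps D)\<rparr>"

lemma linear_rotate_point: "linear (rotate_point c s)"
  by (rule linearI) (simp_all add: rotate_point_def prod_eq_iff algebra_simps)

lemma rotate_point_diff: "rotate_point c s p - rotate_point c s q = rotate_point c s (p - q)"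
  by (simp add: rotate_point_def prod_eq_iff algebra_simps)

lemma rotate_point_norm:
  assumes "c\<^sup>2 + s\<^sup>2 = 1"
  shows "norm (rotate_point c s p) = norm p"
proof -
  have "(c * fst p - s * snd p)\<^sup>2 + (s * fst p + c * snd p)\<^sup>2 = (c\<^sup>2 + s\<^sup>2) * ((fst p)\<^sup>2 + (snd p)\<^sup>2)"
    by (simp add: power2_eq_square algebra_simps)
  then show ?thesis
    using assms by (simp add: rotate_point_def norm_prod_def)
qed

lemma rotate_point_dist:
  "c\<^sup>2 + s\<^sup>2 = 1 \<Longrightarrow> dist (rotate_point c s p) (rotate_point c s q) = dist p q"
  by (simp add: dist_norm rotate_point_diff rotate_point_norm)

lemma inj_rotate_point: "c\<^sup>2 + s\<^sup>2 = 1 \<Longrightarrow> inj (rotate_point c s)"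
  by (metis injI rotate_point_dist dist_eq_0_iff)

lemma edges_rotate: "edges (rotate_diagram c s D) = edges D"
  by (auto simp: edges_def rotate_diagram_def)

lemma next_edge_rotate: "e \<in> edges D \<Longrightarrow> next_edge (rotate_diagram c s D) e = next_edge D e"
  by (auto simp: next_edge_def rotate_diagram_def edges_def)

lemma src_rotate: "e \<in> edges D \<Longrightarrow> src (rotate_diagram c s D) e = rotate_point c s (src D e)"
  by (auto simp: src_def rotate_diagram_def edges_def)

lemma tgt_rotate: "e \<in> edges D \<Longrightarrow> tgt (rotate_diagram c s D) e = rotate_point c s (tgt D e)"
  by (simp add: tgt_def next_edge_rotate src_rotate next_edge_in_edges)

lemma closed_edge_rotate:
  "e \<in> edges D \<Longrightarrow> closed_edge (rotate_diagram c s D) e = rotate_point c s ` closed_edge D e"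
  by (simp add: closed_edge_def src_rotate tgt_rotate closed_segment_linear_image[OF linear_rotate_point])

lemma open_edge_rotate:
  "c\<^sup>2 + s\<^sup>2 = 1 \<Longrightarrow> e \<in> edges D \<Longrightarrow>
     open_edge (rotate_diagram c s D) e = rotate_point c s ` open_edge D e"
  by (simp add: open_edge_def src_rotate tgt_rotate
      open_segment_linear_image[OF linear_rotate_point inj_rotate_point])

lemma crosses_rotate:
  assumes "c\<^sup>2 + s\<^sup>2 = 1"
  shows "crosses (rotate_diagram c s D) e f \<longleftrightarrow> crosses D e f"
proof (cases "e \<in> edges D \<and> f \<in> edges D")
  case True
  then show ?thesis
    by (simp add: crosses_def edges_rotate open_edge_rotate[OF assms]
        image_Int[OF inj_rotate_point[OF assms], symmetric])
qed (auto simp: crosses_def edges_rotate)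

lemma crossing_sign_rotate:
  assumes "c\<^sup>2 + s\<^sup>2 = 1" "e \<in> edges D" "f \<in> edges D"
  shows "crossing_sign (rotate_diagram c s D) e f = crossing_sign D e f"
proof -
  have det: "fst (rotate_point c s u) * snd (rotate_point c s v) - snd (rotate_point c s u) * fst (rotate_point c s v)
      = fst u * snd v - snd u * fst v" for u v
  proof -
    have "fst (rotate_point c s u) * snd (rotate_point c s v) - snd (rotate_point c s u) * fst (rotate_point c s v)
      = (c\<^sup>2 + s\<^sup>2) * (fst u * snd v - snd u * fst v)"
      by (simp add: rotate_point_def power2_eq_square algebra_simps)
    then show ?thesis using assms(1) by simp
  qed
  show ?thesis
    unfolding crossing_sign_def Let_def src_rotate[OF assms(2)] src_rotate[OF assms(3)]
      tgt_rotate[OF assms(2)] tgt_rotate[OF assms(3)] rotate_point_diff det ..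
qed

lemma over_rel_rotate: "over_rel (rotate_diagram c s D) = over_rel D"
  by (simp add: rotate_diagram_def)

lemma sorted_key_list_of_set_cong:
  fixes f g :: "'b \<Rightarrow> 'a :: linorder"
  assumes "inj_on f A" "finite A" and eq: "\<And>x. x \<in> A \<Longrightarrow> f x = g x"
  shows "sorted_key_list_of_set f A = sorted_key_list_of_set g A"
proof -
  let ?xs = "sorted_key_list_of_set f A" and ?ys = "sorted_key_list_of_set g A"
  have g: "inj_on g A" using assms(1) eq inj_on_cong by blast
  have set: "set ?xs = A" "set ?ys = A"
    using sorted_key_list_of_set_inj[OF assms(1,2)] sorted_key_list_of_set_inj[OF g assms(2)] by auto
  have ys: "map f ?ys = map g ?ys" using set eq by simp
  have "map f ?xs = map f ?ys"
    unfolding ys using eq sorted_key_list_of_set_strict[OF assms(1,2)] sorted_key_list_of_set_strict[OF g assms(2)] set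
    by (intro strict_sorted_equal) (simp_all cong: image_cong)
  then show ?thesis
    by (rule map_inj_on) (simp add: set assms(1))
qed

lemma virtual_diagramI:
  assumes "\<forall>P \<in> set (comps D). length P \<ge> 3"
    and "\<And>e. e \<in> edges D \<Longrightarrow> src D e \<noteq> tgt D e"
    and "\<And>e. e \<in> edges D \<Longrightarrow> closed_edge D e \<inter> closed_edge D (next_edge D e) = {tgt D e}"
    and "\<And>e f. \<lbrakk>e \<in> edges D; f \<in> edges D; e \<noteq> f; f \<noteq> next_edge D e; e \<noteq> next_edge D f\<rbrakk> \<Longrightarrow>
        closed_edge D e \<inter> closed_edge D f = {} \<or>
        (\<exists>p \<in> open_edge D e \<inter> open_edge D f. closed_edge D e \<inter> closed_edge D f = {p})"
    and "\<And>e f g. \<lbrakk>e \<in> edges D; f \<in> edges D; g \<in> edges D; e \<noteq> f; f \<noteq> g; e \<noteq> g\<rbrakk> \<Longrightarrow>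
        closed_edge D e \<inter> closed_edge D f \<inter> closed_edge D g = {}"
    and "\<And>e f. (e, f) \<in> over_rel D \<Longrightarrow> crosses D e f \<and> (f, e) \<notin> over_rel D"
  shows "virtual_diagram D"
  unfolding virtual_diagram_def
proof (intro conjI)
  show "\<forall>(e, f) \<in> over_rel D. crosses D e f \<and> (f, e) \<notin> over_rel D"
    using assms(6) by (intro ballI) (simp add: case_prod_beta)
qed (simp_all add: assms(1-5))

context link_diagram
begin

lemma virtual_diagram_rotate:
  assumes cs: "c\<^sup>2 + s\<^sup>2 = 1"
  shows "virtual_diagram (rotate_diagram c s D)"
proof (rule virtual_diagramI)
  note inj = inj_rotate_point[OF cs]
  note image_Int = image_Int[OF inj, symmetric]
  let ?D = "rotate_diagram c s D"
  show "\<forall>P\<in>set (comps ?D). 3 \<le> length P"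
    using comp_length by (auto simp: rotate_diagram_def in_set_conv_nth)
  fix e assume "e \<in> edges ?D"
  then have e: "e \<in> edges D" by (simp add: edges_rotate)
  show "src ?D e \<noteq> tgt ?D e"
    using src_neq_tgt[OF e] inj by (simp add: src_rotate[OF e] tgt_rotate[OF e] inj_eq)
  show "closed_edge ?D e \<inter> closed_edge ?D (next_edge ?D e) = {tgt ?D e}"
    unfolding next_edge_rotate[OF e] closed_edge_rotate[OF e]
      closed_edge_rotate[OF next_edge_in_edges[OF e]] tgt_rotate[OF e] image_Int adjacent_edges[OF e]
    by simp
  fix f assume "f \<in> edges ?D" and ef: "e \<noteq> f"
  then have f: "f \<in> edges D" by (simp add: edges_rotate)
  show "closed_edge ?D e \<inter> closed_edge ?D f = {} \<or>
        (\<exists>p \<in> open_edge ?D e \<inter> open_edge ?D f. closed_edge ?D e \<inter> closed_edge ?D f = {p})"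
    if "f \<noteq> next_edge ?D e" "e \<noteq> next_edge ?D f"
  proof -
    have "closed_edge D e \<inter> closed_edge D f = {} \<or>
        (\<exists>p \<in> open_edge D e \<inter> open_edge D f. closed_edge D e \<inter> closed_edge D f = {p})"
      using nonadjacent_edges[OF e f ef] that by (simp add: next_edge_rotate e f)
    then show ?thesis
      unfolding closed_edge_rotate[OF e] closed_edge_rotate[OF f] open_edge_rotate[OF cs e]
        open_edge_rotate[OF cs f] image_Int by (elim disjE bexE) auto
  qed
  fix g assume "g \<in> edges ?D" and fg: "f \<noteq> g" "e \<noteq> g"
  then have g: "g \<in> edges D" by (simp add: edges_rotate)
  show "closed_edge ?D e \<inter> closed_edge ?D f \<inter> closed_edge ?D g = {}"
    unfolding closed_edge_rotate[OF e] closed_edge_rotate[OF f] closed_edge_rotate[OF g] image_Int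
      no_triple_point[OF e f g ef fg] by simp
next
  fix e f assume "(e, f) \<in> over_rel (rotate_diagram c s D)"
  then show "crosses (rotate_diagram c s D) e f \<and> (f, e) \<notin> over_rel (rotate_diagram c s D)"
    using over_crosses over_asym by (simp add: over_rel_rotate crosses_rotate[OF cs])
qed

lemma crossing_point_rotate:
  assumes cs: "c\<^sup>2 + s\<^sup>2 = 1" and c: "crosses D e f"
  shows "crossing_point (rotate_diagram c s D) e f = rotate_point c s (crossing_point D e f)"
proof -
  interpret R: link_diagram "rotate_diagram c s D"
    by unfold_locales (rule virtual_diagram_rotate[OF cs])
  have "e \<in> edges D" "f \<in> edges D" using c unfolding crosses_def by blast+
  then have "rotate_point c s (crossing_point D e f) \<in>
      open_edge (rotate_diagram c s D) e \<inter> open_edge (rotate_diagram c s D) f"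
    using crosses_point(1)[OF c] by (simp add: open_edge_rotate[OF cs])
  moreover have "crosses (rotate_diagram c s D) e f" using c by (simp add: crosses_rotate[OF cs])
  ultimately show ?thesis using R.crosses_point(2) by simp
qed

lemma gauss_of_rotate:
  assumes cs: "c\<^sup>2 + s\<^sup>2 = 1"
  shows "gauss_of (rotate_diagram c s D) = gauss_of D"
proof -
  let ?D = "rotate_diagram c s D"
  have word: "edge_word ?D e = edge_word D e" if e: "e \<in> edges D" for e
  proof -
    have partners: "crossing_partners ?D e = crossing_partners D e"
      by (simp add: crossing_partners_def over_rel_rotate)
    have "partner_list ?D e = partner_list D e"
      unfolding partner_list_def partners
    proof (rule sorted_key_list_of_set_cong[OF _ finite_partners, symmetric])
      fix f assume "f \<in> crossing_partners D e"
      then show "dist (src D e) (crossing_point D e f) = dist (src ?D e) (crossing_point ?D e f)"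
        using partner_crosses by (simp add: src_rotate[OF e] crossing_point_rotate[OF cs] rotate_point_dist[OF cs])
    qed (rule crossing_dist_inj)
    moreover have "passage_of ?D e f = passage_of D e f" if "f \<in> set (partner_list D e)" for f
    proof -
      have "f \<in> edges D" using that set_partner_list partner_edges by blast
      then show ?thesis using e by (simp add: passage_of_def over_rel_rotate crossing_sign_rotate[OF cs])
    qed
    ultimately show ?thesis unfolding edge_word_partner_list by simp
  qed
  have "length (comps ?D) = length (comps D)" by (simp add: rotate_diagram_def)
  moreover have "concat (map (\<lambda>j. edge_word ?D (i, j)) [0..<length (comps ?D ! i)]) =
      concat (map (\<lambda>j. edge_word D (i, j)) [0..<length (comps D ! i)])"
    if "i < length (comps D)" for i
  proof -
    have "length (comps ?D ! i) = length (comps D ! i)" using that by (simp add: rotate_diagram_def)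
    moreover have "edge_word ?D (i, j) = edge_word D (i, j)" if "j < length (comps D ! i)" for j
      using word[of "(i, j)"] that \<open>i < length (comps D)\<close> by (simp add: edges_def)
    ultimately show ?thesis by (intro arg_cong[of _ _ concat] map_cong) simp_all
  qed
  ultimately show ?thesis unfolding gauss_of_def by (simp cong: map_cong)
qed

lemma crossing_points_eq:
  "{p. \<exists>e f. crosses D e f \<and> p \<in> open_edge D e \<inter> open_edge D f} =
   {crossing_point D e f | e f. crosses D e f}"
proof (intro subset_antisym subsetI; elim CollectE exE conjE)
  fix p e f assume "crosses D e f" "p \<in> open_edge D e \<inter> open_edge D f"
  then show "p \<in> {crossing_point D e f | e f. crosses D e f}"
    using crosses_point(2) by blast
next
  fix p e f assume "p = crossing_point D e f" "crosses D e f"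
  then show "p \<in> {p. \<exists>e f. crosses D e f \<and> p \<in> open_edge D e \<inter> open_edge D f}"
    using crosses_point(1) by blast
qed

text \<open>
  Up to a positive factor the height after a rotation by the angle $arctan t$ is $t x + y$. Each pair of
  distinct points excludes at most one value of $t$, and there are finitely many vertices and crossings.
  Rotations, rather than shears, are used because they preserve the distances by which the crossings on
  an edge are sorted.
\<close>

lemma ex_height_generic_rotation:
  "\<exists>c s. c\<^sup>2 + s\<^sup>2 = 1 \<and> height_generic (rotate_diagram c s D)"
proof -
  let ?C = "{crossing_point D e f | e f. crosses D e f}"
  let ?P = "src D ` edges D \<union> ?C"
  have "?C \<subseteq> (\<lambda>(e, f). crossing_point D e f) ` (edges D \<times> edges D)"
    by (auto simp: crosses_def)
  then have "finite ?C" by (rule finite_subset) (simp add: finite_edges)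
  then have fin: "finite ?P" using finite_edges by simp
  have "finite ((\<lambda>(p, q). - (snd p - snd q) / (fst p - fst q)) ` (?P \<times> ?P))"
    using fin by blast
  \<comment> \<open>The direction (t, 1) must not be orthogonal to a line through two of the points.\<close>
  then obtain t :: real where t: "t \<notin> (\<lambda>(p, q). - (snd p - snd q) / (fst p - fst q)) ` (?P \<times> ?P)"
    using infinite_UNIV_char_0 ex_new_if_finite by blast
  define r where "r = sqrt (1 + t\<^sup>2)"
  have pos: "0 < 1 + t\<^sup>2" by (simp add: add_pos_nonneg)
  then have r: "r > 0" "r\<^sup>2 = 1 + t\<^sup>2" by (simp_all add: r_def)
  have cs: "(1 / r)\<^sup>2 + (t / r)\<^sup>2 = 1"
    using r pos by (simp add: power_divide add_divide_distrib[symmetric])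
  let ?D = "rotate_diagram (1 / r) (t / r) D" and ?f = "rotate_point (1 / r) (t / r)"
  interpret R: link_diagram ?D by unfold_locales (rule virtual_diagram_rotate[OF cs])
  have "{crossing_point ?D e f | e f. crosses ?D e f} = ?f ` ?C"
    unfolding crosses_rotate[OF cs] using crossing_point_rotate[OF cs] by force
  moreover have "src ?D ` edges ?D = ?f ` src D ` edges D"
    unfolding edges_rotate image_image by (rule image_cong) (simp_all add: src_rotate)
  moreover have "inj_on height (?f ` ?P)"
  proof (rule inj_onI)
    fix p' q' assume "p' \<in> ?f ` ?P" "q' \<in> ?f ` ?P" and eq: "height p' = height q'"
    then obtain p q where p: "p \<in> ?P" "p' = ?f p" and q: "q \<in> ?P" "q' = ?f q" by blast
    have "(t * fst p + snd p) / r = (t * fst q + snd q) / r"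
      using eq p(2) q(2) by (simp add: height_def rotate_point_def add_divide_distrib)
    then have *: "t * (fst p - fst q) = - (snd p - snd q)" using r(1) by (simp add: algebra_simps)
    have "fst p = fst q"
    proof (rule ccontr)
      assume "fst p \<noteq> fst q"
      then have "t = - (snd p - snd q) / (fst p - fst q)" using * by (simp add: field_simps)
      then show False using t p(1) q(1) by force
    qed
    then have "p = q" using * by (simp add: prod_eq_iff)
    then show "p' = q'" using p(2) q(2) by simp
  qed
  ultimately have "height_generic ?D"
    unfolding height_generic_def R.crossing_points_eq by (simp add: image_Un)
  then show ?thesis using cs by blast
qed

end

lemma diagram_move_same_gauss:
  assumes "virtual_diagram D" "virtual_diagram D'" "gauss_of D' = gauss_of D"
  shows "diagram_move D D'"
proof -
  have "gauss_iso (gauss_of D) (gauss_of D)"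
    unfolding gauss_iso_def
  proof (intro exI conjI)
    show "inj_on id (\<Union>w \<in> set (gauss_of D). \<Union>p \<in> set w. set_passage p)" by simp
    show "mset (gauss_of D) = mset (map (map (map_passage id)) (gauss_of D))"
      by (simp add: passage.map_id0)
    have "\<exists>n. u = rotate n u" for u :: "(edge \<times> edge) passage list"
      by (rule exI[of _ 0]) simp
    then show "list_all2 (\<lambda>u v. \<exists>n. v = rotate n u) (gauss_of D) (gauss_of D)"
      by (simp add: list_all2_same)
  qed
  then show ?thesis using assms by (simp add: diagram_move_def)
qed

lemma virtual_linkD:
  assumes "L \<in> virtual_links" "D \<in> L"
  shows "virtual_diagram D"
    and "D' \<in> L \<longleftrightarrow> virtual_diagram D' \<and> equivclp diagram_move D D'"
proof -
  obtain D0 where D0: "virtual_diagram D0"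
    and L: "L = {D'. virtual_diagram D' \<and> equivclp diagram_move D0 D'}"
    using assms(1) unfolding virtual_links_def quotient_def by auto
  show "virtual_diagram D" using assms(2) L by simp
  have "equivclp diagram_move D0 D" using assms(2) L by simp
  then have "equivclp diagram_move D0 D' \<longleftrightarrow> equivclp diagram_move D D'"
    using equivclp_sym equivclp_trans by metis
  then show "D' \<in> L \<longleftrightarrow> virtual_diagram D' \<and> equivclp diagram_move D D'" using L by simp
qed

text \<open>
  The minimum is taken over a nonempty set since the link contains a rotated copy of any of its diagrams.
\<close>

lemma second_bridge_index_attained:
  assumes L: "L \<in> virtual_links" and D: "D \<in> L"
  shows "\<exists>D'\<in>L. height_generic D' \<and> num_local_maxima D' = second_bridge_index L"
proof -
  interpret link_diagram D by unfold_locales (rule virtual_linkD(1)[OF L D])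
  obtain c s where cs: "c\<^sup>2 + s\<^sup>2 = 1" and generic: "height_generic (rotate_diagram c s D)"
    using ex_height_generic_rotation by blast
  have "diagram_move D (rotate_diagram c s D)"
    by (rule diagram_move_same_gauss[OF diagram virtual_diagram_rotate[OF cs] gauss_of_rotate[OF cs]])
  then have "rotate_diagram c s D \<in> L"
    using virtual_linkD(2)[OF L D] virtual_diagram_rotate[OF cs] r_into_equivclp by blast
  then have "\<exists>n. \<exists>D'\<in>L. height_generic D' \<and> n = num_local_maxima D'" using generic by blast
  then have "\<exists>D'\<in>L. height_generic D' \<and> second_bridge_index L = num_local_maxima D'"
    unfolding second_bridge_index_def by (rule LeastI_ex)
  then show ?thesis by metis
qed

section \<open>Colorings are determined at the local maxima\<close>

lemma concat_upt_nth:
  assumes "j < n" "k < length (g j)"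
  shows "concat (map g [0..<n]) ! (length (concat (map g [0..<j])) + k) = g j ! k"
    and "length (concat (map g [0..<j])) + k < length (concat (map g [0..<n]))"
proof -
  have "[0..<n] = [0..<j] @ j # [Suc j..<n]"
    using assms(1) upt_add_eq_append[of 0 j "n - j"] by (simp add: upt_conv_Cons)
  then have *: "concat (map g [0..<n]) = concat (map g [0..<j]) @ g j @ concat (map g [Suc j..<n])"
    by simp
  show "concat (map g [0..<n]) ! (length (concat (map g [0..<j])) + k) = g j ! k"
    "length (concat (map g [0..<j])) + k < length (concat (map g [0..<n]))"
    unfolding * using assms(2) by (simp_all add: nth_append del: length_concat)
qed

lemma concat_upt_index:
  "p < length (concat (map g [0..<n])) \<Longrightarrow>
     \<exists>j<n. \<exists>k<length (g j). p = length (concat (map g [0..<j])) + k"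
proof (induction n)
  case (Suc n)
  show ?case
  proof (cases "p < length (concat (map g [0..<n]))")
    case True
    then show ?thesis using Suc.IH less_SucI by blast
  next
    case False
    then have "p - length (concat (map g [0..<n])) < length (g n)" using Suc.prems by simp
    then show ?thesis
      using False by (intro exI[of _ n] conjI exI[of _ "p - length (concat (map g [0..<n]))"]) simp_all
  qed
qed simp

text \<open>
  The number of passages on the earlier edges of the same component.
\<close>

definition edge_offset :: "vdiagram \<Rightarrow> edge \<Rightarrow> nat" where
  "edge_offset D e = length (concat (map (\<lambda>j. edge_word D (fst e, j)) [0..<snd e]))"

text \<open>
  The crossings on an edge \<open>e\<close> cut it into pieces that are numbered from 0 in the direction of \<open>e\<close>.
  Piece \<open>k\<close> runs from stop \<open>k\<close> to stop \<open>k + 1\<close>, where stop 0 is the source, the last stop is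
  the target, and the stops in between are the crossings.
\<close>

definition piece_color :: "vdiagram \<Rightarrow> ('x \<times> 'x list) list \<Rightarrow> edge \<Rightarrow> nat \<Rightarrow> 'x" where
  "piece_color D c e k = (fst (c ! fst e) # snd (c ! fst e)) ! (edge_offset D e + k)"

definition stops :: "vdiagram \<Rightarrow> edge \<Rightarrow> point list" where
  "stops D e = src D e # map (crossing_point D e) (partner_list D e) @ [tgt D e]"

definition stop_height :: "vdiagram \<Rightarrow> edge \<Rightarrow> nat \<Rightarrow> real" where
  "stop_height D e k = height (stops D e ! k)"

definition maxima :: "vdiagram \<Rightarrow> edge set" where
  "maxima D = {e \<in> edges D.
     height (src D e) < height (tgt D e) \<and> height (tgt D (next_edge D e)) < height (tgt D e)}"

lemma finite_maxima: "finite (maxima D)"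
  by (rule finite_subset[OF _ finite_edges[of D]]) (auto simp: maxima_def)

lemma card_maxima: "card (maxima D) = num_local_maxima D"
  by (simp add: maxima_def num_local_maxima_def)

abbreviation last_piece :: "vdiagram \<Rightarrow> edge \<Rightarrow> nat" where
  "last_piece D e \<equiv> length (partner_list D e)"

lemma length_gauss_of: "length (gauss_of D) = length (comps D)"
  by (simp add: gauss_of_def)

lemma gauss_of_nth:
  "i < length (comps D) \<Longrightarrow>
     gauss_of D ! i = concat (map (\<lambda>j. edge_word D (i, j)) [0..<length (comps D ! i)])"
  by (simp add: gauss_of_def)

lemma ex_previous_edge:
  assumes "e \<in> edges D" shows "\<exists>e'\<in>edges D. next_edge D e' = e"
proof -
  obtain i j where e: "e = (i, j)" "i < length (comps D)" "j < length (comps D ! i)"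
    using assms by (cases e) (auto simp: edges_def)
  let ?n = "length (comps D ! i)"
  have "(if j = 0 then ?n - 1 else j - 1) < ?n" "((if j = 0 then ?n - 1 else j - 1) + 1) mod ?n = j"
    using e(3) by auto
  then show ?thesis
    using e by (intro bexI[of _ "(i, if j = 0 then ?n - 1 else j - 1)"])
      (simp_all add: next_edge_def edges_def)
qed

lemma stop_height_0: "stop_height D e 0 = height (src D e)"
  by (simp add: stop_height_def stops_def)

lemma stop_height_last: "stop_height D e (Suc (last_piece D e)) = height (tgt D e)"
  by (simp add: stop_height_def stops_def nth_append)

lemma stop_height_crossing:
  "k < last_piece D e \<Longrightarrow> stop_height D e (Suc k) = height (crossing_point D e (partner_list D e ! k))"
  by (simp add: stop_height_def stops_def nth_append)

context link_diagram
begin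

lemma stop_on_edge:
  assumes e: "e \<in> edges D" and p: "p \<in> set (stops D e)"
  shows "height p = height (src D e) +
    dist (src D e) p / dist (src D e) (tgt D e) * (height (tgt D e) - height (src D e))"
proof -
  have "p = src D e + (dist (src D e) p / dist (src D e) (tgt D e)) *\<^sub>R (tgt D e - src D e)"
  proof -
    consider "p = src D e" | "p = tgt D e" | f where "f \<in> crossing_partners D e" "p = crossing_point D e f"
      using p by (auto simp: stops_def set_partner_list)
    then show ?thesis
    proof cases
      case 3
      then have "p \<in> open_segment (src D e) (tgt D e)"
        using crosses_point(1)[OF partner_crosses] by (simp add: open_edge_def)
      then show ?thesis by (rule open_segment_dist(1))
    qed (use src_neq_tgt[OF e] in simp_all)
  qed
  then have "snd p = snd (src D e + (dist (src D e) p / dist (src D e) (tgt D e)) *\<^sub>R (tgt D e - src D e))"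
    by (rule arg_cong)
  then show ?thesis by (simp add: height_def)
qed

lemma stops_dist_sorted:
  assumes e: "e \<in> edges D"
  shows "sorted_wrt (<) (map (dist (src D e)) (stops D e))"
proof -
  have "0 < dist (src D e) (crossing_point D e f) \<and>
      dist (src D e) (crossing_point D e f) < dist (src D e) (tgt D e)"
    if "f \<in> crossing_partners D e" for f
    using open_segment_dist(2,3)[of "crossing_point D e f" "src D e" "tgt D e"]
      crosses_point(1)[OF partner_crosses[OF that]] by (simp add: open_edge_def)
  then show ?thesis
    using sorted_partner_list[of e] src_neq_tgt[OF e]
    by (simp add: stops_def sorted_wrt_append set_partner_list comp_def)
qed

text \<open>
  An edge is straight, so the height along it is an affine function of the distance from its source.
\<close>

lemma stop_height_mono:
  assumes e: "e \<in> edges D" and k: "k \<le> last_piece D e"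
  shows "height (src D e) < height (tgt D e) \<Longrightarrow> stop_height D e k < stop_height D e (Suc k)"
    and "height (tgt D e) < height (src D e) \<Longrightarrow> stop_height D e (Suc k) < stop_height D e k"
proof -
  let ?d = "\<lambda>k. dist (src D e) (stops D e ! k) / dist (src D e) (tgt D e)"
  have len: "Suc k < length (stops D e)" using k by (simp add: stops_def)
  have "dist (src D e) (stops D e ! k) < dist (src D e) (stops D e ! Suc k)"
    using sorted_wrt_nth_less[OF stops_dist_sorted[OF e], of k "Suc k"] len by simp
  then have d: "?d k < ?d (Suc k)"
    using src_neq_tgt[OF e] by (simp add: divide_strict_right_mono)
  have h: "stop_height D e l = height (src D e) + ?d l * (height (tgt D e) - height (src D e))"
    if "l < length (stops D e)" for l
    unfolding stop_height_def using stop_on_edge[OF e nth_mem[OF that]] .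
  have hk: "stop_height D e k = height (src D e) + ?d k * (height (tgt D e) - height (src D e))"
    "stop_height D e (Suc k) = height (src D e) + ?d (Suc k) * (height (tgt D e) - height (src D e))"
    using h len by simp_all
  show "stop_height D e k < stop_height D e (Suc k)" if "height (src D e) < height (tgt D e)"
    unfolding hk by (rule add_strict_left_mono, rule mult_strict_right_mono[OF d]) (simp add: that)
  show "stop_height D e (Suc k) < stop_height D e k" if "height (tgt D e) < height (src D e)"
    unfolding hk by (rule add_strict_left_mono, rule mult_strict_right_mono_neg[OF d]) (simp add: that)
qed

lemma edge_not_horizontal:
  assumes "height_generic D" "e \<in> edges D"
  shows "height (src D e) \<noteq> height (tgt D e)"
proof
  assume "height (src D e) = height (tgt D e)"
  moreover have "src D e \<in> src D ` edges D" "tgt D e \<in> src D ` edges D"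
    using assms(2) next_edge_in_edges by (auto simp: tgt_def)
  ultimately have "src D e = tgt D e"
    using assms(1) unfolding height_generic_def by (meson UnI1 inj_onD)
  then show False using src_neq_tgt[OF assms(2)] by simp
qed

end

locale colored_diagram = finite_biquandle X + link_diagram D
  for X :: "'a biquandle_struct" and D :: vdiagram
begin

lemma consistentD:
  "consistent E \<Longrightarrow> (Over a s, i, i') \<in> E \<Longrightarrow> (Under a s, j, j') \<in> E \<Longrightarrow>
     signed_crossing s i i' j j'"
  unfolding consistent_def by blast

lemma coloring_component:
  assumes c: "c \<in> colorings (gauss_of D)" and i: "i < length (comps D)"
  shows "length (snd (c ! i)) = length (gauss_of D ! i)"
    "last (fst (c ! i) # snd (c ! i)) = fst (c ! i)" "fst (c ! i) \<in> carrier X"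
    "set (snd (c ! i)) \<subseteq> carrier X"
proof -
  have "c ! i \<in> closed_runs (gauss_of D ! i)" using c i by (simp add: colorings_def length_gauss_of)
  then show "length (snd (c ! i)) = length (gauss_of D ! i)"
    "last (fst (c ! i) # snd (c ! i)) = fst (c ! i)" "fst (c ! i) \<in> carrier X"
    "set (snd (c ! i)) \<subseteq> carrier X"
    unfolding closed_runs_def case_prod_beta by blast+
qed

text \<open>
  A vertex is no crossing, so the two pieces that meet there belong to the same semiarc.
\<close>

lemma piece_color_next:
  assumes c: "c \<in> colorings (gauss_of D)" and e: "e \<in> edges D"
  shows "piece_color D c e (last_piece D e) = piece_color D c (next_edge D e) 0"
proof -
  obtain i j where ij: "e = (i, j)" "i < length (comps D)" "j < length (comps D ! i)"
    using e by (cases e) (auto simp: edges_def)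
  have off: "edge_offset D e + last_piece D e = edge_offset D (i, Suc j)"
    by (simp add: edge_offset_def ij(1) edge_word_partner_list)
  show ?thesis
  proof (cases "Suc j < length (comps D ! i)")
    case True
    then have "next_edge D e = (i, Suc j)" by (simp add: next_edge_def ij(1))
    then show ?thesis by (simp add: piece_color_def off[unfolded ij(1)] ij(1))
  next
    case False
    then have n: "Suc j = length (comps D ! i)" using ij(3) by simp
    then have next_eq: "next_edge D e = (i, 0)" by (simp add: next_edge_def ij(1))
    have "edge_offset D (i, Suc j) = length (snd (c ! i))"
      using coloring_component(1)[OF c ij(2)] by (simp add: gauss_of_nth[OF ij(2)] edge_offset_def n)
    then have "piece_color D c e (last_piece D e) = (fst (c ! i) # snd (c ! i)) ! length (snd (c ! i))"
      by (simp add: piece_color_def off[unfolded ij(1)] ij(1))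
    also have "\<dots> = last (fst (c ! i) # snd (c ! i))" by (subst last_conv_nth) simp_all
    also have "\<dots> = fst (c ! i)" by (rule coloring_component(2)[OF c ij(2)])
    finally show ?thesis by (simp add: next_eq piece_color_def edge_offset_def)
  qed
qed

lemma piece_color_event:
  assumes c: "c \<in> colorings (gauss_of D)" and e: "e \<in> edges D" and k: "k < last_piece D e"
  shows "(passage_of D e (partner_list D e ! k), piece_color D c e k, piece_color D c e (Suc k)) \<in>
    (\<Union>i<length (gauss_of D). run_events (gauss_of D ! i) (c ! i))"
proof -
  obtain i j where ij: "e = (i, j)" "i < length (comps D)" "j < length (comps D ! i)"
    using e by (cases e) (auto simp: edges_def)
  let ?p = "edge_offset D e + k"
  have k': "k < length (edge_word D (i, j))" using k by (simp add: edge_word_partner_list ij(1))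
  have p: "?p < length (gauss_of D ! i)"
    and "gauss_of D ! i ! ?p = edge_word D (i, j) ! k"
    using concat_upt_nth[OF ij(3), of k "\<lambda>j. edge_word D (i, j)", OF k']
    unfolding gauss_of_nth[OF ij(2)] edge_offset_def ij(1) by simp_all
  then have w: "gauss_of D ! i ! ?p = passage_of D e (partner_list D e ! k)"
    using k by (simp add: edge_word_partner_list ij(1))
  have "(gauss_of D ! i ! ?p, (fst (c ! i) # snd (c ! i)) ! ?p, snd (c ! i) ! ?p) \<in>
      run_events (gauss_of D ! i) (c ! i)"
    unfolding run_events_def events_nth[OF coloring_component(1)[OF c ij(2)]] using p by blast
  then have "(passage_of D e (partner_list D e ! k), piece_color D c e k, piece_color D c e (Suc k)) \<in>
      run_events (gauss_of D ! i) (c ! i)"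
    unfolding w by (simp add: piece_color_def ij(1))
  then show ?thesis using ij(2) by (auto simp: length_gauss_of)
qed

lemma piece_color_crossing:
  assumes c: "c \<in> colorings (gauss_of D)" and over: "(e, f) \<in> over_rel D"
    and k: "k < last_piece D e" "partner_list D e ! k = f"
    and l: "l < last_piece D f" "partner_list D f ! l = e"
  shows "signed_crossing (crossing_sign D e f) (piece_color D c e k) (piece_color D c e (Suc k))
    (piece_color D c f l) (piece_color D c f (Suc l))"
proof -
  have e: "e \<in> edges D" and f: "f \<in> edges D"
    using over_crosses[OF over] unfolding crosses_def by blast+
  have passages: "passage_of D e f = Over (e, f) (crossing_sign D e f)"
    "passage_of D f e = Under (e, f) (crossing_sign D e f)"
    using over over_asym[OF over] by (simp_all add: passage_of_def)
  have "consistent (\<Union>i<length (gauss_of D). run_events (gauss_of D ! i) (c ! i))"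
    using c by (simp add: colorings_def)
  then show ?thesis
    using piece_color_event[OF c e k(1)] piece_color_event[OF c f l(1)]
    unfolding k(2) l(2) passages by (rule consistentD)
qed

text \<open>
  Two colorings that agree on one piece of each strand at a crossing agree on all four pieces, as one
  strand is the overstrand and the other the understrand.
\<close>

lemma piece_color_across_crossing:
  assumes c: "c \<in> colorings (gauss_of D)" "c' \<in> colorings (gauss_of D)"
    and k: "k < last_piece D e" "partner_list D e ! k = f"
    and l: "l < last_piece D f" "partner_list D f ! l = e"
    and agree_e: "piece_color D c e k = piece_color D c' e k \<or>
      piece_color D c e (Suc k) = piece_color D c' e (Suc k)"
    and agree_f: "piece_color D c f l = piece_color D c' f l \<or>
      piece_color D c f (Suc l) = piece_color D c' f (Suc l)"
  shows "piece_color D c e k = piece_color D c' e k"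
    "piece_color D c e (Suc k) = piece_color D c' e (Suc k)"
proof -
  have "f \<in> crossing_partners D e" using k set_partner_list nth_mem by metis
  then consider "(e, f) \<in> over_rel D" | "(f, e) \<in> over_rel D" by (auto simp: crossing_partners_def)
  then have "piece_color D c e k = piece_color D c' e k \<and>
    piece_color D c e (Suc k) = piece_color D c' e (Suc k)"
  proof cases
    case 1
    show ?thesis
      using signed_crossing_unique[OF piece_color_crossing[OF c(1) 1 k l]
          piece_color_crossing[OF c(2) 1 k l] agree_e agree_f] by (elim conjE) (intro conjI)
  next
    case 2
    show ?thesis
      using signed_crossing_unique[OF piece_color_crossing[OF c(1) 2 l k]
          piece_color_crossing[OF c(2) 2 l k] agree_f agree_e] by (elim conjE) (intro conjI)
  qed
  then show "piece_color D c e k = piece_color D c' e k"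
    "piece_color D c e (Suc k) = piece_color D c' e (Suc k)" by blast+
qed

lemma coloring_eqI:
  assumes c: "c \<in> colorings (gauss_of D)" "c' \<in> colorings (gauss_of D)"
    and eq: "\<And>e k. e \<in> edges D \<Longrightarrow> k \<le> last_piece D e \<Longrightarrow> piece_color D c e k = piece_color D c' e k"
  shows "c = c'"
proof (rule nth_equalityI)
  show "length c = length c'" using c by (simp add: colorings_def)
  fix i assume "i < length c"
  then have i: "i < length (comps D)" using c(1) by (simp add: colorings_def length_gauss_of)
  let ?w = "gauss_of D ! i"
  have len: "length (snd (c ! i)) = length ?w" "length (snd (c' ! i)) = length ?w"
    using coloring_component(1) c i by blast+
  have "fst (c ! i) = fst (c' ! i)"
    using eq[of "(i, 0)" 0] comp_length[OF i] i
    by (cases "comps D ! i") (auto simp: piece_color_def edge_offset_def edges_def)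
  moreover have "snd (c ! i) = snd (c' ! i)"
  proof (rule nth_equalityI)
    show "length (snd (c ! i)) = length (snd (c' ! i))" using len by simp
    fix p assume "p < length (snd (c ! i))"
    then have "p < length (concat (map (\<lambda>j. edge_word D (i, j)) [0..<length (comps D ! i)]))"
      using len(1) by (simp add: gauss_of_nth[OF i] del: length_concat)
    from concat_upt_index[OF this] obtain j k where j: "j < length (comps D ! i)"
      "k < length (edge_word D (i, j))"
      "p = length (concat (map (\<lambda>j. edge_word D (i, j)) [0..<j])) + k" by blast
    have "piece_color D c (i, j) (Suc k) = piece_color D c' (i, j) (Suc k)"
      by (rule eq) (use i j in \<open>simp_all add: edges_def edge_word_partner_list\<close>)
    then show "snd (c ! i) ! p = snd (c' ! i) ! p"
      by (simp add: piece_color_def edge_offset_def j(3) del: length_concat)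
  qed
  ultimately show "c ! i = c' ! i" by (simp add: prod_eq_iff)
qed

lemma partner_index:
  assumes "k < last_piece D e"
  obtains l where "l < last_piece D (partner_list D e ! k)"
    "partner_list D (partner_list D e ! k) ! l = e"
proof -
  have "partner_list D e ! k \<in> crossing_partners D e" using assms set_partner_list nth_mem by metis
  then have "e \<in> set (partner_list D (partner_list D e ! k))"
    using partner_sym set_partner_list by blast
  then show ?thesis using that by (metis in_set_conv_nth)
qed

lemma crossing_heights:
  assumes "k < last_piece D e" "l < last_piece D f" "partner_list D e ! k = f" "partner_list D f ! l = e"
  shows "stop_height D e (Suc k) = stop_height D f (Suc l)"
proof -
  have "f \<in> crossing_partners D e" using assms set_partner_list nth_mem by metis
  from crossing_point_sym[OF partner_crosses[OF this]] show ?thesis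
    using stop_height_crossing[OF assms(1)] stop_height_crossing[OF assms(2)]
      assms(3,4) by simp
qed

text \<open>
  This is the descent from the top to the bottom. Suppose that two colorings agree at the local maxima
  but not everywhere, and consider among the pieces on which they differ one whose upper end is
  highest. Its upper end is a crossing or a vertex. At a crossing, both strands have a piece that reaches
  further up; there the colorings agree by the choice of the piece, and as one of these pieces is over
  and the other under, the crossing relation forces agreement below. At a vertex that is not a local
  maximum the other piece reaches further up and has the same color. At a local maximum the colorings
  agree by assumption.
\<close>

lemma coloring_determined_by_maxima:
  assumes generic: "height_generic D"
    and c: "c \<in> colorings (gauss_of D)" "c' \<in> colorings (gauss_of D)"
    and maxima: "\<And>e. e \<in> maxima D \<Longrightarrow>
      piece_color D c e (last_piece D e) = piece_color D c' e (last_piece D e)"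
  shows "c = c'"
proof (rule coloring_eqI[OF c], rule ccontr)
  define bad where "bad = {(e, k). e \<in> edges D \<and> k \<le> last_piece D e \<and>
    piece_color D c e k \<noteq> piece_color D c' e k}"
  define top where "top = (\<lambda>(e, k). max (stop_height D e k) (stop_height D e (Suc k)))"
  fix e0 k0 assume "e0 \<in> edges D" "k0 \<le> last_piece D e0" "piece_color D c e0 k0 \<noteq> piece_color D c' e0 k0"
  then have ne: "bad \<noteq> {}" unfolding bad_def by blast
  have "bad \<subseteq> Sigma (edges D) (\<lambda>e. {..last_piece D e})" by (auto simp: bad_def)
  then have fin: "finite bad" by (rule finite_subset) (simp add: finite_edges)
  have "Max (top ` bad) \<in> top ` bad" using fin ne by (intro Max_in) simp_all
  then obtain e k where ek: "(e, k) \<in> bad" "top (e, k) = Max (top ` bad)" by auto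
  have good: "piece_color D c f l = piece_color D c' f l"
    if "f \<in> edges D" "l \<le> last_piece D f" "top (e, k) < top (f, l)" for f l
  proof (rule ccontr)
    assume "piece_color D c f l \<noteq> piece_color D c' f l"
    then have "(f, l) \<in> bad" using that by (simp add: bad_def)
    then have "top (f, l) \<le> top (e, k)" using fin by (simp add: ek(2))
    then show False using that(3) by simp
  qed
  have e: "e \<in> edges D" and k: "k \<le> last_piece D e"
    and bad: "piece_color D c e k \<noteq> piece_color D c' e k"
    using ek(1) by (simp_all add: bad_def)
  note up = stop_height_mono(1) and down = stop_height_mono(2)
  \<comment> \<open>Each strand through a crossing at the upper end of the chosen piece has a piece that reaches further up.\<close>
  have above: "piece_color D c f l = piece_color D c' f l \<or>
      piece_color D c f (Suc l) = piece_color D c' f (Suc l)"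
    if f: "f \<in> edges D" and l: "l < last_piece D f" and h: "stop_height D f (Suc l) = top (e, k)" for f l
  proof (cases "height (src D f) < height (tgt D f)")
    case True
    then have "top (e, k) < top (f, Suc l)"
      using up[OF f, of "Suc l"] l h by (simp add: top_def less_max_iff_disj)
    then show ?thesis using good[OF f, of "Suc l"] l by simp
  next
    case False
    then have "top (e, k) < top (f, l)"
      using down[OF f, of l] edge_not_horizontal[OF generic f] l h by (simp add: top_def less_max_iff_disj)
    then show ?thesis using good[OF f, of l] l by simp
  qed
  \<comment> \<open>The chosen piece is piece l or piece l + 1, according to the direction of its edge.\<close>
  have no_crossing_on_top: False
    if l: "l < last_piece D e" and h: "stop_height D e (Suc l) = top (e, k)" and kl: "k = l \<or> k = Suc l" for l
  proof -
    obtain m where m: "m < last_piece D (partner_list D e ! l)"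
      "partner_list D (partner_list D e ! l) ! m = e" using partner_index[OF l] .
    have "partner_list D e ! l \<in> edges D"
      using l set_partner_list nth_mem partner_edges by metis
    moreover have "stop_height D (partner_list D e ! l) (Suc m) = top (e, k)"
      using crossing_heights[OF l m(1) HOL.refl m(2)] h by simp
    ultimately have "piece_color D c e l = piece_color D c' e l"
      "piece_color D c e (Suc l) = piece_color D c' e (Suc l)"
      using piece_color_across_crossing[OF c l HOL.refl m above[OF e l h]] above m(1) by blast+
    then show False using bad kl by blast
  qed
  show False
  proof (cases "height (src D e) < height (tgt D e)")
    case True
    have top: "top (e, k) = stop_height D e (Suc k)"
      using up[OF e k True] by (simp add: top_def)
    have "k = last_piece D e" using no_crossing_on_top[of k] top k by force
    let ?f = "next_edge D e"
    have f: "?f \<in> edges D" using e by (rule next_edge_in_edges)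
    have top': "top (e, k) = height (src D ?f)"
      using top stop_height_last[of D e] \<open>k = last_piece D e\<close> by (simp add: tgt_def)
    have "piece_color D c ?f 0 \<noteq> piece_color D c' ?f 0"
      using bad piece_color_next[OF c(1) e] piece_color_next[OF c(2) e] \<open>k = last_piece D e\<close> by simp
    then have "\<not> top (e, k) < top (?f, 0)" using good[OF f, of 0] by blast
    moreover have "top (e, k) < top (?f, 0)" if "height (src D ?f) < height (tgt D ?f)"
      unfolding top' using up[OF f le0 that] by (simp add: top_def stop_height_0 less_max_iff_disj)
    ultimately have "\<not> height (src D ?f) < height (tgt D ?f)" by blast
    then have "height (tgt D ?f) < height (src D ?f)" using edge_not_horizontal[OF generic f] by simp
    then have "e \<in> maxima D" using True e by (simp add: maxima_def tgt_def)
    then show False using maxima bad \<open>k = last_piece D e\<close> by simp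
  next
    case False
    then have False': "height (tgt D e) < height (src D e)"
      using edge_not_horizontal[OF generic e] by simp
    have top: "top (e, k) = stop_height D e k"
      using down[OF e k False'] by (simp add: top_def)
    have "k = 0"
    proof (cases k)
      case (Suc l)
      then show ?thesis using no_crossing_on_top[of l] top k by simp
    qed
    obtain f where f: "f \<in> edges D" "next_edge D f = e" using ex_previous_edge[OF e] by blast
    have top': "top (e, k) = height (tgt D f)"
      using top stop_height_0[of D e] \<open>k = 0\<close> by (simp add: tgt_def f(2))
    have bad': "piece_color D c f (last_piece D f) \<noteq> piece_color D c' f (last_piece D f)"
      using bad piece_color_next[OF c(1) f(1)] piece_color_next[OF c(2) f(1)] \<open>k = 0\<close> f(2) by simp
    then have "\<not> top (e, k) < top (f, last_piece D f)" using good[OF f(1) order.refl] by blast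
    moreover have "top (e, k) < top (f, last_piece D f)" if "height (tgt D f) < height (src D f)"
      unfolding top' using down[OF f(1) order.refl that]
      by (simp add: top_def stop_height_last less_max_iff_disj)
    ultimately have "\<not> height (tgt D f) < height (src D f)" by blast
    then have "height (src D f) < height (tgt D f)" using edge_not_horizontal[OF generic f(1)] by simp
    then have "f \<in> maxima D" using False' f by (simp add: maxima_def tgt_def)
    then show False using maxima bad' by simp
  qed
qed

end

section \<open>Isomorphism of the coloring quivers\<close>

context colored_diagram
begin

lemma piece_in_word:
  assumes c: "c \<in> colorings (gauss_of D)" and e: "e \<in> edges D" and k: "k \<le> last_piece D e"
  shows "edge_offset D e + k \<le> length (snd (c ! fst e))"
proof -
  obtain i j where ij: "e = (i, j)" "i < length (comps D)" "j < length (comps D ! i)"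
    using e by (cases e) (auto simp: edges_def)
  let ?g = "\<lambda>j. edge_word D (i, j)"
  have n: "Suc j + (length (comps D ! i) - Suc j) = length (comps D ! i)" using ij(3) by simp
  have "[0..<length (comps D ! i)] = [0..<Suc j] @ [Suc j..<length (comps D ! i)]"
    using upt_add_eq_append[of 0 "Suc j" "length (comps D ! i) - Suc j", OF le0] unfolding n .
  then have "length (concat (map ?g [0..<Suc j])) \<le> length (gauss_of D ! i)"
    unfolding gauss_of_nth[OF ij(2)] by (metis concat_append le_add1 length_append map_append)
  moreover have "edge_offset D e + k \<le> length (concat (map ?g [0..<Suc j]))"
    using k by (simp add: edge_offset_def ij(1) edge_word_partner_list)
  ultimately show ?thesis using coloring_component(1)[OF c ij(2)] ij(1) by simp
qed

lemma edge_component: "e \<in> edges D \<Longrightarrow> fst e < length (comps D)"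
  by (auto simp: edges_def)

lemma piece_color_carrier:
  assumes c: "c \<in> colorings (gauss_of D)" and e: "e \<in> edges D" and k: "k \<le> last_piece D e"
  shows "piece_color D c e k \<in> carrier X"
proof -
  have "piece_color D c e k \<in> set (fst (c ! fst e) # snd (c ! fst e))"
    unfolding piece_color_def using piece_in_word[OF assms] by (intro nth_mem) simp
  then show ?thesis using coloring_component(3,4)[OF c edge_component[OF e]] by auto
qed

lemma piece_color_recolor:
  assumes c: "c \<in> colorings (gauss_of D)" and e: "e \<in> edges D" and k: "k \<le> last_piece D e"
  shows "piece_color D (recolor \<phi> c) e k = \<phi> (piece_color D c e k)"
proof -
  have "fst e < length c" using c edge_component[OF e] by (simp add: colorings_def length_gauss_of)
  then have "piece_color D (recolor \<phi> c) e k = map \<phi> (fst (c ! fst e) # snd (c ! fst e)) ! (edge_offset D e + k)"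
    by (simp add: piece_color_def recolor_def)
  also have "\<dots> = \<phi> (piece_color D c e k)"
    unfolding piece_color_def using piece_in_word[OF assms] by (intro nth_map) simp
  finally show ?thesis .
qed

lemma maxima_edges: "e \<in> maxima D \<Longrightarrow> e \<in> edges D"
  by (simp add: maxima_def)

text \<open>
  Reading off the colors at the local maxima is injective; the hypothesis on the number of colorings
  makes it a bijection onto the full function space.
\<close>

lemma colorings_free_on_maxima:
  assumes generic: "height_generic D"
    and card: "card (colorings (gauss_of D)) = card (carrier X) ^ num_local_maxima D"
  shows "equivariantly_bijective (Hom X X) recolor (colorings (gauss_of D))
    (\<lambda>\<phi> g. compose (maxima D) \<phi> g) (maxima D \<rightarrow>\<^sub>E carrier X)"
proof -
  define F where "F c = (\<lambda>e\<in>maxima D. piece_color D c e (last_piece D e))" for c :: "('a \<times> 'a list) list"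
  have F_apply: "F c e = piece_color D c e (last_piece D e)" if "e \<in> maxima D" for c e
    using that by (simp add: F_def)
  have inj: "inj_on F (colorings (gauss_of D))"
  proof (rule inj_onI)
    fix c c' assume c: "c \<in> colorings (gauss_of D)" "c' \<in> colorings (gauss_of D)" and "F c = F c'"
    then show "c = c'"
      using coloring_determined_by_maxima[OF generic c] F_apply by metis
  qed
  have sub: "F ` colorings (gauss_of D) \<subseteq> maxima D \<rightarrow>\<^sub>E carrier X"
    using piece_color_carrier maxima_edges by (auto simp: F_def)
  have fin': "finite (maxima D \<rightarrow>\<^sub>E carrier X)" using finite_maxima finite_carrier by (rule finite_PiE)
  have "card (F ` colorings (gauss_of D)) = card (maxima D \<rightarrow>\<^sub>E carrier X)"
    using card_image[OF inj] by (simp add: card card_PiE finite_maxima card_maxima)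
  then have "F ` colorings (gauss_of D) = (maxima D \<rightarrow>\<^sub>E carrier X)"
    by (rule card_subset_eq[OF fin' sub])
  then have "bij_betw F (colorings (gauss_of D)) (maxima D \<rightarrow>\<^sub>E carrier X)"
    using inj by (simp add: bij_betw_def)
  moreover have "F (recolor \<phi> c) = compose (maxima D) \<phi> (F c)" if "c \<in> colorings (gauss_of D)" for \<phi> c
    unfolding F_def compose_def
    by (rule restrict_ext) (simp add: piece_color_recolor[OF that] maxima_edges)
  ultimately show ?thesis
    unfolding equivariantly_bijective_def using colorings_Hom by blast
qed

end

lemma equivariantly_bijective_PiE:
  assumes "finite I" "finite J" "card I = card J"
    and \<Phi>: "\<And>\<phi> x. \<phi> \<in> \<Phi> \<Longrightarrow> x \<in> Q \<Longrightarrow> \<phi> x \<in> Q"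
  shows "equivariantly_bijective \<Phi> (\<lambda>\<phi> g. compose I \<phi> g) (I \<rightarrow>\<^sub>E Q)
    (\<lambda>\<phi> g. compose J \<phi> g) (J \<rightarrow>\<^sub>E Q)"
proof -
  obtain h where h: "bij_betw h J I" using finite_same_card_bij[OF assms(2,1)] assms(3) by metis
  then have hJ: "h j \<in> I" if "j \<in> J" for j using that by (auto simp: bij_betw_def)
  have onto: "\<exists>j\<in>J. i = h j" if "i \<in> I" for i using that h by (auto simp: bij_betw_def)
  define R where "R g g' \<longleftrightarrow> (\<forall>j\<in>J. g' j = g (h j))" for g :: "'a \<Rightarrow> 'c" and g' :: "'b \<Rightarrow> 'c"
  show ?thesis
  proof (rule equivariantly_bijectiveI[where R = R])
    fix g assume g: "g \<in> I \<rightarrow>\<^sub>E Q"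
    then have "restrict (g \<circ> h) J \<in> J \<rightarrow>\<^sub>E Q" using hJ by auto
    then show "\<exists>g'\<in>J \<rightarrow>\<^sub>E Q. R g g'" by (rule bexI[rotated]) (simp add: R_def)
  next
    fix g' assume g': "g' \<in> J \<rightarrow>\<^sub>E Q"
    let ?k = "inv_into J h"
    have "restrict (g' \<circ> ?k) I \<in> I \<rightarrow>\<^sub>E Q"
      using g' h by (auto simp: bij_betw_def inv_into_into)
    moreover have "R (restrict (g' \<circ> ?k) I) g'"
      using hJ h by (simp add: R_def bij_betw_inv_into_left)
    ultimately show "\<exists>g\<in>I \<rightarrow>\<^sub>E Q. R g g'" by blast
  next
    fix g' g'' and g assume "g' \<in> J \<rightarrow>\<^sub>E Q" "g'' \<in> J \<rightarrow>\<^sub>E Q" "R g g'" "R g g''"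
    then show "g' = g''" by (intro PiE_ext) (auto simp: R_def)
  next
    fix g g' :: "'a \<Rightarrow> 'c" and g'' :: "'b \<Rightarrow> 'c"
    assume g: "g \<in> I \<rightarrow>\<^sub>E Q" "g' \<in> I \<rightarrow>\<^sub>E Q" and R: "R g g''" "R g' g''"
    show "g = g'"
    proof (rule PiE_ext[OF g])
      fix i assume "i \<in> I"
      then obtain j where "j \<in> J" "i = h j" using onto by blast
      then show "g i = g' i" using R by (simp add: R_def)
    qed
  next
    fix \<phi> g g' assume "\<phi> \<in> \<Phi>" "g' \<in> J \<rightarrow>\<^sub>E Q" "R g g'"
    then show "compose J \<phi> g' \<in> J \<rightarrow>\<^sub>E Q \<and> R (compose I \<phi> g) (compose J \<phi> g')"
      using \<Phi> hJ by (auto simp: compose_def R_def)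
  qed (use \<Phi> in \<open>auto simp: compose_def\<close>)
qed

lemma equivariantly_bijective_card:
  "equivariantly_bijective \<Phi> act A act' B \<Longrightarrow> card A = card B"
  unfolding equivariantly_bijective_def using bij_betw_same_card by blast

text \<open>
  The arcs are pairs of a vertex and an endomorphism, and the target of an arc is given by the action.
  So an equivariant bijection of the vertices, together with the identity on endomorphisms, is an
  isomorphism.
\<close>

lemma digraph_iso_coloring_quiver:
  assumes bij: "equivariantly_bijective (Hom X X)
      (\<lambda>\<phi> v. compose (carrier (fundamental_biquandle D1)) \<phi> v) (Hom (fundamental_biquandle D1) X)
      (\<lambda>\<phi> v. compose (carrier (fundamental_biquandle D2)) \<phi> v) (Hom (fundamental_biquandle D2) X)"
    and S: "S \<subseteq> Hom X X"
  shows "digraph_iso (coloring_quiver X S D1) (coloring_quiver X S D2)"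
proof -
  let ?G1 = "coloring_quiver X S D1" and ?G2 = "coloring_quiver X S D2"
  let ?act1 = "\<lambda>\<phi> v. compose (carrier (fundamental_biquandle D1)) \<phi> v"
  let ?act2 = "\<lambda>\<phi> v. compose (carrier (fundamental_biquandle D2)) \<phi> v"
  obtain F where F: "bij_betw F (Hom (fundamental_biquandle D1) X) (Hom (fundamental_biquandle D2) X)"
    and equivariant: "\<And>\<phi> v. \<phi> \<in> S \<Longrightarrow> v \<in> Hom (fundamental_biquandle D1) X \<Longrightarrow>
        F (?act1 \<phi> v) = ?act2 \<phi> (F v)"
    and closed: "\<And>\<phi> v. \<phi> \<in> S \<Longrightarrow> v \<in> Hom (fundamental_biquandle D1) X \<Longrightarrow>
        ?act1 \<phi> v \<in> Hom (fundamental_biquandle D1) X"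
    using bij S unfolding equivariantly_bijective_def by blast
  define f where "f = \<lparr>iso_verts = F, iso_arcs = (\<lambda>(v, \<phi>). (F v, \<phi>)),
    iso_head = head ?G2, iso_tail = tail ?G2\<rparr>"
  have "wf_digraph ?G1"
    by unfold_locales (auto simp: coloring_quiver_def closed)
  moreover have "inj_on (\<lambda>(v, \<phi>). (F v, \<phi>)) (Hom (fundamental_biquandle D1) X \<times> S)"
    using F by (auto simp: bij_betw_def inj_on_def)
  ultimately have "pre_digraph.digraph_isomorphism ?G1 f"
    using F equivariant unfolding pre_digraph.digraph_isomorphism_def
    by (auto simp: f_def coloring_quiver_def bij_betw_def)
  moreover have "(\<lambda>(v, \<phi>). (F v, \<phi>)) ` (Hom (fundamental_biquandle D1) X \<times> S) =
      Hom (fundamental_biquandle D2) X \<times> S"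
    using F by (force simp: bij_betw_def)
  then have "?G2 = app_iso f ?G1"
    using F by (simp add: app_iso_def f_def coloring_quiver_def bij_betw_def)
  ultimately show ?thesis unfolding digraph_iso_def by blast
qed

context finite_biquandle
begin

lemma same_colorings_diagram_move:
  assumes "diagram_move D D'"
  shows "same_colorings (gauss_of D) (gauss_of D')"
proof -
  interpret D: link_diagram D using assms by unfold_locales (simp add: diagram_move_def)
  interpret D': link_diagram D' using assms by unfold_locales (simp add: diagram_move_def)
  consider "gauss_iso (gauss_of D) (gauss_of D')"
    | G G' :: "(edge \<times> edge) gauss" where "gauss_iso (gauss_of D) G" "reidemeister G G'"
      "gauss_iso G' (gauss_of D')"
    using assms unfolding diagram_move_def by blast
  then show ?thesis
  proof cases
    case 1
    then show ?thesis by (rule same_colorings_gauss_iso)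
  next
    case 2
    have "simple_gauss G" "simple_gauss G'"
      using gauss_iso_simple_gauss[OF 2(1)] gauss_iso_simple_gauss[OF 2(3)] D.simple_gauss_of D'.simple_gauss_of
      by simp_all
    then have "same_colorings G G'" by (rule same_colorings_reidemeister[OF 2(2)])
    from equivariantly_bijective_trans[OF equivariantly_bijective_trans[OF
          same_colorings_gauss_iso[OF 2(1)] this] same_colorings_gauss_iso[OF 2(3)]]
    show ?thesis .
  qed
qed

lemma same_colorings_link:
  assumes "equivclp diagram_move D D'"
  shows "same_colorings (gauss_of D) (gauss_of D')"
  using assms
proof (induction rule: equivclp_induct)
  case base
  show ?case by (rule equivariantly_bijective_refl) (rule colorings_Hom)
next
  case (step E E')
  then have "same_colorings (gauss_of E) (gauss_of E')"
    using same_colorings_diagram_move equivariantly_bijective_sym by blast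
  then show ?case using step.IH equivariantly_bijective_trans by blast
qed

text \<open>
  The chain of equivariant bijections: homomorphisms, colorings of the given diagram, colorings of a
  diagram in which the second bridge index is attained, colors at its local maxima.
\<close>

lemma Hom_free:
  assumes L: "L \<in> virtual_links" "D \<in> L"
    and card: "card (Hom (fundamental_biquandle D) X) = card (carrier X) ^ second_bridge_index L"
    and q: "q \<in> carrier X"
  shows "\<exists>I :: edge set. finite I \<and> card I = second_bridge_index L \<and>
    equivariantly_bijective (Hom X X)
      (\<lambda>\<phi> v. compose (carrier (fundamental_biquandle D)) \<phi> v) (Hom (fundamental_biquandle D) X)
      (\<lambda>\<phi> g. compose I \<phi> g) (I \<rightarrow>\<^sub>E carrier X)"
proof -
  obtain D' where D': "D' \<in> L" "height_generic D'" "num_local_maxima D' = second_bridge_index L"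
    using second_bridge_index_attained[OF L] by blast
  interpret colored_diagram X D' by unfold_locales (rule virtual_linkD(1)[OF L(1) D'(1)])
  have "equivclp diagram_move D D'" using virtual_linkD(2)[OF L] D'(1) by blast
  from equivariantly_bijective_trans[OF Hom_colorings[OF q] same_colorings_link[OF this]]
  have *: "equivariantly_bijective (Hom X X)
      (\<lambda>\<phi> v. compose (carrier (fundamental_biquandle D)) \<phi> v) (Hom (fundamental_biquandle D) X)
      recolor (colorings (gauss_of D'))" .
  have "card (colorings (gauss_of D')) = card (carrier X) ^ num_local_maxima D'"
    using equivariantly_bijective_card[OF *] card D'(3) by simp
  from equivariantly_bijective_trans[OF * colorings_free_on_maxima[OF D'(2) this]]
  show ?thesis
    using card_maxima[of D'] D'(3) finite_maxima by (intro exI[of _ "maxima D'"]) simp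
qed

end

theorem lemma1p2:
  fixes X :: "'a biquandle_struct"
    and L1 L2 :: "vdiagram set"
    and D1 D2 :: vdiagram
  assumes "biquandle X" and "finite (carrier X)"
    and "L1 \<in> virtual_links" and "L2 \<in> virtual_links"
    and "D1 \<in> L1" and "D2 \<in> L2"
    and "card (Hom (fundamental_biquandle D1) X) = card (carrier X) ^ second_bridge_index L1"
    and "card (Hom (fundamental_biquandle D2) X) = card (carrier X) ^ second_bridge_index L2"
    and "card (Hom (fundamental_biquandle D1) X) = card (Hom (fundamental_biquandle D2) X)"
  shows "\<forall>S \<subseteq> Hom X X. digraph_iso (coloring_quiver X S D1) (coloring_quiver X S D2)"
proof -
  interpret biquandle X by (rule assms(1))
  interpret finite_biquandle X by unfold_locales (rule assms(2))
  let ?F1 = "fundamental_biquandle D1" and ?F2 = "fundamental_biquandle D2"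
  have "equivariantly_bijective (Hom X X) (\<lambda>\<phi> v. compose (carrier ?F1) \<phi> v) (Hom ?F1 X)
      (\<lambda>\<phi> v. compose (carrier ?F2) \<phi> v) (Hom ?F2 X)"
  \<comment> \<open>If X has at most one element, then there is at most one coloring; the exponents need not agree in this case.\<close>
  proof (cases "card (carrier X) \<le> 1")
    case True
    then have point: "x = y" if "x \<in> carrier X" "y \<in> carrier X" for x y
      using that assms(2) by (auto simp: card_le_Suc0_iff_eq)
    have unique: "v = w" if "v \<in> Hom (fundamental_biquandle D) X" "w \<in> Hom (fundamental_biquandle D) X"
      for v w D
    proof -
      let ?A = "carrier (fundamental_biquandle D)"
      have vw: "v \<in> ?A \<rightarrow>\<^sub>E carrier X" "w \<in> ?A \<rightarrow>\<^sub>E carrier X" using that by (simp_all add: Hom_def)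
      show ?thesis
        by (rule PiE_ext[OF vw]) (rule point[OF PiE_mem[OF vw(1)] PiE_mem[OF vw(2)]])
    qed
    have fin: "finite (Hom (fundamental_biquandle D) X)" for D
    proof (cases "Hom (fundamental_biquandle D) X = {}")
      case False
      then obtain v where "v \<in> Hom (fundamental_biquandle D) X" by blast
      then have "Hom (fundamental_biquandle D) X \<subseteq> {v}" using unique by blast
      then show ?thesis by (rule finite_subset) simp
    qed simp
    have "Hom ?F1 X = {} \<longleftrightarrow> Hom ?F2 X = {}"
      using assms(9) fin[of D1] fin[of D2] card_eq_0_iff by metis
    then show ?thesis
      using unique Hom_presented_compose unfolding fundamental_biquandle_def
      by (intro equivariantly_bijectiveI[where R = "\<lambda>_ _. True"]) (blast, blast, blast, blast, blast, blast)
  next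
    case False
    then obtain q where q: "q \<in> carrier X" by force
    obtain I1 :: "edge set" where I1: "finite I1" "card I1 = second_bridge_index L1"
      "equivariantly_bijective (Hom X X) (\<lambda>\<phi> v. compose (carrier ?F1) \<phi> v) (Hom ?F1 X)
        (\<lambda>\<phi> g. compose I1 \<phi> g) (I1 \<rightarrow>\<^sub>E carrier X)"
      using Hom_free[OF assms(3,5,7) q] by blast
    obtain I2 :: "edge set" where I2: "finite I2" "card I2 = second_bridge_index L2"
      "equivariantly_bijective (Hom X X) (\<lambda>\<phi> v. compose (carrier ?F2) \<phi> v) (Hom ?F2 X)
        (\<lambda>\<phi> g. compose I2 \<phi> g) (I2 \<rightarrow>\<^sub>E carrier X)"
      using Hom_free[OF assms(4,6,8) q] by blast
    have "card (carrier X) ^ card I1 = card (carrier X) ^ card I2"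
      using assms(7-9) I1(2) I2(2) by simp
    then have "card I1 = card I2" using False by (simp add: power_inject_exp)
    from equivariantly_bijective_PiE[OF I1(1) I2(1) this, of "Hom X X" "carrier X"]
    have "equivariantly_bijective (Hom X X) (\<lambda>\<phi> g. compose I1 \<phi> g) (I1 \<rightarrow>\<^sub>E carrier X)
        (\<lambda>\<phi> g. compose I2 \<phi> g) (I2 \<rightarrow>\<^sub>E carrier X)"
      using Hom_carrier by blast
    from equivariantly_bijective_trans[OF equivariantly_bijective_trans[OF I1(3) this]
        equivariantly_bijective_sym[OF I2(3)]]
    show ?thesis .
  qed
  then show ?thesis using digraph_iso_coloring_quiver by blast
qed

end
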